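(* Let $r$ be a rational function and let $c=A_r$ be the number of finite attracting fixed points of $\bar r$. Then there exists an unbounded quadrature domain with quadrature function $r$ whose connectivity is $\ge c$.
   Context: A finite fixed point of $\bar r$ is a point $z\in\mathbb C$ with $r(z)=\bar z$; it is attracting if $|r'(z)|<1$. A domain $\Omega\subset\widehat{\mathbb C}$ with $\infty\in\Omega$ and $\mathop{\rm int}\mathop{\rm clos}\Omega=\Omega$ is an unbounded quadrature domain with quadrature function $r$ if all poles of $r$ lie in $\Omega$ and $\int_\Omega f\,dA=\frac1{2i}\oint_{\partial\Omega}f(z)r(z)\,dz$ (area integral in principal value sense) for every $f$ analytic in $\Omega$, continuous up to the boundary, with $f(\infty)=0$. The connectivity of $\Omega$ is the number of connected components of $\widehat{\mathbb C}\setminus\Omega$. *)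

theory Defs
  imports "HOL-Complex_Analysis.Complex_Analysis"
          "HOL-Computational_Algebra.Polynomial"
          "HOL-Library.Extended_Nat"
begin

text \<open>A rational function is represented as a reduced quotient p/q of complex
polynomials (q nonzero, p and q coprime); its finite poles are the roots of q.\<close>

definition rat_fun :: "complex poly \<Rightarrow> complex poly \<Rightarrow> complex \<Rightarrow> complex" where
  "rat_fun p q = (\<lambda>z. poly p z / poly q z)"

definition attracting_fixed_points :: "complex poly \<Rightarrow> complex poly \<Rightarrow> complex set" where
  "attracting_fixed_points p q =
     {z. poly q z \<noteq> 0 \<and> rat_fun p q z = cnj z \<and> norm (deriv (rat_fun p q) z) < 1}"

text \<open>An unbounded domain \<Omega> of the Riemann sphere with \<infinity> in \<Omega> is represented by
its finite part \<Omega>0 = \<Omega> \<inter> \<complex>; the complement of \<Omega> in the sphere is the compact set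
- \<Omega>0. \<Omega> is open and connected iff \<Omega>0 is open, connected and has bounded complement.\<close>

definition unbounded_domain :: "complex set \<Rightarrow> bool" where
  "unbounded_domain \<Omega>0 \<longleftrightarrow> open \<Omega>0 \<and> connected \<Omega>0 \<and> \<Omega>0 \<noteq> {} \<and> bounded (- \<Omega>0)
      \<and> interior (closure \<Omega>0) = \<Omega>0"

text \<open>A boundary cycle: finitely many closed piecewise-C1 paths whose images make up
the boundary, oriented positively with respect to \<Omega> (winding number 0 at points of \<Omega>,
-1 at points of the interior of the complement).\<close>

definition boundary_cycle :: "complex set \<Rightarrow> (real \<Rightarrow> complex) list \<Rightarrow> bool" where
  "boundary_cycle \<Omega>0 \<gamma>s \<longleftrightarrow>
     (\<forall>\<gamma>\<in>set \<gamma>s. valid_path \<gamma> \<and> pathfinish \<gamma> = pathstart \<gamma>)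
     \<and> (\<Union>\<gamma>\<in>set \<gamma>s. path_image \<gamma>) = frontier \<Omega>0
     \<and> (\<forall>w. w \<notin> frontier \<Omega>0 \<longrightarrow>
           (\<Sum>\<gamma>\<leftarrow>\<gamma>s. winding_number \<gamma> w) = (if w \<in> \<Omega>0 then 0 else -1))"

definition boundary_integral :: "(real \<Rightarrow> complex) list \<Rightarrow> (complex \<Rightarrow> complex) \<Rightarrow> complex" where
  "boundary_integral \<gamma>s g = (\<Sum>\<gamma>\<leftarrow>\<gamma>s. contour_integral \<gamma> g)"

definition test_function :: "complex set \<Rightarrow> (complex \<Rightarrow> complex) \<Rightarrow> bool" where
  "test_function \<Omega>0 f \<longleftrightarrow> f holomorphic_on \<Omega>0 \<and> continuous_on (closure \<Omega>0) f
     \<and> (\<lambda>w. if w = 0 then 0 else f (inverse w)) analytic_on {0}"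

definition pv_area_integral_is :: "complex set \<Rightarrow> (complex \<Rightarrow> complex) \<Rightarrow> complex \<Rightarrow> bool" where
  "pv_area_integral_is \<Omega>0 f I \<longleftrightarrow>
     ((\<lambda>R::real. integral (\<Omega>0 \<inter> ball 0 R) f) \<longlongrightarrow> I) at_top"

definition unbounded_quadrature_domain ::
  "complex set \<Rightarrow> (complex \<Rightarrow> complex) \<Rightarrow> (complex \<Rightarrow> bool) \<Rightarrow> bool" where
  "unbounded_quadrature_domain \<Omega>0 r is_pole_pt \<longleftrightarrow>
     unbounded_domain \<Omega>0 \<and> (\<forall>z. is_pole_pt z \<longrightarrow> z \<in> \<Omega>0)
     \<and> (\<exists>\<gamma>s. boundary_cycle \<Omega>0 \<gamma>s \<and>
          (\<forall>f. test_function \<Omega>0 f \<longrightarrow>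
             pv_area_integral_is \<Omega>0 f
               (boundary_integral \<gamma>s (\<lambda>z. f z * r z) / (2 * \<i>))))"

definition connectivity :: "complex set \<Rightarrow> enat" where
  "connectivity \<Omega>0 = (if finite (components (- \<Omega>0)) then enat (card (components (- \<Omega>0))) else \<infinity>)"

end

theory Submission
  imports Defs "HOL-Probability.Discrete_Topology"
begin

text \<open>
  Let \<open>a\<^sub>1, \<dots>, a\<^sub>n\<close> be the attracting fixed points. The complement of the domain consists of
  \<open>n\<close> small cells \<open>K\<^sub>j\<close> around them. The exterior of \<open>K\<^sub>j\<close> is the image of \<open>|s| > 1\<close> under
  \<open>\<phi>\<^sub>j(s) = a\<^sub>j + t(s + cnj h\<^sub>j(1 / cnj s))\<close> with \<open>h\<^sub>j\<close> holomorphic on a disc of radius \<open>N > 1\<close>. The domain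
  is a quadrature domain for \<open>r\<close> if on each \<open>\<partial>K\<^sub>j\<close> one has \<open>cnj z = r(z) + c\<^sub>1(z) + \<dots> + c\<^sub>n(z)\<close>, where
  \<open>c\<^sub>l\<close> is the Cauchy transform of \<open>K\<^sub>l\<close>. In the coordinate \<open>s\<close> this says that
  \<open>cnj a\<^sub>j + t h\<^sub>j\<close> is the part of \<open>(r + \<Sum>\<^sub>l c\<^sub>l) \<circ> \<phi>\<^sub>j\<close> (sum over \<open>l \<noteq> j\<close>) with nonnegative powers of \<open>s\<close>.
  Since \<open>c\<^sub>l = O(t\<^sup>2)\<close> away from \<open>K\<^sub>l\<close> and \<open>|r'(a\<^sub>j)| < 1\<close>, for small \<open>t\<close> this is a contraction, and its
  fixed point satisfies \<open>h\<^sub>j(s) = r'(a\<^sub>j) s + O(t)\<close>; thus \<open>K\<^sub>j\<close> is nearly an ellipse.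

  On the closed disc \<open>s + cnj h\<^sub>j(s)\<close> extends the boundary values of \<open>\<phi>\<^sub>j\<close>. Glued together the two maps
  are the identity plus a contraction of the plane, hence a homeomorphism, which gives the topology of
  the cells and all winding numbers. The quadrature identity itself needs no Green's theorem: the
  disc potential \<open>\<integral>\<^bsub>|\<xi>| < R\<^esub> dA(\<xi>) / (z - \<xi>) = \<pi> cnj z\<close> and Fubini turn \<open>\<ointegral> f(z) cnj z dz\<close> into the area
  integral of a Cauchy integral of \<open>f\<close>.
\<close>

section \<open>The Cauchy kernel and area measure\<close>

text \<open>In the sup norm, the projection onto nonnegative powers is not bounded on the circle
  that carries the data. Hence the unknown lives on \<open>|s| = N\<close>, while its projection is
  read only for \<open>|s| \<le> 1\<close>: the reflection \<open>1 / cnj s\<close> in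
  \<open>\<phi>\<^sub>j\<close> sends \<open>|s| = N\<close> to \<open>|s| = 1 / N\<close>. The loss
  is then \<open>N\<^sup>2 / (N\<^sup>2 - 1)\<close>, and strict attraction leaves room for it.

  The homeomorphism needs more than a solution: the derivative of \<open>h\<^sub>j\<close> must stay
  below 1 on the whole closed disc, where the crude Cauchy estimate loses a factor 2. Only a small
  error pays that factor; the linear part of \<open>r\<close> contributes exactly
  \<open>r'(a\<^sub>j)\<close>, because \<open>\<phi>\<^sub>j(s) - a\<^sub>j\<close> has
  \<open>t s\<close> as its only positive power.

  Test functions are merely continuous at the boundary. So boundary integrals are shown to vanish
  first on the curves \<open>|s| = r > 1\<close>, which lie in the domain, and then for
  \<open>r = 1\<close> by a limit. This limit also requires versions of the Cauchy transforms that
  are continuous up to the boundary.\<close>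

definition to_plane :: "real^2 \<Rightarrow> complex" where
  "to_plane v = Complex (v$1) (v$2)"

text \<open>Invariance of area under orthogonal maps is the fact
  \<open>measure_orthogonal_image\<close> on \<open>real^2\<close>; this identity carries it over to
  the complex plane.\<close>

lemma lborel_to_plane: "lborel = distr lborel borel to_plane"
proof (rule lborel_eqI)
  have cont: "continuous_on UNIV to_plane"
    unfolding to_plane_def Complex_eq by (intro continuous_intros)
  then have meas: "to_plane \<in> borel_measurable borel"
    by (rule borel_measurable_continuous_onI)
  show "sets (distr lborel borel to_plane) = sets borel" by simp
  fix l u :: complex
  assume lu: "\<And>b. b \<in> Basis \<Longrightarrow> l \<bullet> b \<le> u \<bullet> b"
  have eq: "to_plane -` box l u = box (vector [Re l, Im l]) (vector [Re u, Im u] :: real^2)"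
    by (auto simp: box_def to_plane_def Basis_complex_def Basis_vec_def forall_2 inner_axis)
  have le: "Re l \<le> Re u" "Im l \<le> Im u"
    using lu[of 1] lu[of \<i>] by (auto simp: Basis_complex_def)
  have bas: "(Basis :: (real^2) set) = {axis 1 1, axis 2 1}"
    by (auto simp: Basis_vec_def UNIV_2)
  have ne: "axis 1 1 \<noteq> (axis 2 1 :: real^2)" by (simp add: axis_eq_axis)
  have "emeasure (distr lborel borel to_plane) (box l u) = emeasure lborel (to_plane -` box l u)"
    using meas by (subst emeasure_distr) auto
  also have "\<dots> = (Re u - Re l) * (Im u - Im l)"
    unfolding eq using le ne by (subst emeasure_lborel_box) (auto simp: bas inner_axis)
  also have "\<dots> = (\<Prod>b\<in>Basis. (u - l) \<bullet> b)"
    by (simp add: Basis_complex_def)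
  finally show "emeasure (distr lborel borel to_plane) (box l u) = (\<Prod>b\<in>Basis. (u - l) \<bullet> b)" .
qed

text \<open>Seen through \<open>to_plane\<close>, the preimage of a box under multiplication by
  \<open>c\<close> is the image of the box under the isometry \<open>f\<close>, the rotation by
  \<open>cnj c\<close>. Both have the same area, and boxes determine the measure.\<close>

lemma lborel_rotate:
  fixes c :: complex
  assumes "norm c = 1"
  shows "lborel = distr lborel borel ((*) c)"
proof (rule lborel_eqI)
  have meas: "(*) c \<in> borel_measurable borel" by simp
  have measT: "to_plane \<in> borel_measurable borel"
    unfolding to_plane_def Complex_eq by (intro borel_measurable_continuous_onI continuous_intros)
  show "sets (distr lborel borel ((*) c)) = sets borel" by simp
  fix l u :: complex
  assume lu: "\<And>b. b \<in> Basis \<Longrightarrow> l \<bullet> b \<le> u \<bullet> b"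
  define f :: "real^2 \<Rightarrow> real^2" where
    "f v = (let z = cnj c * to_plane v in vector [Re z, Im z])" for v
  have cc: "c * cnj c = 1" using assms by (simp add: complex_norm_square[symmetric])
  have Tf: "to_plane (f v) = cnj c * to_plane v" for v
    by (simp add: f_def Let_def to_plane_def complex_eq_iff)
  have injT: "to_plane v = to_plane w \<longleftrightarrow> v = w" for v w
    by (auto simp: to_plane_def vec_eq_iff forall_2)
  have nT: "norm (to_plane v) = norm v" for v
    by (simp add: to_plane_def norm_vec_def L2_set_def UNIV_2 cmod_def)
  have lin: "linear f"
    by (rule linearI) (simp_all add: f_def Let_def to_plane_def vec_eq_iff forall_2 algebra_simps)
  have nf: "norm (f v) = norm v" for v
    using assms by (simp add: nT[symmetric] Tf norm_mult)
  have orth: "orthogonal_transformation f"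
    using lin nf by (simp add: orthogonal_transformation)
  have im: "to_plane -` ((*) c -` B) = f ` (to_plane -` B)" for B
  proof (intro equalityI subsetI)
    fix v assume v: "v \<in> to_plane -` ((*) c -` B)"
    define w :: "real^2" where "w = vector [Re (c * to_plane v), Im (c * to_plane v)]"
    have Tw: "to_plane w = c * to_plane v" by (simp add: w_def to_plane_def complex_eq_iff)
    moreover have "f w = v"
      using cc by (subst injT[symmetric]) (simp add: Tf Tw mult.assoc[symmetric] mult.commute)
    ultimately show "v \<in> f ` (to_plane -` B)" using v by (metis image_eqI vimage_eq)
  next
    fix v assume "v \<in> f ` (to_plane -` B)"
    then obtain w where "v = f w" "to_plane w \<in> B" by auto
    then show "v \<in> to_plane -` ((*) c -` B)"
      using cc by (simp add: Tf mult.assoc[symmetric])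
  qed
  let ?B = "to_plane -` box l u"
  have mB: "?B \<in> sets borel" using measT by (simp add: measurable_sets_borel)
  have bd: "bounded ?B"
  proof -
    obtain b where "\<And>x. x \<in> box l u \<Longrightarrow> norm x \<le> b"
      using bounded_box[of l u] by (auto simp: bounded_iff)
    then show ?thesis by (auto simp: bounded_iff nT[symmetric])
  qed
  have lm: "?B \<in> lmeasurable"
    using mB bd by (intro bounded_set_imp_lmeasurable) auto
  have "emeasure (distr lborel borel ((*) c)) (box l u) = emeasure lborel ((*) c -` box l u)"
    using meas by (subst emeasure_distr) auto
  also have "\<dots> = emeasure lborel (to_plane -` ((*) c -` box l u))"
    using measT measurable_sets_borel[OF meas] by (subst lborel_to_plane, subst emeasure_distr) auto
  also have "\<dots> = emeasure lebesgue (f ` ?B)"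
    using measurable_sets_borel[OF measT measurable_sets_borel[OF meas, of "box l u"]]
    unfolding im[symmetric] by simp
  also have "\<dots> = emeasure lebesgue ?B"
    using measure_orthogonal_image[OF orth lm] measurable_orthogonal_image[OF orth lm] lm
    by (simp add: emeasure_eq_measure2)
  also have "\<dots> = emeasure lborel ?B" using mB by simp
  also have "\<dots> = emeasure lborel (box l u)"
    using measT by (subst lborel_to_plane, subst emeasure_distr) auto
  also have "\<dots> = (\<Prod>b\<in>Basis. (u - l) \<bullet> b)" using lu by simp
  finally show "emeasure (distr lborel borel ((*) c)) (box l u) = (\<Prod>b\<in>Basis. (u - l) \<bullet> b)" .
qed

text \<open>Dyadic decomposition around \<open>w\<close>; the point is that the bound does not depend on \<open>w\<close>.\<close>

lemma nn_integral_inverse_norm_le: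
  fixes w :: complex and R :: real
  shows "(\<integral>\<^sup>+\<xi>. ennreal (indicator (ball 0 R) \<xi> * inverse (norm (w - \<xi>))) \<partial>lborel)
     \<le> ennreal (pi * R\<^sup>2) + ennreal (4 * pi)"
proof -
  have eb: "emeasure lborel (ball (c::complex) r) = ennreal (pi * r\<^sup>2)" if "r \<ge> 0" for c r
    using emeasure_ball[of r c] that by (simp add: unit_ball_vol_2)
  have [measurable]: "ball (c::complex) r \<in> sets borel" for c r by simp
  have eb': "emeasure lborel (ball (c::complex) R) \<le> ennreal (pi * R\<^sup>2)" for c
    by (cases "R \<ge> 0") (auto simp: eb ball_empty)
  have pw: "ennreal (indicator (ball 0 R) \<xi> * inverse (norm (w - \<xi>))) \<le>
      indicator (ball 0 R) \<xi> + (\<Sum>n. ennreal (2 * 2^n) * indicator (ball w ((1/2)^n)) \<xi>)" for \<xi>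
  \<comment> \<open>The point \<open>\<xi> = w\<close> joins the harmless case, since
    \<open>inverse 0 = 0\<close>.\<close>
  proof (cases "norm (w - \<xi>) = 0 \<or> norm (w - \<xi>) \<ge> 1")
    case True
    then have "inverse (norm (w - \<xi>)) \<le> 1" by (auto simp: inverse_le_1_iff)
    then have "ennreal (indicator (ball 0 R) \<xi> * inverse (norm (w - \<xi>))) \<le> indicator (ball 0 R) \<xi>"
      by (auto simp: indicator_def)
    then show ?thesis by (simp add: add_increasing2)
  next
    case False
    define d where "d = norm (w - \<xi>)"
    have d: "0 < d" "d < 1" using False by (auto simp: d_def)
    define n where "n = (LEAST n. (1/2)^n \<le> d)"
    have ex: "\<exists>n. (1/2)^n \<le> d"
      using real_arch_pow_inv[of d "1/2"] d by (auto intro: less_imp_le)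
    have n1: "(1/2)^n \<le> d" unfolding n_def by (rule LeastI_ex[OF ex])
    have "n \<noteq> 0" using n1 d by (cases n) auto
    then obtain m where m: "n = Suc m" by (cases n) auto
    have n2: "d < (1/2)^m"
      using not_less_Least[of m "\<lambda>n. (1/2)^n \<le> d"] m by (simp add: n_def[symmetric] not_le)
    have "inverse d \<le> inverse ((1/2)^n)" using n1 by (intro le_imp_inverse_le) auto
    then have inv: "inverse d \<le> 2 * 2^m" by (simp add: m power_one_over inverse_eq_divide)
    have "ennreal (indicator (ball 0 R) \<xi> * inverse d) \<le> ennreal (2 * 2^m)"
      using inv d by (intro ennreal_leI) (auto simp: indicator_def)
    also have "\<dots> = ennreal (2 * 2^m) * indicator (ball w ((1/2)^m)) \<xi>"
      using n2 by (simp add: d_def dist_norm)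
    also have "\<dots> \<le> (\<Sum>n. ennreal (2 * 2^n) * indicator (ball w ((1/2)^n)) \<xi>)"
      (is "?g m \<le> suminf ?g")
    proof -
      have "sum ?g {m} \<le> suminf ?g" by (rule sum_le_suminf) auto
      then show ?thesis by (simp only: sum.insert sum.empty finite.emptyI empty_iff not_False_eq_True add_0_right)
    qed
    finally show ?thesis by (simp add: d_def add_increasing)
  qed
  have "(\<integral>\<^sup>+\<xi>. ennreal (indicator (ball 0 R) \<xi> * inverse (norm (w - \<xi>))) \<partial>lborel)
     \<le> (\<integral>\<^sup>+\<xi>. indicator (ball 0 R) \<xi> + (\<Sum>n. ennreal (2 * 2^n) * indicator (ball w ((1/2)^n)) \<xi>) \<partial>lborel)"
    by (intro nn_integral_mono pw)
  also have "\<dots> = emeasure lborel (ball (0::complex) R)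
      + (\<Sum>n. ennreal (2 * 2^n) * emeasure lborel (ball w ((1/2)^n)))"
    by (subst nn_integral_add) (auto simp: nn_integral_suminf nn_integral_cmult_indicator)
  also have "(\<Sum>n. ennreal (2 * 2^n) * emeasure lborel (ball w ((1/2)^n))) = (\<Sum>n. ennreal (2 * pi * (1/2)^n))"
  proof (rule arg_cong[where f = suminf], rule ext)
    fix n
    have "2 * 2^n * (pi * ((1/2)^n)\<^sup>2) = 2 * pi * (1/2)^n * (2^n * (1/2)^n :: real)"
      by (simp add: power2_eq_square)
    also have "2^n * (1/2)^n = (1::real)" by (simp add: power_mult_distrib[symmetric])
    finally show "ennreal (2 * 2^n) * emeasure lborel (ball w ((1/2)^n)) = ennreal (2 * pi * (1/2)^n)"
      by (simp add: eb ennreal_mult[symmetric])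
  qed
  also have "\<dots> = ennreal (4 * pi)"
  proof (rule suminf_ennreal_eq)
    have "(\<lambda>n. (1/2)^n) sums (1 / (1 - 1/2) :: real)" by (rule geometric_sums) simp
    from sums_mult[OF this, of "2 * pi"] show "(\<lambda>n. 2 * pi * (1/2)^n) sums (4 * pi)" by simp
  qed auto
  finally show ?thesis using eb'[of 0] by (meson add_right_mono order_trans)
qed

section \<open>The Cauchy transform of a disc\<close>

definition disc_potential :: "real \<Rightarrow> complex \<Rightarrow> complex" where
  "disc_potential R w = (\<integral>\<xi>. indicator (ball 0 R) \<xi> *\<^sub>R (1 / (w - \<xi>)) \<partial>lborel)"

text \<open>The uniform bound of \<open>nn_integral_inverse_norm_le\<close> makes the kernel
  absolutely integrable in both variables, although the curve \<open>w\<close> may run through the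
  disc. This serves twice: for the average over rotations that computes
  \<open>disc_potential\<close>, and for the area integral of a Cauchy integral.\<close>

lemma
  fixes b w :: "real \<Rightarrow> complex"
  assumes b: "continuous_on {0..1} b" and w: "continuous_on {0..1} w"
  shows cauchy_kernel_Fubini_integrable: "integrable lborel (\<lambda>\<xi>. indicator (ball 0 R) \<xi> *\<^sub>R
             (\<integral>x. indicator {0..1} x *\<^sub>R (b x / (w x - \<xi>)) \<partial>lborel))" (is ?A)
    and cauchy_kernel_Fubini: "(\<integral>\<xi>. indicator (ball 0 R) \<xi> *\<^sub>R
             (\<integral>x. indicator {0..1} x *\<^sub>R (b x / (w x - \<xi>)) \<partial>lborel) \<partial>lborel)
          = (\<integral>x. indicator {0..1} x *\<^sub>R (b x * disc_potential R (w x)) \<partial>lborel)" (is ?B)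
proof -
  \<comment> \<open>Extended by 0, both functions are Borel measurable on the whole line, as the
    product measure demands.\<close>
  define b' w' where "b' x = indicator {0..1} x *\<^sub>R b x"
    and "w' x = indicator {0..1} x *\<^sub>R w x" for x
  have [measurable]: "b' \<in> borel_measurable borel" "w' \<in> borel_measurable borel"
    unfolding b'_def w'_def using b w by (auto intro!: borel_measurable_continuous_on_indicator)
  define F where "F x \<xi> = b' x * (indicator (ball 0 R) \<xi> *\<^sub>R (1 / (w' x - \<xi>)))" for x \<xi>
  obtain B where B: "\<And>x. x \<in> {0..1} \<Longrightarrow> norm (b x) \<le> B"
    using compact_imp_bounded[OF compact_continuous_image[OF b compact_Icc]]
    unfolding bounded_iff by blast
  have B0: "B \<ge> 0" using B[of 0] norm_ge_zero[of "b 0"] order_trans by (metis atLeastAtMost_iff zero_le_one order_refl)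
  have [measurable]: "ball (0::complex) R \<in> sets borel" by simp
  have Fm[measurable]: "case_prod F \<in> borel_measurable (lborel \<Otimes>\<^sub>M lborel)"
    unfolding F_def case_prod_beta
    by (intro borel_measurable_times borel_measurable_scaleR borel_measurable_divide borel_measurable_diff) measurable
  have nF: "ennreal (norm (F x \<xi>)) \<le> ennreal (B * indicator {0..1} x) *
     ennreal (indicator (ball 0 R) \<xi> * inverse (norm (w' x - \<xi>)))" for x \<xi>
  proof -
    have "norm (F x \<xi>) = norm (b' x) * (indicator (ball 0 R) \<xi> * inverse (norm (w' x - \<xi>)))"
      by (simp add: F_def norm_mult norm_divide inverse_eq_divide)
    also have "\<dots> \<le> (B * indicator {0..1} x) * (indicator (ball 0 R) \<xi> * inverse (norm (w' x - \<xi>)))"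
      using B[of x] by (intro mult_right_mono) (auto simp: b'_def indicator_def)
    finally have "norm (F x \<xi>) \<le> (B * indicator {0..1} x) * (indicator (ball 0 R) \<xi> * inverse (norm (w' x - \<xi>)))" .
    then show ?thesis using B0 by (subst ennreal_mult[symmetric]) (auto intro: ennreal_leI)
  qed
  have int: "integrable (lborel \<Otimes>\<^sub>M lborel) (case_prod F)"
  proof (rule integrableI_bounded[OF Fm])
    have "(\<integral>\<^sup>+ p. ennreal (norm (case_prod F p)) \<partial>(lborel \<Otimes>\<^sub>M lborel)) =
        (\<integral>\<^sup>+ x. \<integral>\<^sup>+ \<xi>. ennreal (norm (F x \<xi>)) \<partial>lborel \<partial>lborel)"
      by (subst lborel.nn_integral_fst[symmetric]) auto
    also have "\<dots> \<le> (\<integral>\<^sup>+ x. \<integral>\<^sup>+ \<xi>. ennreal (B * indicator {0..1} x) *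
     ennreal (indicator (ball 0 R) \<xi> * inverse (norm (w' x - \<xi>))) \<partial>lborel \<partial>lborel)"
      by (intro nn_integral_mono nF)
    also have "\<dots> = (\<integral>\<^sup>+ x. ennreal (B * indicator {0..1} x) * (\<integral>\<^sup>+ \<xi>.
     ennreal (indicator (ball 0 R) \<xi> * inverse (norm (w' x - \<xi>))) \<partial>lborel) \<partial>lborel)"
      by (intro nn_integral_cong nn_integral_cmult) measurable
    also have "\<dots> \<le> (\<integral>\<^sup>+ x. ennreal (B * indicator {0..1::real} x) * (ennreal (pi * R\<^sup>2) + ennreal (4 * pi)) \<partial>lborel)"
    proof (rule nn_integral_mono)
      fix x :: real
      show "ennreal (B * indicator {0..1} x) * (\<integral>\<^sup>+ \<xi>.
          ennreal (indicator (ball 0 R) \<xi> * inverse (norm (w' x - \<xi>))) \<partial>lborel)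
        \<le> ennreal (B * indicator {0..1} x) * (ennreal (pi * R\<^sup>2) + ennreal (4 * pi))"
        using nn_integral_inverse_norm_le[where w = "w' x" and R = R] by (rule mult_left_mono) simp
    qed
    also have "\<dots> = (\<integral>\<^sup>+ x. ennreal (B * (pi * R\<^sup>2 + 4 * pi)) * indicator {0..1::real} x \<partial>lborel)"
      using B0 by (intro nn_integral_cong) (auto simp: indicator_def ennreal_mult)
    also have "\<dots> < \<infinity>"
      by (subst nn_integral_cmult_indicator) (auto simp: ennreal_mult_less_top)
    finally show "(\<integral>\<^sup>+ p. ennreal (norm (case_prod F p)) \<partial>(lborel \<Otimes>\<^sub>M lborel)) < \<infinity>" .
  qed
  have e1: "(\<integral>x. F x \<xi> \<partial>lborel) = indicator (ball 0 R) \<xi> *\<^sub>R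
             (\<integral>x. indicator {0..1} x *\<^sub>R (b x / (w x - \<xi>)) \<partial>lborel)" for \<xi>
    by (subst integral_scaleR_right[symmetric], rule Bochner_Integration.integral_cong)
       (auto simp: F_def b'_def w'_def indicator_def)
  have e2: "(\<integral>\<xi>. F x \<xi> \<partial>lborel) = indicator {0..1} x *\<^sub>R (b x * disc_potential R (w x))" for x
    unfolding F_def disc_potential_def
    by (subst integral_mult_right_zero) (auto simp: b'_def w'_def indicator_def)
  show ?A
    using lborel_pair.integrable_snd[OF int] by (simp add: e1)
  show ?B
    using lborel_pair.Fubini_integral[OF int] by (simp add: e1 e2)
qed

text \<open>Substitute \<open>c \<xi>\<close> for \<open>\<xi>\<close>: area and disc are invariant
  under the rotation, and the kernel acquires the factor \<open>1 / c\<close>.\<close>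

lemma disc_potential_rotate:
  assumes "norm c = 1"
  shows "disc_potential R z = c * disc_potential R (c * z)"
proof -
  have c0: "c \<noteq> 0" using assms by auto
  have "disc_potential R (c * z) = (\<integral>\<xi>. indicator (ball 0 R) \<xi> *\<^sub>R (1 / (c * z - \<xi>)) \<partial>distr lborel borel ((*) c))"
    unfolding disc_potential_def by (subst lborel_rotate[OF assms]) simp
  also have "\<dots> = (\<integral>\<xi>. indicator (ball 0 R) (c * \<xi>) *\<^sub>R (1 / (c * z - c * \<xi>)) \<partial>lborel)"
    by (subst integral_distr)
       (auto intro!: borel_measurable_scaleR borel_measurable_indicator borel_measurable_divide)
  also have "\<dots> = (\<integral>\<xi>. (1 / c) * (indicator (ball 0 R) \<xi> *\<^sub>R (1 / (z - \<xi>))) \<partial>lborel)"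
  proof (rule Bochner_Integration.integral_cong)
    fix \<xi> :: complex
    have "c * z - c * \<xi> = c * (z - \<xi>)" by (simp add: algebra_simps)
    then show "indicator (ball 0 R) (c * \<xi>) *\<^sub>R (1 / (c * z - c * \<xi>)) = (1 / c) * (indicator (ball 0 R) \<xi> *\<^sub>R (1 / (z - \<xi>)))"
      using assms by (simp add: indicator_def norm_mult)
  qed simp
  also have "\<dots> = (1 / c) * disc_potential R z" unfolding disc_potential_def by (rule integral_mult_right_zero)
  finally show ?thesis using c0 by simp
qed

abbreviation unit_exp :: "real \<Rightarrow> complex" where
  "unit_exp x \<equiv> exp (2 * of_real pi * \<i> * of_real x)"

lemma norm_unit_exp [simp]: "norm (unit_exp x) = 1"
  by (simp add: norm_exp_eq_Re)

lemma norm_circlepath [simp]: "norm (circlepath 0 r x) = \<bar>r\<bar>"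
  by (simp add: circlepath norm_mult)

lemma cnj_unit_exp: "cnj (unit_exp x) = 1 / unit_exp x"
proof -
  have "unit_exp x * cnj (unit_exp x) = 1"
    by (simp only: complex_norm_square[symmetric] norm_unit_exp) simp
  then show ?thesis by (simp add: field_simps)
qed

lemma inverse_cnj_unit: "norm s = 1 \<Longrightarrow> 1 / cnj s = s"
proof -
  assume "norm s = 1"
  then have "s * cnj s = 1" by (simp add: complex_norm_square[symmetric])
  then show ?thesis by (metis mult.commute mult_eq_0_iff nonzero_eq_divide_eq zero_neq_one)
qed

lemma open_norm_gt: "open {s::complex. x < norm s}" by (intro open_Collect_less continuous_intros)

lemma contour_integral_circlepath_unit_exp:
  "contour_integral (circlepath 0 r) f = 2 * of_real pi * \<i> *
     integral {0..1} (\<lambda>x. f (of_real r * unit_exp x) * (of_real r * unit_exp x))"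
proof -
  have "contour_integral (circlepath 0 r) f =
    integral {0..1} (\<lambda>x. f (circlepath 0 r x) * vector_derivative (circlepath 0 r) (at x))"
    by (rule contour_integral_integral)
  also have "\<dots> = integral {0..1} (\<lambda>x. (2 * of_real pi * \<i>) * (f (of_real r * unit_exp x) * (of_real r * unit_exp x)))"
    by (intro integral_cong) (simp only: vector_derivative_circlepath, simp add: circlepath algebra_simps)
  also have "\<dots> = 2 * of_real pi * \<i> * integral {0..1} (\<lambda>x. f (of_real r * unit_exp x) * (of_real r * unit_exp x))"
    by (rule integral_mult_right)
  finally show ?thesis .
qed

text \<open>With \<open>s = unit_exp x\<close> this is, up to the factor \<open>2 pi i\<close>, the
  integral of \<open>1 / (s z - \<xi>)\<close> over the unit circle; its pole
  \<open>\<xi> / z\<close> is inside exactly when \<open>|\<xi>| < |z|\<close>.\<close>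

lemma integral_rotated_kernel:
  fixes z \<xi> :: complex
  assumes "norm z \<noteq> norm \<xi>"
  shows "integral {0..1} (\<lambda>x. unit_exp x / (unit_exp x * z - \<xi>)) = (if norm \<xi> < norm z then 1 / z else 0)"
proof (cases "norm \<xi> < norm z")
  case True
  then have z0: "z \<noteq> 0" by auto
  have "contour_integral (circlepath 0 1) (\<lambda>s. (1/z) / (s - \<xi>/z)) = 2 * of_real pi * \<i> * (1/z)"
    using True z0 by (intro contour_integral_unique Cauchy_integral_circlepath_simple)
      (auto simp: norm_divide divide_simps)
  moreover have "(1/z) / (s - \<xi>/z) = 1 / (s * z - \<xi>)" for s
    using z0 by (simp add: field_simps)
  ultimately have "contour_integral (circlepath 0 1) (\<lambda>s. 1 / (s * z - \<xi>)) = 2 * of_real pi * \<i> * (1/z)"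
    by (simp only:)
  then show ?thesis using True z0
    by (simp add: contour_integral_circlepath_unit_exp field_simps)
next
  case False
  then have lt: "norm z < norm \<xi>" using assms by auto
  have ne: "s * z - \<xi> \<noteq> 0" if "s \<in> cball 0 1" for s
  proof
    assume "s * z - \<xi> = 0"
    then have "norm \<xi> = norm s * norm z" by (metis eq_iff_diff_eq_0 norm_mult)
    moreover have "norm s * norm z \<le> 1 * norm z" using that by (intro mult_right_mono) auto
    ultimately show False using lt by simp
  qed
  have "((\<lambda>s. 1 / (s * z - \<xi>)) has_contour_integral 0) (circlepath 0 1)"
    using ne by (intro Cauchy_theorem_convex_simple[of _ "cball 0 1"] holomorphic_intros) auto
  then show ?thesis using False
    by (auto dest!: contour_integral_unique simp: contour_integral_circlepath_unit_exp)
qed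

text \<open>Averaging over rotations replaces the kernel by \<open>1 / z\<close> for \<open>|\<xi>| < |z|\<close> and by \<open>0\<close> for \<open>|\<xi>| > |z|\<close>.\<close>

lemma disc_potential_eq:
  assumes "norm z < R"
  shows "disc_potential R z = of_real pi * cnj z"
proof (cases "z = 0")
  case True
  \<comment> \<open>Rotation by \<open>-1\<close> fixes the centre and changes the sign, so the
    value there is 0.\<close>
  have "disc_potential R 0 = (-1) * disc_potential R ((-1) * 0)"
    by (rule disc_potential_rotate) simp
  then show ?thesis using True by simp
next
  case False
  have c1: "continuous_on {0..1} unit_exp" and c2: "continuous_on {0..1} (\<lambda>x. unit_exp x * z)"
    by (intro continuous_intros)+
  have "disc_potential R z = (\<integral>x. indicator {0..1::real} x *\<^sub>R disc_potential R z \<partial>lborel)"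
    by simp
  also have "\<dots> = (\<integral>x. indicator {0..1} x *\<^sub>R (unit_exp x * disc_potential R (unit_exp x * z)) \<partial>lborel)"
    by (subst disc_potential_rotate[symmetric]) auto
  also have "\<dots> = (\<integral>\<xi>. indicator (ball 0 R) \<xi> *\<^sub>R
       (\<integral>x. indicator {0..1} x *\<^sub>R (unit_exp x / (unit_exp x * z - \<xi>)) \<partial>lborel) \<partial>lborel)"
    by (rule cauchy_kernel_Fubini[OF c1 c2, symmetric])
  also have "\<dots> = (\<integral>\<xi>. indicator (ball (0::complex) (norm z)) \<xi> *\<^sub>R (1 / z) \<partial>lborel)"
  proof (rule Bochner_Integration.integral_cong_AE)
    \<comment> \<open>For \<open>|\<xi>| = |z|\<close> the rotated kernel has its pole on the path
      of integration; these points form a null set.\<close>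
    have "AE \<xi> in lborel. \<xi> \<notin> sphere (0::complex) (norm z)"
      using negligible_sphere[of "0::complex" "norm z"]
      by (intro AE_not_in) (simp add: negligible_iff_null_sets null_sets_completion_iff)
    then show "AE \<xi> in lborel. indicator (ball 0 R) \<xi> *\<^sub>R
       (\<integral>x. indicator {0..1} x *\<^sub>R (unit_exp x / (unit_exp x * z - \<xi>)) \<partial>lborel) =
        indicator (ball 0 (norm z)) \<xi> *\<^sub>R (1 / z)"
    proof eventually_elim
      fix \<xi> :: complex
      assume "\<xi> \<notin> sphere 0 (norm z)"
      then have ne: "norm z \<noteq> norm \<xi>" by (auto simp: dist_norm)
      have ne0: "unit_exp x * z - \<xi> \<noteq> 0" for x
        using ne by (metis eq_iff_diff_eq_0 norm_mult norm_unit_exp mult_1)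
      have "set_integrable lborel {0..1} (\<lambda>x. unit_exp x / (unit_exp x * z - \<xi>))"
        using ne0 by (intro borel_integrable_atLeastAtMost' continuous_intros) auto
      then have "(\<integral>x. indicator {0..1} x *\<^sub>R (unit_exp x / (unit_exp x * z - \<xi>)) \<partial>lborel) =
          (if norm \<xi> < norm z then 1 / z else 0)"
        unfolding integral_rotated_kernel[OF ne, symmetric]
        by (subst set_borel_integral_eq_integral(2)[symmetric]) (auto simp: set_lebesgue_integral_def)
      then show "indicator (ball 0 R) \<xi> *\<^sub>R
       (\<integral>x. indicator {0..1} x *\<^sub>R (unit_exp x / (unit_exp x * z - \<xi>)) \<partial>lborel) =
        indicator (ball 0 (norm z)) \<xi> *\<^sub>R (1 / z)"
        using assms by (auto simp: indicator_def)
    qed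
  qed (use cauchy_kernel_Fubini_integrable[OF c1 c2, of R] in \<open>auto intro!: borel_measurable_scaleR borel_measurable_indicator\<close>)
  also have "\<dots> = measure lborel (ball (0::complex) (norm z)) *\<^sub>R (1 / z)"
    by (subst integral_scaleR_left) (auto intro!: integrable_real_indicator emeasure_bounded_finite)
  also have "\<dots> = of_real (pi * (norm z)\<^sup>2) / z"
    by (simp add: content_ball unit_ball_vol_2 scaleR_conv_of_real)
  also have "\<dots> = of_real pi * cnj z"
    unfolding of_real_mult complex_norm_square using False by simp
  finally show ?thesis .
qed

section \<open>Cycles and near-identity maps\<close>

text \<open>The global Cauchy theorem is about one closed path. Each loop is tied to the base point
  by a path run there and back, and the two runs cancel for every holomorphic
  \<open>f\<close>.\<close>

lemma loops_join:
  assumes "open S" "connected S" "z0 \<in> S"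
    and "\<forall>\<gamma>\<in>set \<gamma>s. valid_path \<gamma> \<and> pathfinish \<gamma> = pathstart \<gamma> \<and> path_image \<gamma> \<subseteq> S"
  shows "\<exists>g. valid_path g \<and> pathstart g = z0 \<and> pathfinish g = z0 \<and> path_image g \<subseteq> S \<and>
     (\<forall>f. f holomorphic_on S \<longrightarrow> contour_integral g f = (\<Sum>\<gamma>\<leftarrow>\<gamma>s. contour_integral \<gamma> f))"
  using assms(4)
proof (induction \<gamma>s)
  case Nil
  then show ?case using assms(3)
    by (intro exI[of _ "linepath z0 z0"]) (simp del: linepath_trivial)
next
  case (Cons \<gamma> \<gamma>s)
  then obtain g where g: "valid_path g" "pathstart g = z0" "pathfinish g = z0" "path_image g \<subseteq> S"
    and gf: "\<And>f. f holomorphic_on S \<Longrightarrow> contour_integral g f = (\<Sum>\<gamma>\<leftarrow>\<gamma>s. contour_integral \<gamma> f)"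
    by auto
  have \<gamma>: "valid_path \<gamma>" "pathfinish \<gamma> = pathstart \<gamma>" "path_image \<gamma> \<subseteq> S" using Cons by auto
  then have "pathstart \<gamma> \<in> S" by blast
  then obtain p where p: "polynomial_function p" "path_image p \<subseteq> S" "pathstart p = z0" "pathfinish p = pathstart \<gamma>"
    using connected_open_polynomial_connected[OF assms(1-3)] by blast
  have vp: "valid_path p" using p(1) by (simp add: valid_path_polynomial_function)
  let ?g = "p +++ (\<gamma> +++ (reversepath p +++ g))"
  have "contour_integral ?g f = contour_integral \<gamma> f + contour_integral g f" if f: "f holomorphic_on S" for f
  proof -
    have i: "f contour_integrable_on p" "f contour_integrable_on \<gamma>" "f contour_integrable_on g"
      using contour_integrable_holomorphic_simple[OF f \<open>open S\<close>] vp \<gamma> g p by auto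
    then have "f contour_integrable_on reversepath p"
      by (simp add: contour_integrable_reversepath_eq vp)
    then show ?thesis using i vp \<gamma> g p
      by (simp add: contour_integral_join contour_integrable_join contour_integral_reversepath valid_path_join)
  qed
  then show ?case using \<gamma> g p vp
    by (intro exI[of _ ?g]) (auto simp: gf path_image_join valid_path_join)
qed

text \<open>The joined loop of \<open>loops_join\<close> serves all \<open>f\<close> at once.
  Applied to \<open>1 / (z - w)\<close>, it turns the hypothesis on the sum of winding numbers into
  one on a single loop.\<close>

lemma Cauchy_theorem_cycle:
  assumes "open S" "connected S" "f holomorphic_on S"
    and \<gamma>s: "\<And>\<gamma>. \<gamma> \<in> set \<gamma>s \<Longrightarrow> valid_path \<gamma> \<and> pathfinish \<gamma> = pathstart \<gamma> \<and> path_image \<gamma> \<subseteq> S"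
    and zero: "\<And>w. w \<notin> S \<Longrightarrow> (\<Sum>\<gamma>\<leftarrow>\<gamma>s. winding_number \<gamma> w) = 0"
  shows "(\<Sum>\<gamma>\<leftarrow>\<gamma>s. contour_integral \<gamma> f) = 0"
proof (cases "S = {}")
  case True
  then have "set \<gamma>s = {}" using \<gamma>s path_image_nonempty by fastforce
  then show ?thesis by simp
next
  case False
  then obtain z0 where "z0 \<in> S" by blast
  with loops_join[OF assms(1,2)] \<gamma>s obtain g where g: "valid_path g" "pathstart g = z0"
      "pathfinish g = z0" "path_image g \<subseteq> S"
    and gf: "\<And>f. f holomorphic_on S \<Longrightarrow> contour_integral g f = (\<Sum>\<gamma>\<leftarrow>\<gamma>s. contour_integral \<gamma> f)"
    by metis
  have "winding_number g w = 0" if w: "w \<notin> S" for w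
  proof -
    have hol: "(\<lambda>z. 1 / (z - w)) holomorphic_on S" using w by (intro holomorphic_intros) auto
    have "winding_number g w = 1 / (2 * pi * \<i>) * contour_integral g (\<lambda>z. 1 / (z - w))"
      using g w by (intro winding_number_valid_path) auto
    also have "\<dots> = (\<Sum>\<gamma>\<leftarrow>\<gamma>s. 1 / (2 * pi * \<i>) * contour_integral \<gamma> (\<lambda>z. 1 / (z - w)))"
      by (simp only: gf[OF hol] sum_list_const_mult)
    also have "\<dots> = (\<Sum>\<gamma>\<leftarrow>\<gamma>s. winding_number \<gamma> w)"
      using \<gamma>s w by (intro arg_cong[where f = sum_list] map_cong refl winding_number_valid_path[symmetric]) auto
    finally show ?thesis using zero[OF w] by simp
  qed
  then have "contour_integral g f = 0"
    using Cauchy_theorem_global[OF \<open>open S\<close> assms(3) g(1)] g contour_integral_unique by auto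
  then show ?thesis using gf[OF assms(3)] by simp
qed

lemma contour_integral_circlepath_annulus:
  assumes "open S" "f holomorphic_on S" "0 < r1" "r1 \<le> r2"
    and sub: "\<And>s. r1 \<le> norm s \<Longrightarrow> norm s \<le> r2 \<Longrightarrow> s \<in> S"
  shows "contour_integral (circlepath 0 r1) f = contour_integral (circlepath 0 r2) f"
proof (rule Cauchy_theorem_homotopic_loops[OF _ assms(1,2)])
  show "homotopic_loops S (circlepath 0 r1) (circlepath 0 r2)"
  proof (rule homotopic_loops_linear)
    fix x :: real assume "x \<in> {0..1}"
    let ?e = "exp (2 * of_real pi * \<i> * of_real x)"
    show "closed_segment (circlepath 0 r1 x) (circlepath 0 r2 x) \<subseteq> S"
    proof
      fix y assume "y \<in> closed_segment (circlepath 0 r1 x) (circlepath 0 r2 x)"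
      then obtain u where u: "0 \<le> u" "u \<le> 1"
        and y: "y = (1 - u) *\<^sub>R (of_real r1 * ?e) + u *\<^sub>R (of_real r2 * ?e)"
        by (auto simp: closed_segment_def circlepath)
      have "y = of_real ((1 - u) * r1 + u * r2) * ?e"
        by (simp add: y scaleR_conv_of_real algebra_simps)
      moreover have "norm ?e = 1" by (simp add: norm_exp_eq_Re)
      moreover have "r1 \<le> (1 - u) * r1 + u * r2" "(1 - u) * r1 + u * r2 \<le> r2"
        using u assms(3,4) mult_left_mono[of r1 r2 u] mult_left_mono[of r1 r2 "1-u"]
        by (auto simp: algebra_simps)
      ultimately show "y \<in> S" using assms(3) by (intro sub) (auto simp: norm_mult simp del: of_real_add of_real_mult of_real_diff)
    qed
  qed auto
qed (use assms in auto)

section \<open>Homeomorphisms close to the identity\<close>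

definition cell_map :: "complex \<Rightarrow> real \<Rightarrow> (complex \<Rightarrow> complex) \<Rightarrow> complex \<Rightarrow> complex" where
  "cell_map a t E s = a + of_real t * (s + E s)"

locale near_identity =
  fixes a :: complex and t :: real and E :: "complex \<Rightarrow> complex" and L :: real
  assumes t_pos: "0 < t" and L: "0 \<le> L" "L < 1"
    and lip: "\<And>x y. norm (E x - E y) \<le> L * norm (x - y)"
begin

abbreviation "X \<equiv> cell_map a t E"

text \<open>The contraction \<open>E\<close> takes back at most the fraction \<open>L\<close> of a
  distance. This yields both injectivity and a Lipschitz inverse.\<close>

lemma X_lower: "t * (1 - L) * norm (x - y) \<le> norm (X x - X y)"
proof -
  have "X x - X y = of_real t * ((x - y) + (E x - E y))" by (simp add: cell_map_def algebra_simps)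
  then have eq: "norm (X x - X y) = t * norm ((x - y) + (E x - E y))"
    using t_pos by (simp only: norm_mult norm_of_real abs_of_pos)
  have "(1 - L) * norm (x - y) \<le> norm (x - y) - norm (E x - E y)"
    using lip[of x y] by (simp add: algebra_simps)
  also have "\<dots> \<le> norm ((x - y) + (E x - E y))" by (rule norm_diff_ineq)
  finally show ?thesis unfolding eq mult.assoc using t_pos by (intro mult_left_mono) auto
qed

lemma inj_X: "inj X"
proof (rule injI)
  fix x y assume "X x = X y"
  then have "t * (1 - L) * norm (x - y) \<le> 0" using X_lower[of x y] by simp
  then show "x = y" using t_pos L by (simp add: mult_le_0_iff)
qed

lemma surj_X: "surj X"
proof (rule surjI)
  fix w
  have "\<exists>!s. (w - a) / of_real t - E s = s"
    using lip L by (intro banach_fix_type[of L]) (auto simp: dist_norm norm_minus_commute)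
  then obtain s where "(w - a) / of_real t - E s = s" by auto
  then have "X s = w" using t_pos by (simp add: cell_map_def field_simps)
  then show "X (inv X w) = w" by (metis f_inv_into_f rangeI)
qed

lemma continuous_X: "continuous_on S X"
proof -
  have "continuous_on S E"
    using lip L by (intro lipschitz_on_continuous_on[of L] lipschitz_onI) (auto simp: dist_norm)
  then show ?thesis unfolding cell_map_def by (intro continuous_intros)
qed

lemma continuous_inv_X: "continuous_on S (inv X)"
proof (rule lipschitz_on_continuous_on[of "1 / (t * (1 - L))"], rule lipschitz_onI)
  fix x y
  have "t * (1 - L) * norm (inv X x - inv X y) \<le> norm (x - y)"
    using X_lower[of "inv X x" "inv X y"] by (simp add: surj_X surj_f_inv_f)
  then show "dist (inv X x) (inv X y) \<le> 1 / (t * (1 - L)) * dist x y"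
    using t_pos L by (simp add: dist_norm field_simps)
qed (use t_pos L in auto)

lemma X_inv [simp]: "X (inv X w) = w" by (simp add: surj_X surj_f_inv_f)
lemma inv_X [simp]: "inv X (X s) = s" by (simp add: inj_X)

lemma X_eq_iff [simp]: "X x = X y \<longleftrightarrow> x = y" using inj_X by (auto dest: injD)

lemma X_image_vimage: "X ` S = inv X -` S"
  by (auto intro: image_eqI[of _ _ "inv X _"])

lemma open_X_image: "open S \<Longrightarrow> open (X ` S)"
  unfolding X_image_vimage using continuous_inv_X[of UNIV] by (auto simp: continuous_on_open_vimage)

lemma X_image_Compl: "X ` (- S) = - X ` S"
  unfolding X_image_vimage by auto

lemma closure_X_image: "closure (X ` S) = X ` closure S"
proof
  have "closed (X ` closure S)"
    unfolding closed_def X_image_Compl[symmetric] by (intro open_X_image open_Compl closed_closure)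
  then show "closure (X ` S) \<subseteq> X ` closure S"
    by (intro closure_minimal image_mono closure_subset)
  show "X ` closure S \<subseteq> closure (X ` S)"
    by (rule image_closure_subset[OF continuous_X]) (auto simp: closure_subset)
qed

lemma interior_X_image: "interior (X ` S) = X ` interior S"
  by (simp add: interior_closure closure_X_image X_image_Compl[symmetric])

lemma connected_X_image: "connected S \<Longrightarrow> connected (X ` S)"
  by (rule connected_continuous_image[OF continuous_X])

lemma compact_cell: "compact (X ` cball 0 r)"
  by (rule compact_continuous_image[OF continuous_X]) simp

lemma connected_Compl_cell: "connected (- X ` cball 0 1)"
  unfolding X_image_Compl[symmetric]
  by (rule connected_X_image, rule connected_complement_bounded_convex) auto

text \<open>Freeze \<open>E\<close> at \<open>s0\<close>. The curve becomes a round circle, whose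
  point with parameter \<open>y\<close> has distance exactly \<open>t |y - s0|\<close> from
  \<open>X s0\<close>. The true curve deviates from it by at most \<open>L\<close> times this
  distance, so both loops have the same winding number about \<open>X s0\<close>.\<close>

lemma winding_number_X_circle:
  assumes r: "0 < r" and s0: "norm s0 \<noteq> r"
  shows "winding_number (X \<circ> circlepath 0 r) (X s0) = (if norm s0 < r then 1 else 0)"
proof -
  let ?c = "circlepath (a + of_real t * E s0) (t * r)"
  have cx: "circlepath 0 r x \<noteq> s0" for x
  proof
    assume "circlepath 0 r x = s0"
    then have "norm s0 = \<bar>r\<bar>" by (auto simp: circlepath norm_mult norm_exp_eq_Re)
    then show False using s0 r by simp
  qed
  have "winding_number (X \<circ> circlepath 0 r) (X s0) = winding_number ?c (X s0)"
  proof (rule winding_number_nearby_loops_eq)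
    show "path (X \<circ> circlepath 0 r)"
      by (rule path_continuous_image[OF _ continuous_X]) simp
    show "pathfinish (X \<circ> circlepath 0 r) = pathstart (X \<circ> circlepath 0 r)"
      by (simp add: pathfinish_compose pathstart_compose)
    fix x :: real
    let ?y = "circlepath 0 r x"
    have c: "?c x = a + of_real t * (?y + E s0)" by (simp add: circlepath algebra_simps)
    have "norm ((X \<circ> circlepath 0 r) x - ?c x) = t * norm (E ?y - E s0)"
      unfolding c using t_pos by (simp add: cell_map_def norm_mult right_diff_distrib[symmetric])
    also have "\<dots> \<le> t * (L * norm (?y - s0))" using t_pos lip by (intro mult_left_mono) auto
    also have "\<dots> < t * norm (?y - s0)" using t_pos L cx[of x] by simp
    also have "\<dots> = norm (?c x - X s0)"
      unfolding c using t_pos by (simp add: cell_map_def norm_mult right_diff_distrib[symmetric])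
    finally show "norm ((X \<circ> circlepath 0 r) x - ?c x) < norm (?c x - X s0)" .
  qed auto
  also have "\<dots> = (if norm s0 < r then 1 else 0)"
  proof -
    have d: "X s0 - (a + of_real t * E s0) = of_real t * s0" by (simp add: cell_map_def algebra_simps)
    show ?thesis
    proof (cases "norm s0 < r")
      case True
      then have "norm (X s0 - (a + of_real t * E s0)) < t * r" using t_pos by (simp add: d norm_mult)
      then show ?thesis using True by (simp add: winding_number_circlepath)
    next
      case False
      then have "norm (X s0 - (a + of_real t * E s0)) > t * r" using t_pos s0 by (simp add: d norm_mult)
      then have "X s0 \<notin> cball (a + of_real t * E s0) (t * r)" by (auto simp: dist_norm norm_minus_commute)
      then show ?thesis using False t_pos r
        by (intro trans[OF winding_number_zero_outside[of _ "cball (a + of_real t * E s0) (t * r)"]])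
           auto
    qed
  qed
  finally show ?thesis .
qed

end

section \<open>The exterior of finitely many cells\<close>

text \<open>
  \<open>E j\<close> is Lipschitz on the whole plane, \<open>k j\<close> is holomorphic across the unit circle, and they agree for
  \<open>|s| \<ge> 1\<close>: the former supplies the homeomorphism, the latter the regularity of the boundary.
\<close>

locale cells =
  fixes J :: "nat set" and a :: "nat \<Rightarrow> complex" and t :: real
    and E k :: "nat \<Rightarrow> complex \<Rightarrow> complex" and L \<rho> N \<delta> :: real
  assumes finite_J: "finite J"
    and near_id: "\<And>j. j \<in> J \<Longrightarrow> near_identity t (E j) L"
    and rho: "0 < \<rho>" "\<rho> < 1" and N: "1 < N"
    and hol_k: "\<And>j. j \<in> J \<Longrightarrow> k j holomorphic_on {s. \<rho> < norm s}"
    and E_eq_k: "\<And>j s. j \<in> J \<Longrightarrow> 1 \<le> norm s \<Longrightarrow> E j s = k j s"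
    and in_ball: "\<And>j s. j \<in> J \<Longrightarrow> norm s \<le> N \<Longrightarrow> cell_map (a j) t (E j) s \<in> ball (a j) \<delta>"
    and disj: "\<And>i j. i \<in> J \<Longrightarrow> j \<in> J \<Longrightarrow> i \<noteq> j \<Longrightarrow> ball (a i) \<delta> \<inter> ball (a j) \<delta> = {}"
begin

definition "X j = cell_map (a j) t (E j)"
definition "ph j = cell_map (a j) t (k j)"
definition "K j = X j ` cball 0 1"
definition "Om = - (\<Union>j\<in>J. K j)"
text \<open>Taken from \<open>ph\<close>, whose holomorphy across the unit circle makes this a valid
  path even for \<open>r = 1\<close>. By \<open>Gam_eq\<close> it is also the image of the circle
  under the homeomorphism \<open>X j\<close>, which gives its winding numbers.\<close>

definition "Gam j r = ph j \<circ> circlepath 0 r"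

lemma ph_eq_X: "j \<in> J \<Longrightarrow> 1 \<le> norm s \<Longrightarrow> ph j s = X j s"
  by (simp add: ph_def X_def cell_map_def E_eq_k)

lemma Gam_eq: "j \<in> J \<Longrightarrow> 1 \<le> r \<Longrightarrow> Gam j r = X j \<circ> circlepath 0 r"
  by (rule ext) (simp add: Gam_def ph_eq_X)

lemma holomorphic_ph: "j \<in> J \<Longrightarrow> ph j holomorphic_on {s. \<rho> < norm s}"
  unfolding ph_def cell_map_def using hol_k by (intro holomorphic_intros) auto

lemma X_homeo:
  assumes "j \<in> J"
  shows "closure (X j ` S) = X j ` closure S" "interior (X j ` S) = X j ` interior S"
    "open S \<Longrightarrow> open (X j ` S)" "connected S \<Longrightarrow> connected (X j ` S)" "compact (X j ` cball 0 r)"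
    "X j ` (- S) = - X j ` S" "continuous_on S (X j)" "continuous_on S (inv (X j))"
    "X j (inv (X j) w) = w" "inv (X j) (X j s) = s" "X j x = X j y \<longleftrightarrow> x = y"
    "connected (- X j ` cball 0 1)"
proof -
  interpret n: near_identity "a j" t "E j" L by (rule near_id[OF assms])
  show "closure (X j ` S) = X j ` closure S" "interior (X j ` S) = X j ` interior S"
    "open S \<Longrightarrow> open (X j ` S)" "connected S \<Longrightarrow> connected (X j ` S)" "compact (X j ` cball 0 r)"
    "X j ` (- S) = - X j ` S" "continuous_on S (X j)" "continuous_on S (inv (X j))"
    "X j (inv (X j) w) = w" "inv (X j) (X j s) = s" "X j x = X j y \<longleftrightarrow> x = y"
    "connected (- X j ` cball 0 1)"
    unfolding X_def
    by (fact n.closure_X_image n.interior_X_image n.open_X_image n.connected_X_image n.compact_cell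
        n.X_image_Compl n.continuous_X n.continuous_inv_X n.X_inv n.inv_X n.X_eq_iff
        n.connected_Compl_cell)+
qed

lemma X_in_ball: "j \<in> J \<Longrightarrow> norm s \<le> N \<Longrightarrow> X j s \<in> ball (a j) \<delta>"
  unfolding X_def by (rule in_ball)

lemma K_subset_ball: "j \<in> J \<Longrightarrow> K j \<subseteq> ball (a j) \<delta>"
  unfolding K_def using X_in_ball N by fastforce

lemma winding_number_Gam:
  assumes j: "j \<in> J" and r: "1 \<le> r" and z: "z \<notin> X j ` sphere 0 r"
  shows "winding_number (Gam j r) z = (if z \<in> X j ` ball 0 r then 1 else 0)"
proof -
  interpret n: near_identity "a j" t "E j" L by (rule near_id[OF j])
  define s where "s = inv (X j) z"
  have zs: "z = X j s" using X_homeo(9)[OF j] by (simp add: s_def)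
  have "norm s \<noteq> r" using z zs by auto
  then have "winding_number (X j \<circ> circlepath 0 r) (X j s) = (if norm s < r then 1 else 0)"
    unfolding X_def using r by (intro n.winding_number_X_circle) auto
  moreover have "X j s \<in> X j ` ball 0 r \<longleftrightarrow> norm s < r"
    using X_homeo(11)[OF j] by auto
  ultimately show ?thesis by (simp add: Gam_eq[OF j r] zs)
qed

lemma path_image_Gam: "j \<in> J \<Longrightarrow> 1 \<le> r \<Longrightarrow> path_image (Gam j r) = X j ` sphere 0 r"
  by (simp add: Gam_eq path_image_compose)

lemma valid_path_Gam: "j \<in> J \<Longrightarrow> 1 \<le> r \<Longrightarrow> valid_path (Gam j r)"
  unfolding Gam_def using rho
  by (intro valid_path_compose_holomorphic[OF _ holomorphic_ph open_norm_gt]) auto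

lemma loop_Gam: "pathfinish (Gam j r) = pathstart (Gam j r)"
  by (simp add: Gam_def pathfinish_compose pathstart_compose)

lemma closed_KK: "closed (\<Union>j\<in>J. K j)" and compact_KK: "compact (\<Union>j\<in>J. K j)"
  using finite_J X_homeo(5) by (auto simp: K_def intro!: compact_UN compact_imp_closed)

lemma open_Om: "open Om"
  unfolding Om_def using closed_KK by (rule open_Compl)

lemma bounded_Compl_Om: "bounded (- Om)"
  unfolding Om_def using compact_KK by (simp add: compact_imp_bounded)

text \<open>Disjoint compact sets none of which separates the plane do not separate it jointly:
  Janiszewski's theorem, with empty intersection, adds one cell at a time.\<close>

lemma connected_Om: "connected Om"
proof -
  have "connected (- (\<Union>j\<in>I. K j))" if "I \<subseteq> J" "finite I" for I
    using that(2,1)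
  proof (induction I rule: finite_induct)
    case (insert i I)
    have e: "K i \<inter> (\<Union>j\<in>I. K j) = {}"
      using insert K_subset_ball disj[of i] by fast
    have "connected (- (K i \<union> (\<Union>j\<in>I. K j)))"
    proof (rule Janiszewski_connected)
      show "compact (K i)" "connected (- K i)"
        using insert X_homeo(5,12)[of i] by (auto simp: K_def)
      show "closed (\<Union>j\<in>I. K j)"
        using insert X_homeo(5) by (auto simp: K_def intro!: closed_UN compact_imp_closed)
    qed (use e insert in auto)
    then show ?case by simp
  qed auto
  from this[of J] show ?thesis using finite_J by (simp add: Om_def)
qed

text \<open>The ball around one cell meets no other cell, so within it an interior point of the
  union is an interior point of that cell.\<close>

lemma interior_KK: "interior (\<Union>j\<in>J. K j) = (\<Union>j\<in>J. X j ` ball 0 1)"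
proof
  show "(\<Union>j\<in>J. X j ` ball 0 1) \<subseteq> interior (\<Union>j\<in>J. K j)"
    using X_homeo(3) by (intro interior_maximal open_UN) (auto simp: K_def)
  show "interior (\<Union>j\<in>J. K j) \<subseteq> (\<Union>j\<in>J. X j ` ball 0 1)"
  proof
    fix z assume z: "z \<in> interior (\<Union>j\<in>J. K j)"
    then obtain j where j: "j \<in> J" "z \<in> K j" using interior_subset by blast
    have "interior (\<Union>j\<in>J. K j) \<inter> ball (a j) \<delta> \<subseteq> K j"
    proof
      fix x assume x: "x \<in> interior (\<Union>j\<in>J. K j) \<inter> ball (a j) \<delta>"
      then obtain i where i: "i \<in> J" "x \<in> K i" using interior_subset by blast
      then have "i = j" using x K_subset_ball[of i] disj[of i j] j by blast
      then show "x \<in> K j" using i by simp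
    qed
    then have "interior (\<Union>j\<in>J. K j) \<inter> ball (a j) \<delta> \<subseteq> interior (K j)"
      by (intro interior_maximal) auto
    then have "z \<in> interior (K j)" using z j K_subset_ball by blast
    then show "z \<in> (\<Union>j\<in>J. X j ` ball 0 1)" using j X_homeo(2)[OF j(1)] by (auto simp: K_def)
  qed
qed

lemma closure_Om: "closure Om = - (\<Union>j\<in>J. X j ` ball 0 1)"
  unfolding Om_def closure_complement interior_KK ..

lemma interior_closure_Om: "interior (closure Om) = Om"
proof -
  have "closure (\<Union>j\<in>J. X j ` ball 0 1) = (\<Union>j\<in>J. K j)"
  proof
    show "closure (\<Union>j\<in>J. X j ` ball 0 1) \<subseteq> (\<Union>j\<in>J. K j)"
      by (rule closure_minimal[OF _ closed_KK]) (force simp: K_def)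
    show "(\<Union>j\<in>J. K j) \<subseteq> closure (\<Union>j\<in>J. X j ` ball 0 1)"
    proof (rule UN_least)
      fix j assume j: "j \<in> J"
      then have "K j = closure (X j ` ball 0 1)"
        using X_homeo(1)[OF j, of "ball 0 1"] by (simp add: K_def)
      also have "\<dots> \<subseteq> closure (\<Union>j\<in>J. X j ` ball 0 1)"
        using j by (intro closure_mono UN_upper)
      finally show "K j \<subseteq> closure (\<Union>j\<in>J. X j ` ball 0 1)" .
    qed
  qed
  then have "interior (closure Om) = - (\<Union>j\<in>J. K j)" by (simp only: closure_Om interior_complement)
  then show ?thesis by (simp only: Om_def)
qed

lemma X_sphere_disjoint_ball:
  assumes "i \<in> J" "j \<in> J" shows "X i ` sphere 0 1 \<inter> X j ` ball 0 1 = {}"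
proof (cases "i = j")
  case True
  then show ?thesis using X_homeo(11)[OF assms(1)] by auto
next
  case False
  have "X i ` sphere 0 1 \<subseteq> K i" "X j ` ball 0 1 \<subseteq> K j" by (auto simp: K_def)
  then show ?thesis using disj[OF assms False] K_subset_ball[OF assms(1)] K_subset_ball[OF assms(2)]
    by blast
qed

lemma frontier_Om: "frontier Om = (\<Union>j\<in>J. X j ` sphere 0 1)"
proof -
  have "frontier Om = (\<Union>j\<in>J. X j ` cball 0 1) - (\<Union>j\<in>J. X j ` ball 0 1)"
    unfolding frontier_def closure_Om using open_Om by (auto simp: interior_open Om_def K_def)
  also have "\<dots> = (\<Union>j\<in>J. X j ` sphere 0 1)"
  proof safe
    fix i s assume "i \<in> J" "s \<in> cball 0 1" "X i s \<notin> (\<Union>j\<in>J. X j ` ball 0 1)"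
    then show "X i s \<in> (\<Union>j\<in>J. X j ` sphere 0 1)" by force
  next
    fix i and s :: complex assume "i \<in> J" "s \<in> sphere 0 1"
    then show "X i s \<in> (\<Union>j\<in>J. X j ` cball 0 1)" by force
  next
    fix i j and s s' :: complex
    assume "i \<in> J" "s \<in> sphere 0 1" "j \<in> J" "X i s = X j s'" "s' \<in> ball 0 1"
    then show False using X_sphere_disjoint_ball[of i j] by blast
  qed
  finally show ?thesis .
qed

lemma X_in_Om:
  assumes j: "j \<in> J" and s: "1 < norm s" "norm s \<le> N"
  shows "X j s \<in> Om"
proof -
  have "X j s \<notin> K i" if i: "i \<in> J" for i
  proof (cases "i = j")
    case True
    then show ?thesis using s X_homeo(11)[OF j] by (auto simp: K_def)
  next
    case False
    then show ?thesis using disj[OF i j False] K_subset_ball[OF i] X_in_ball[OF j s(2)] by blast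
  qed
  then show ?thesis by (auto simp: Om_def)
qed

lemma X_in_closure_Om:
  assumes j: "j \<in> J" and s: "1 \<le> norm s" "norm s \<le> N"
  shows "X j s \<in> closure Om"
proof (cases "norm s = 1")
  case True
  then have "s \<in> sphere 0 1" by simp
  then have "X j s \<in> frontier Om" unfolding frontier_Om using j by blast
  then show ?thesis by (simp add: frontier_def)
next
  case False
  then show ?thesis using X_in_Om[OF j _ s(2)] s closure_subset by force
qed

lemma winding_number_Gam_eq:
  assumes i: "i \<in> J" "z \<in> K i" and j: "j \<in> J" and r: "1 < r" "r \<le> N"
  shows "winding_number (Gam j r) z = (if i = j then 1 else 0)"
proof (cases "i = j")
  case True
  obtain s where s: "z = X i s" "norm s \<le> 1" using i by (auto simp: K_def)
  have "z \<notin> X j ` sphere 0 r" "z \<in> X j ` ball 0 r"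
    using s r X_homeo(11)[OF i(1)] True by auto
  then show ?thesis using winding_number_Gam[OF j, of r z] r True by simp
next
  case False
  have "z \<notin> X j ` cball 0 r"
    using disj[OF i(1) j False] K_subset_ball[OF i(1)] i(2) X_in_ball[OF j] r by fastforce
  then have "z \<notin> X j ` sphere 0 r" "z \<notin> X j ` ball 0 r" by auto
  then show ?thesis using winding_number_Gam[OF j, of r z] r False by simp
qed

text \<open>About a point of a cell the large circle winds once, and so does exactly one of the
  loops. Their difference is therefore a cycle to which Cauchy's theorem in \<open>Om\<close>
  applies.\<close>

lemma sum_Gam_circlepath:
  assumes g: "g holomorphic_on Om" and r: "1 < r" "r \<le> N" and R: "(\<Union>j\<in>J. K j) \<subseteq> ball 0 R" "0 < R"
  shows "(\<Sum>j\<in>J. contour_integral (Gam j r) g) = contour_integral (circlepath 0 R) g"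
proof -
  define js where "js = sorted_list_of_set J"
  have js: "set js = J" "distinct js" using finite_J by (auto simp: js_def)
  let ?\<gamma>s = "circlepath 0 R # map (\<lambda>j. reversepath (Gam j r)) js"
  have sub: "path_image (Gam j r) \<subseteq> Om" if "j \<in> J" for j
    using that r path_image_Gam[OF that, of r] X_in_Om[OF that] by auto
  have subR: "sphere 0 R \<subseteq> Om"
    using R by (force simp: Om_def)
  have "(\<Sum>\<gamma>\<leftarrow>?\<gamma>s. contour_integral \<gamma> g) = 0"
  proof (rule Cauchy_theorem_cycle[OF open_Om connected_Om g])
    fix \<gamma> assume "\<gamma> \<in> set ?\<gamma>s"
    then show "valid_path \<gamma> \<and> pathfinish \<gamma> = pathstart \<gamma> \<and> path_image \<gamma> \<subseteq> Om"
      using sub subR r R valid_path_Gam[of _ r] loop_Gam[of _ r] js(1) by force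
  next
    fix w assume "w \<notin> Om"
    then obtain i where i: "i \<in> J" "w \<in> K i" by (auto simp: Om_def)
    have "(\<Sum>\<gamma>\<leftarrow>?\<gamma>s. winding_number \<gamma> w) = 1 + (\<Sum>j\<leftarrow>js. winding_number (reversepath (Gam j r)) w)"
    proof -
      have "w \<in> ball 0 R" using R i by blast
      then have "winding_number (circlepath 0 R) w = 1" by (intro winding_number_circlepath) simp
      then show ?thesis by (simp add: comp_def)
    qed
    also have "(\<Sum>j\<leftarrow>js. winding_number (reversepath (Gam j r)) w) = (\<Sum>j\<in>J. winding_number (reversepath (Gam j r)) w)"
      using js by (simp add: sum_list_distinct_conv_sum_set)
    also have "\<dots> = (\<Sum>j\<in>J. - (if i = j then 1 else 0))"
    proof (rule sum.cong)
      fix j assume j: "j \<in> J"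
      have "w \<notin> path_image (Gam j r)" using sub[OF j] \<open>w \<notin> Om\<close> by auto
      then show "winding_number (reversepath (Gam j r)) w = - (if i = j then 1 else 0)"
        using winding_number_Gam_eq[OF i j r] valid_path_Gam[OF j, of r] r
        by (simp add: winding_number_reversepath valid_path_imp_path)
    qed simp
    also have "\<dots> = -1" using finite_J i by (simp add: sum_negf)
    finally show "(\<Sum>\<gamma>\<leftarrow>?\<gamma>s. winding_number \<gamma> w) = 0" by simp
  qed
  then have "contour_integral (circlepath 0 R) g + (\<Sum>j\<in>J. contour_integral (reversepath (Gam j r)) g) = 0"
    using js by (simp add: comp_def sum_list_distinct_conv_sum_set)
  moreover have "(\<Sum>j\<in>J. contour_integral (reversepath (Gam j r)) g) = (\<Sum>j\<in>J. - contour_integral (Gam j r) g)"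
    using valid_path_Gam r by (intro sum.cong contour_integral_reversepath) auto
  ultimately show ?thesis by (simp add: sum_negf)
qed

section \<open>Boundary integrals and Cauchy's formula for the exterior\<close>

lemma contour_integral_Gam:
  assumes j: "j \<in> J" and r: "1 \<le> r"
  shows "contour_integral (Gam j r) g = 2 * of_real pi * \<i> *
     integral {0..1} (\<lambda>x. g (X j (of_real r * unit_exp x)) *
        (deriv (ph j) (of_real r * unit_exp x) * (of_real r * unit_exp x)))"
proof -
  have "contour_integral (Gam j r) g = contour_integral (circlepath 0 r) (\<lambda>s. deriv (ph j) s * g (ph j s))"
    unfolding Gam_def using holomorphic_ph[OF j] open_norm_gt r rho
    by (intro contour_integral_comp_analyticW[of _ "{s. \<rho> < norm s}"]) (auto simp: analytic_on_open)
  also have "\<dots> = 2 * of_real pi * \<i> *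
     integral {0..1} (\<lambda>x. (deriv (ph j) (of_real r * unit_exp x) * g (ph j (of_real r * unit_exp x))) * (of_real r * unit_exp x))"
    by (rule contour_integral_circlepath_unit_exp)
  also have "(\<lambda>x. (deriv (ph j) (of_real r * unit_exp x) * g (ph j (of_real r * unit_exp x))) * (of_real r * unit_exp x))
     = (\<lambda>x. g (X j (of_real r * unit_exp x)) * (deriv (ph j) (of_real r * unit_exp x) * (of_real r * unit_exp x)))"
    using r by (intro ext) (simp add: ph_eq_X[OF j] norm_mult)
  finally show ?thesis .
qed

lemma continuous_on_deriv_ph: "j \<in> J \<Longrightarrow> continuous_on {s. \<rho> < norm s} (deriv (ph j))"
  by (intro holomorphic_on_imp_continuous_on holomorphic_deriv holomorphic_ph open_norm_gt)

text \<open>For \<open>r > 1\<close> the loops lie in \<open>Om\<close> and can be exchanged for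
  ever larger circles, over which the integral tends to 0. As \<open>g\<close> is only continuous at
  the boundary, the case \<open>r = 1\<close> is a limit: pulled back to the parameter interval, the
  integrand is jointly continuous in \<open>r\<close> and the angle.\<close>

lemma sum_contour_integral_Gam_eq_0:
  assumes g: "g holomorphic_on Om" "continuous_on (closure Om) g"
    and decay: "\<And>z. R0 \<le> norm z \<Longrightarrow> norm (g z) \<le> C / (norm z)\<^sup>2"
  shows "(\<Sum>j\<in>J. contour_integral (Gam j 1) g) = 0"
proof -
  define S where "S r = (\<Sum>j\<in>J. contour_integral (Gam j r) g)" for r
  have S0: "S r = 0" if r: "1 < r" "r \<le> N" for r
  proof -
    obtain R1 where R1: "R1 > 0" "(\<Union>j\<in>J. K j) \<subseteq> ball 0 R1"
      using bounded_subset_ballD[OF compact_imp_bounded[OF compact_KK], of 0] by blast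
    have le: "norm (S r) \<le> 2 * pi * \<bar>C\<bar> / R" if R: "R \<ge> max R0 R1" for R
    proof -
      have Rp: "R > 0" "R \<ge> R0" using R R1 by auto
      have Rs: "(\<Union>j\<in>J. K j) \<subseteq> ball 0 R" using R1 R by (auto dest!: subsetD)
      have "sphere 0 R \<subseteq> Om" using Rs by (force simp: Om_def)
      then have "g contour_integrable_on (circlepath 0 R)"
        using Rp by (intro contour_integrable_continuous_circlepath continuous_on_subset[OF holomorphic_on_imp_continuous_on[OF g(1)]]) auto
      then have "(g has_contour_integral S r) (circlepath 0 R)"
        unfolding S_def sum_Gam_circlepath[OF g(1) r Rs Rp(1)] by (rule has_contour_integral_integral)
      then have "norm (S r) \<le> (\<bar>C\<bar> / R\<^sup>2) * (2 * pi * R)"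
      proof (rule has_contour_integral_bound_circlepath)
        fix z :: complex assume "norm (z - 0) = R"
        then have "norm (g z) \<le> C / R\<^sup>2" using decay[of z] Rp by simp
        also have "\<dots> \<le> \<bar>C\<bar> / R\<^sup>2" by (intro divide_right_mono) auto
        finally show "norm (g z) \<le> \<bar>C\<bar> / R\<^sup>2" .
      qed (use Rp in auto)
      then show ?thesis using Rp by (simp add: power2_eq_square field_simps)
    qed
    have "((\<lambda>R. 2 * pi * \<bar>C\<bar> / R) \<longlongrightarrow> 0) at_top" (is "(?f \<longlongrightarrow> 0) at_top")
      by (intro tendsto_divide_0[OF tendsto_const] filterlim_at_top_imp_at_infinity filterlim_ident)
    then have "norm (S r) \<le> 0"
      using le by (intro tendsto_lowerbound[of ?f 0 at_top]) (auto simp: eventually_at_top_linorder intro!: exI[of _ "max R0 R1"])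
    then show ?thesis by simp
  qed
  have cont: "continuous_on {1..N} S"
    unfolding S_def
  proof (rule continuous_on_sum)
    fix j assume j: "j \<in> J"
    let ?h = "\<lambda>r x. g (X j (of_real r * unit_exp x)) *
        (deriv (ph j) (of_real r * unit_exp x) * (of_real r * unit_exp x))"
    have c: "continuous_on ({1..N} \<times> cbox 0 1) (\<lambda>p. of_real (fst p) * unit_exp (snd p))"
      by (intro continuous_intros)
    have im: "(\<lambda>p. of_real (fst p) * unit_exp (snd p)) ` ({1..N} \<times> cbox 0 1) \<subseteq> {s. 1 \<le> norm s \<and> norm s \<le> N}"
      by (auto simp: norm_mult)
    have "continuous_on {s. 1 \<le> norm s \<and> norm s \<le> N} (\<lambda>s. g (X j s) * (deriv (ph j) s * s))"
      using rho X_in_closure_Om[OF j]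
      by (intro continuous_intros continuous_on_subset[OF continuous_on_deriv_ph[OF j]]
          continuous_on_compose2[OF g(2) X_homeo(7)[OF j]]) auto
    from continuous_on_compose2[OF this c im]
    have "continuous_on {1..N} (\<lambda>r. integral (cbox 0 1) (?h r))"
      by (intro integral_continuous_on_param) (simp add: case_prod_beta)
    then have "continuous_on {1..N} (\<lambda>r. 2 * of_real pi * \<i> * integral {0..1} (?h r))"
      by (intro continuous_intros) simp
    then show "continuous_on {1..N} (\<lambda>r. contour_integral (Gam j r) g)"
      by (rule continuous_on_eq) (simp add: contour_integral_Gam[OF j])
  qed
  have "(S \<longlongrightarrow> S 1) (at 1 within {1..N})"
    using cont[unfolded continuous_on_def, rule_format, of 1] N by simp
  then have "(S \<longlongrightarrow> S 1) (at_right 1)"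
    using N by (simp add: at_within_Icc_at_right)
  moreover have "eventually (\<lambda>r. S r = 0) (at_right 1)"
    using N S0 by (auto simp: eventually_at_right_field intro!: exI[of _ N])
  then have "(S \<longlongrightarrow> 0) (at_right 1)" by (simp add: tendsto_eventually)
  ultimately have "S 1 = 0" by (intro tendsto_unique[of "at_right (1::real)"]) auto
  then show ?thesis by (simp add: S_def)
qed

lemma contour_integrable_Gam:
  assumes j: "j \<in> J" and g: "continuous_on (X j ` sphere 0 1) g"
  shows "g contour_integrable_on Gam j 1"
proof -
  have vd: "vector_derivative (Gam j 1) (at x) = deriv (ph j) (circlepath 0 1 x) * vector_derivative (circlepath 0 1) (at x)" for x
  proof -
    have "circlepath 0 1 differentiable at x"
      using has_vector_derivative_circlepath[of 0 1 x UNIV] by (auto simp: differentiableI_vector)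
    moreover have "ph j field_differentiable at (circlepath 0 1 x)"
      using holomorphic_ph[OF j] open_norm_gt rho
      by (intro holomorphic_on_imp_differentiable_at) auto
    ultimately show ?thesis unfolding Gam_def
      by (subst vector_derivative_chain_at_general) (auto simp: mult.commute)
  qed
  have "continuous_on {0..1} (\<lambda>x. g (Gam j 1 x))"
    unfolding Gam_eq[OF j order_refl] comp_def
    by (intro continuous_on_compose2[OF g] continuous_on_compose2[OF X_homeo(7)[OF j]])
       (auto simp: circlepath intro!: continuous_intros)
  moreover have "continuous_on {0..1} (\<lambda>x. deriv (ph j) (circlepath 0 1 x))"
    using rho by (intro continuous_on_compose2[OF continuous_on_deriv_ph[OF j]])
       (auto simp: circlepath intro!: continuous_intros)
  moreover have "continuous_on {0..1} (\<lambda>x. vector_derivative (circlepath 0 1) (at x))"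
    unfolding vector_derivative_circlepath by (intro continuous_intros)
  ultimately show ?thesis
    unfolding contour_integrable_on vd
    by (intro integrable_continuous_real continuous_intros)
qed

lemma sphere_subset_closure: "j \<in> J \<Longrightarrow> X j ` sphere 0 1 \<subseteq> closure Om"
  using X_in_closure_Om N by auto

lemma contour_integral_Gam_Cauchy:
  assumes j: "j \<in> J" and z: "z \<notin> X j ` sphere 0 1"
  shows "((\<lambda>w. 1 / (w - z)) has_contour_integral
     (2 * of_real pi * \<i> * (if z \<in> X j ` ball 0 1 then 1 else 0))) (Gam j 1)"
  using has_contour_integral_winding_number[OF valid_path_Gam[OF j order_refl], of z]
    winding_number_Gam[OF j order_refl z] path_image_Gam[OF j order_refl] z by simp

text \<open>The kernel adds one order of decay, and its pole lies outside
  \<open>closure Om\<close>.\<close>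

lemma exterior_Cauchy_inside:
  assumes f: "f holomorphic_on Om" "continuous_on (closure Om) f"
    and decay: "\<And>z. R0 \<le> norm z \<Longrightarrow> norm (f z) \<le> C / norm z"
    and \<xi>: "i \<in> J" "\<xi> \<in> X i ` ball 0 1"
  shows "(\<Sum>j\<in>J. contour_integral (Gam j 1) (\<lambda>w. f w / (w - \<xi>))) = 0"
proof (rule sum_contour_integral_Gam_eq_0)
  have nin: "\<xi> \<notin> closure Om" using \<xi> by (auto simp: closure_Om)
  then have "\<xi> \<notin> Om" using closure_subset by blast
  then show "(\<lambda>w. f w / (w - \<xi>)) holomorphic_on Om"
    using f by (intro holomorphic_intros) auto
  show "continuous_on (closure Om) (\<lambda>w. f w / (w - \<xi>))"
    using nin f by (intro continuous_intros) auto
  fix z :: complex assume z: "max R0 (2 * norm \<xi> + 1) \<le> norm z"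
  have "norm z / 2 \<le> norm (z - \<xi>)" using norm_triangle_ineq2[of z \<xi>] z by auto
  moreover have "norm z > 0" using z norm_ge_zero[of \<xi>] by linarith
  ultimately have "norm (f z / (z - \<xi>)) \<le> (C / norm z) / (norm z / 2)"
    unfolding norm_divide using decay[of z] z order_trans[OF norm_ge_zero decay[of z]] by (intro frac_le) auto
  then show "norm (f z / (z - \<xi>)) \<le> 2 * C / (norm z)\<^sup>2"
    by (simp add: power2_eq_square field_simps)
qed

text \<open>The difference quotient \<open>q\<close> removes the pole at \<open>\<xi>\<close>, but
  it decays only like \<open>- f \<xi> / z\<close>. The term \<open>f \<xi> / (z - p)\<close>, with
  its pole hidden in a cell, cancels this leading part and makes
  \<open>sum_contour_integral_Gam_eq_0\<close> applicable. The right-hand side is the price: the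
  loop around that cell winds once about \<open>p\<close>, and none winds about
  \<open>\<xi>\<close>.\<close>

lemma exterior_Cauchy_outside:
  assumes f: "f holomorphic_on Om" "continuous_on (closure Om) f"
    and decay: "\<And>z. R0 \<le> norm z \<Longrightarrow> norm (f z) \<le> C / norm z"
    and ne: "J \<noteq> {}" and \<xi>: "\<xi> \<in> Om"
  shows "(\<Sum>j\<in>J. contour_integral (Gam j 1) (\<lambda>w. f w / (w - \<xi>))) = - 2 * of_real pi * \<i> * f \<xi>"
proof -
  obtain i where i: "i \<in> J" using ne by blast
  define p where "p = X i 0"
  have p: "p \<in> X i ` ball 0 1" by (simp add: p_def)
  then have p_nin: "p \<notin> closure Om" using i by (auto simp: closure_Om)
  then have p_nin': "p \<notin> Om" using closure_subset by blast
  define q where "q z = (if z = \<xi> then deriv f \<xi> else (f z - f \<xi>) / (z - \<xi>))" for z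
  define g where "g z = q z + f \<xi> / (z - p)" for z
  have hol: "g holomorphic_on Om"
    unfolding g_def q_def using pole_lemma_open[OF f(1) open_Om, of \<xi>] p_nin'
    by (intro holomorphic_intros) auto
  have cont: "continuous_on (closure Om) g"
    unfolding continuous_on_eq_continuous_within
  proof
    fix z assume z: "z \<in> closure Om"
    show "continuous (at z within closure Om) g"
    proof (cases "z \<in> Om")
      case True
      then have "isCont g z"
        using holomorphic_on_imp_continuous_on[OF hol] open_Om by (simp add: continuous_on_eq_continuous_at)
      then show ?thesis by (rule continuous_at_imp_continuous_within)
    next
      case False
      then have zx: "z \<noteq> \<xi>" "z \<noteq> p" using \<xi> z p_nin by auto
      have "continuous (at z within closure Om) (\<lambda>z. (f z - f \<xi>) / (z - \<xi>) + f \<xi> / (z - p))"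
        using zx z f(2) by (intro continuous_intros) (auto simp: continuous_on_eq_continuous_within)
      then show ?thesis
        by (rule continuous_transform_within[where \<delta> = "dist z \<xi>"]) (use zx z in \<open>auto simp: g_def q_def dist_commute\<close>)
    qed
  qed
  have geq: "g z = f z / (z - \<xi>) - f \<xi> * (1 / (z - \<xi>)) + f \<xi> * (1 / (z - p))" if "z \<noteq> \<xi>" for z
    using that by (simp add: g_def q_def diff_divide_distrib)
  have "(\<Sum>j\<in>J. contour_integral (Gam j 1) g) = 0"
  proof (rule sum_contour_integral_Gam_eq_0[OF hol cont])
    fix z :: complex assume z: "max R0 (2 * norm \<xi> + 2 * norm p + 1) \<le> norm z"
    have z1: "norm z / 2 \<le> norm (z - \<xi>)" "norm z / 2 \<le> norm (z - p)"
      using norm_triangle_ineq2[of z \<xi>] norm_triangle_ineq2[of z p] z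
        norm_ge_zero[of \<xi>] norm_ge_zero[of p] unfolding max_def by (smt (verit, best) field_sum_of_halves)+
    have zp: "norm z > 0" using z norm_ge_zero[of \<xi>] norm_ge_zero[of p] by linarith
    have zne: "z \<noteq> \<xi>" "z \<noteq> p" using z1 zp by auto
    have "g z = f z / (z - \<xi>) + f \<xi> * (p - \<xi>) / ((z - \<xi>) * (z - p))"
    proof -
      have "1 / (z - p) - 1 / (z - \<xi>) = (p - \<xi>) / ((z - \<xi>) * (z - p))"
        using zne by (simp add: diff_frac_eq mult.commute)
      moreover have "g z = f z / (z - \<xi>) + f \<xi> * (1 / (z - p) - 1 / (z - \<xi>))"
        unfolding geq[OF zne(1)] by (simp add: right_diff_distrib)
      ultimately show ?thesis by simp
    qed
    also have "norm \<dots> \<le> norm (f z / (z - \<xi>)) + norm (f \<xi> * (p - \<xi>) / ((z - \<xi>) * (z - p)))"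
      by (rule norm_triangle_ineq)
    also have "norm (f z / (z - \<xi>)) \<le> (C / norm z) / (norm z / 2)"
      unfolding norm_divide using decay[of z] z z1 zp order_trans[OF norm_ge_zero decay[of z]] by (intro frac_le) auto
    also have "norm (f \<xi> * (p - \<xi>) / ((z - \<xi>) * (z - p))) \<le> norm (f \<xi> * (p - \<xi>)) / ((norm z / 2) * (norm z / 2))"
      unfolding norm_divide norm_mult using z1 zp by (intro frac_le mult_mono mult_pos_pos) auto
    finally show "norm (g z) \<le> (2 * C + 4 * norm (f \<xi> * (p - \<xi>))) / (norm z)\<^sup>2"
      using zp by (simp add: power2_eq_square add_divide_distrib mult.commute)
  qed
  moreover have "contour_integral (Gam j 1) (\<lambda>w. f w / (w - \<xi>)) =
      contour_integral (Gam j 1) g - (if j = i then 2 * of_real pi * \<i> * f \<xi> else 0)" if j: "j \<in> J" for j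
  proof -
    have \<xi>_nin: "\<xi> \<notin> X j ` sphere 0 1" "\<xi> \<notin> X j ` ball 0 1"
      using \<xi> j by (auto simp: Om_def K_def)
    have p_nin1: "p \<notin> X j ` sphere 0 1"
      using sphere_subset_closure[OF j] p_nin by auto
    have p_iff: "p \<in> X j ` ball 0 1 \<longleftrightarrow> j = i"
    proof
      assume "p \<in> X j ` ball 0 1"
      then have "p \<in> K j" "p \<in> K i" using p by (auto simp: K_def)
      then show "j = i" using K_subset_ball[OF i] K_subset_ball[OF j] disj[OF i j] by blast
    qed (use p in simp)
    have "g contour_integrable_on Gam j 1"
      using sphere_subset_closure[OF j] by (intro contour_integrable_Gam[OF j] continuous_on_subset[OF cont])
    then have "(g has_contour_integral contour_integral (Gam j 1) g) (Gam j 1)"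
      by (rule has_contour_integral_integral)
    then have "((\<lambda>z. g z + f \<xi> * (1 / (z - \<xi>)) - f \<xi> * (1 / (z - p))) has_contour_integral
       (contour_integral (Gam j 1) g + f \<xi> * (2 * of_real pi * \<i> * (if \<xi> \<in> X j ` ball 0 1 then 1 else 0))
         - f \<xi> * (2 * of_real pi * \<i> * (if p \<in> X j ` ball 0 1 then 1 else 0)))) (Gam j 1)"
      by (intro has_contour_integral_diff has_contour_integral_add has_contour_integral_lmul
            contour_integral_Gam_Cauchy j \<xi>_nin p_nin1)
    then have "((\<lambda>z. f z / (z - \<xi>)) has_contour_integral
       (contour_integral (Gam j 1) g + f \<xi> * (2 * of_real pi * \<i> * (if \<xi> \<in> X j ` ball 0 1 then 1 else 0))
         - f \<xi> * (2 * of_real pi * \<i> * (if p \<in> X j ` ball 0 1 then 1 else 0)))) (Gam j 1)"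
    proof (rule has_contour_integral_eq)
      fix z assume "z \<in> path_image (Gam j 1)"
      then have "z \<noteq> \<xi>" using \<xi>_nin path_image_Gam[OF j order_refl] by auto
      then show "g z + f \<xi> * (1 / (z - \<xi>)) - f \<xi> * (1 / (z - p)) = f z / (z - \<xi>)"
        by (simp add: geq)
    qed
    then show ?thesis using \<xi>_nin p_iff by (simp add: contour_integral_unique)
  qed
  ultimately show ?thesis using i finite_J by (simp add: sum_subtractf)
qed

section \<open>The quadrature identity\<close>

lemma negligible_frontier_Om: "negligible (frontier Om)"
  unfolding frontier_Om
proof (rule negligible_Union)
  show "finite ((\<lambda>j. X j ` sphere 0 1) ` J)" using finite_J by simp
  fix T assume "T \<in> (\<lambda>j. X j ` sphere 0 1) ` J"
  then obtain j where j: "j \<in> J" and T: "T = X j ` sphere 0 1" by auto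
  have "T = Gam j 1 ` {0..1}" using path_image_Gam[OF j order_refl] by (simp add: T path_image_def)
  moreover have "Gam j 1 differentiable_on {0..1}"
  proof -
    have "Gam j 1 differentiable at x" for x
    proof -
      have "ph j field_differentiable at (circlepath 0 1 x)"
        using holomorphic_ph[OF j] open_norm_gt rho by (intro holomorphic_on_imp_differentiable_at) auto
      moreover have "circlepath 0 1 differentiable at x"
        using has_vector_derivative_circlepath[of 0 1 x UNIV] by (auto simp: differentiableI_vector)
      ultimately show ?thesis unfolding Gam_def
        by (intro differentiable_chain_at) (auto simp: field_differentiable_imp_differentiable)
    qed
    then show ?thesis by (simp add: differentiable_at_imp_differentiable_on)
  qed
  ultimately show "negligible T"
    by (simp add: negligible_differentiable_image_lowdim)
qed

text \<open>Integrate over \<open>ball 0 R\<close> the Cauchy integral of \<open>f\<close> along the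
  boundary, which is \<open>- 2 pi i f\<close> in \<open>Om\<close> and 0 inside the cells. By
  Fubini the result is a boundary integral against the disc potential, and on the boundary that
  potential is \<open>pi cnj w\<close> for every disc containing the cells. Hence the value does not
  depend on \<open>R\<close>, and the principal value is eventually constant.\<close>

lemma area_integral_Om:
  assumes f: "f holomorphic_on Om" "continuous_on (closure Om) f"
    and decay: "\<And>z. R0 \<le> norm z \<Longrightarrow> norm (f z) \<le> C / norm z"
    and ne: "J \<noteq> {}" and R: "(\<Union>j\<in>J. K j) \<subseteq> ball 0 R"
  shows "(f has_integral (\<i> / 2 * (\<Sum>j\<in>J. contour_integral (Gam j 1) (\<lambda>w. f w * cnj w)))) (Om \<inter> ball 0 R)"
proof -
  define w where "w j x = X j (unit_exp x)" for j x
  \<comment> \<open>This is \<open>f(w) dw/dx\<close> along the boundary curve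
    \<open>w j\<close>.\<close>
  define b where "b j x = 2 * of_real pi * \<i> * (f (w j x) * (deriv (ph j) (unit_exp x) * unit_exp x))" for j x
  have cw: "continuous_on {0..1} (w j)" if j: "j \<in> J" for j
    unfolding w_def by (intro continuous_on_compose2[OF X_homeo(7)[OF j, of UNIV]] continuous_intros) auto
  have cb: "continuous_on {0..1} (b j)" if j: "j \<in> J" for j
    unfolding b_def using cw[OF j] rho X_in_closure_Om[OF j] N
    by (intro continuous_intros continuous_on_compose2[OF f(2) cw[OF j]]
      continuous_on_compose2[OF continuous_on_deriv_ph[OF j]]) (auto simp: w_def)
  have contour: "contour_integral (Gam j 1) (\<lambda>w. f w * h w) = (\<integral>x. indicator {0..1} x *\<^sub>R (b j x * h (w j x)) \<partial>lborel)"
    if j: "j \<in> J" and h: "continuous_on (X j ` sphere 0 1) h" for j h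
  proof -
    have "contour_integral (Gam j 1) (\<lambda>w. f w * h w) = integral {0..1} (\<lambda>x. b j x * h (w j x))"
      unfolding contour_integral_Gam[OF j order_refl] integral_mult_right[symmetric]
      by (rule integral_cong) (simp add: b_def w_def)
    also have "\<dots> = (LINT x:{0..1}|lborel. b j x * h (w j x))"
    proof (rule set_borel_integral_eq_integral(2)[symmetric])
      show "set_integrable lborel {0..1} (\<lambda>x. b j x * h (w j x))"
        by (intro borel_integrable_atLeastAtMost' continuous_intros cb[OF j] continuous_on_compose2[OF h cw[OF j]])
           (auto simp: w_def)
    qed
    finally show ?thesis by (simp add: set_lebesgue_integral_def)
  qed
  define I where "I j \<xi> = (\<integral>x. indicator {0..1} x *\<^sub>R (b j x / (w j x - \<xi>)) \<partial>lborel)" for j \<xi>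
  define G where "G \<xi> = (\<Sum>j\<in>J. indicator (ball 0 R) \<xi> *\<^sub>R I j \<xi>)" for \<xi>
  have "integrable lborel G"
    unfolding G_def I_def by (intro Bochner_Integration.integrable_sum cauchy_kernel_Fubini_integrable cb cw)
  then have "(G has_integral (\<integral>\<xi>. G \<xi> \<partial>lborel)) UNIV" by (rule has_integral_integral_lborel)
  also have "(\<integral>\<xi>. G \<xi> \<partial>lborel) = (\<Sum>j\<in>J. (\<integral>\<xi>. indicator (ball 0 R) \<xi> *\<^sub>R I j \<xi> \<partial>lborel))"
    unfolding G_def I_def by (intro Bochner_Integration.integral_sum cauchy_kernel_Fubini_integrable cb cw)
  also have "\<dots> = (\<Sum>j\<in>J. of_real pi * contour_integral (Gam j 1) (\<lambda>w. f w * cnj w))"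
  proof (rule sum.cong)
    fix j assume j: "j \<in> J"
    have wR: "norm (w j x) < R" for x
    proof -
      have "w j x \<in> K j" by (simp add: w_def K_def)
      then show ?thesis using R j by (auto simp: subset_iff)
    qed
    have "(\<integral>\<xi>. indicator (ball 0 R) \<xi> *\<^sub>R I j \<xi> \<partial>lborel) =
       (\<integral>x. indicator {0..1} x *\<^sub>R (b j x * disc_potential R (w j x)) \<partial>lborel)"
      unfolding I_def by (rule cauchy_kernel_Fubini[OF cb[OF j] cw[OF j]])
    also have "\<dots> = (\<integral>x. of_real pi * (indicator {0..1} x *\<^sub>R (b j x * cnj (w j x))) \<partial>lborel)"
      by (intro Bochner_Integration.integral_cong) (auto simp: disc_potential_eq[OF wR])
    also have "\<dots> = of_real pi * contour_integral (Gam j 1) (\<lambda>w. f w * cnj w)"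
      by (subst integral_mult_right_zero, subst contour[OF j]) (auto intro!: continuous_intros)
    finally show "(\<integral>\<xi>. indicator (ball 0 R) \<xi> *\<^sub>R I j \<xi> \<partial>lborel) =
      of_real pi * contour_integral (Gam j 1) (\<lambda>w. f w * cnj w)" .
  qed simp
  finally have G: "(G has_integral (\<Sum>j\<in>J. of_real pi * contour_integral (Gam j 1) (\<lambda>w. f w * cnj w))) UNIV" .
  have "((\<lambda>\<xi>. if \<xi> \<in> Om \<inter> ball 0 R then - 2 * of_real pi * \<i> * f \<xi> else 0) has_integral
     (\<Sum>j\<in>J. of_real pi * contour_integral (Gam j 1) (\<lambda>w. f w * cnj w))) UNIV"
  proof (rule has_integral_spike[OF negligible_frontier_Om _ G])
    fix \<xi> assume "\<xi> \<in> UNIV - frontier Om"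
    then have nf: "\<xi> \<notin> frontier Om" by simp
    have I: "I j \<xi> = contour_integral (Gam j 1) (\<lambda>w. f w / (w - \<xi>))" if j: "j \<in> J" for j
    proof -
      have "\<xi> \<notin> X j ` sphere 0 1" using nf j by (auto simp: frontier_Om)
      then show ?thesis
        using contour[OF j, of "\<lambda>w. 1 / (w - \<xi>)", symmetric]
        by (simp add: I_def, intro contour[OF j, of "\<lambda>w. 1 / (w - \<xi>)", simplified, symmetric] continuous_intros) auto
    qed
    show "(if \<xi> \<in> Om \<inter> ball 0 R then - 2 * of_real pi * \<i> * f \<xi> else 0) = G \<xi>"
    proof (cases "\<xi> \<in> Om")
      case True
      then show ?thesis using exterior_Cauchy_outside[OF f decay ne True]
        by (auto simp: G_def I indicator_def)
    next
      case False
      then have "\<xi> \<in> (\<Union>j\<in>J. K j) - frontier Om" using nf by (auto simp: Om_def)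
      then obtain i where "i \<in> J" "\<xi> \<in> X i ` ball 0 1" using closure_Om open_Om
        by (auto simp: frontier_def interior_open Om_def)
      then show ?thesis using exterior_Cauchy_inside[OF f decay, where i = i and \<xi> = \<xi>] False
        by (auto simp: G_def I indicator_def)
    qed
  qed
  then have "((\<lambda>\<xi>. - 2 * of_real pi * \<i> * f \<xi>) has_integral
     (\<Sum>j\<in>J. of_real pi * contour_integral (Gam j 1) (\<lambda>w. f w * cnj w))) (Om \<inter> ball 0 R)"
    by (simp only: has_integral_restrict_UNIV)
  from has_integral_mult_right[OF this, of "\<i> / (2 * of_real pi)"]
  show ?thesis by (simp add: sum_distrib_left[symmetric] field_simps)
qed

text \<open>On the boundary \<open>r\<close> is \<open>cnj w - c w\<close>. The product of
  \<open>f\<close> and \<open>c\<close> decays like \<open>1 / |z|\<^sup>2\<close>, so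
  \<open>c\<close> contributes nothing to the integral, and \<open>r\<close> may be replaced by
  \<open>cnj w\<close>, to which \<open>area_integral_Om\<close> applies.\<close>

lemma unbounded_quadrature_domain_Om:
  assumes ne: "J \<noteq> {}"
    and r: "continuous_on (frontier Om) r"
    and poles: "\<And>z. pole z \<Longrightarrow> z \<in> Om"
    and c: "c holomorphic_on Om" "continuous_on (closure Om) c"
    and c_decay: "\<And>z. Rc \<le> norm z \<Longrightarrow> norm (c z) \<le> Cc / norm z"
    and schwarz: "\<And>w. w \<in> frontier Om \<Longrightarrow> cnj w = r w + c w"
  shows "unbounded_quadrature_domain Om r pole"
proof -
  define js where "js = sorted_list_of_set J"
  have js: "set js = J" "distinct js" using finite_J by (auto simp: js_def)
  \<comment> \<open>\<open>Om\<close> lies outside the loops \<open>Gam j 1\<close>, so they are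
    positively oriented with respect to \<open>Om\<close> only after reversal.\<close>
  define \<gamma>s where "\<gamma>s = map (\<lambda>j. reversepath (Gam j 1)) js"
  have sum_js: "(\<Sum>\<gamma>\<leftarrow>\<gamma>s. F \<gamma>) = (\<Sum>j\<in>J. F (reversepath (Gam j 1)))" for F :: "(real \<Rightarrow> complex) \<Rightarrow> complex"
    using js by (simp add: \<gamma>s_def comp_def sum_list_distinct_conv_sum_set)
  have ubd: "\<exists>z. z \<in> Om"
    using bounded_Compl_Om not_bounded_UNIV by (metis Compl_empty_eq empty_iff subsetI subset_empty)
  have ud: "unbounded_domain Om"
    unfolding unbounded_domain_def
    using open_Om connected_Om bounded_Compl_Om interior_closure_Om ubd by auto
  have bc: "boundary_cycle Om \<gamma>s"
    unfolding boundary_cycle_def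
  proof (intro conjI ballI allI impI)
    fix \<gamma> assume "\<gamma> \<in> set \<gamma>s"
    then show "valid_path \<gamma>" "pathfinish \<gamma> = pathstart \<gamma>"
      using js(1) valid_path_Gam[of _ 1] loop_Gam[of _ 1] by (auto simp: \<gamma>s_def)
  next
    show "(\<Union>\<gamma>\<in>set \<gamma>s. path_image \<gamma>) = frontier Om"
      using js(1) path_image_Gam[of _ 1] by (simp add: \<gamma>s_def frontier_Om)
  next
    fix w assume w: "w \<notin> frontier Om"
    have "(\<Sum>\<gamma>\<leftarrow>\<gamma>s. winding_number \<gamma> w) = (\<Sum>j\<in>J. - (if w \<in> X j ` ball 0 1 then 1 else 0))"
      unfolding sum_js
    proof (rule sum.cong)
      fix j assume j: "j \<in> J"
      have "w \<notin> X j ` sphere 0 1" using w j by (auto simp: frontier_Om)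
      then show "winding_number (reversepath (Gam j 1)) w = - (if w \<in> X j ` ball 0 1 then 1 else 0)"
        using winding_number_Gam[OF j order_refl] path_image_Gam[OF j order_refl] valid_path_Gam[OF j order_refl]
        by (simp add: winding_number_reversepath valid_path_imp_path)
    qed simp
    also have "\<dots> = (if w \<in> Om then 0 else - 1)"
    proof (cases "w \<in> Om")
      case True
      then have "w \<notin> X j ` ball 0 1" if "j \<in> J" for j using that by (auto simp: Om_def K_def)
      then show ?thesis using True by simp
    next
      case False
      then obtain i where i: "i \<in> J" "w \<in> X i ` ball 0 1" using w closure_Om open_Om
        by (auto simp: frontier_def interior_open)
      have "w \<in> X j ` ball 0 1 \<longleftrightarrow> j = i" if j: "j \<in> J" for j
      proof
        assume "w \<in> X j ` ball 0 1"
        then have "w \<in> K j" "w \<in> K i" using i by (auto simp: K_def)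
        then show "j = i" using K_subset_ball[OF i(1)] K_subset_ball[OF j] disj[OF i(1) j] by blast
      qed (use i in simp)
      then have "(\<Sum>j\<in>J. - (if w \<in> X j ` ball 0 1 then 1 else 0)) = (\<Sum>j\<in>J. - (if j = i then 1 else 0 :: complex))"
        by (intro sum.cong) auto
      then show ?thesis using i finite_J False by (simp add: sum_negf)
    qed
    finally show "(\<Sum>\<gamma>\<leftarrow>\<gamma>s. winding_number \<gamma> w) = (if w \<in> Om then 0 else - 1)" .
  qed
  have "pv_area_integral_is Om f (boundary_integral \<gamma>s (\<lambda>z. f z * r z) / (2 * \<i>))" if tf: "test_function Om f" for f
  proof -
    have f: "f holomorphic_on Om" "continuous_on (closure Om) f"
      and an: "(\<lambda>w. if w = 0 then 0 else f (inverse w)) analytic_on {0}" (is "?F analytic_on {0}")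
      using tf by (auto simp: test_function_def)
    \<comment> \<open>As \<open>f\<close> is analytic at infinity with value 0, the difference
      quotient of \<open>h \<mapsto> f (1 / h)\<close> at 0 stays bounded; with
      \<open>h = 1 / z\<close> it is \<open>z f(z)\<close>.\<close>
    obtain R0 C0 where decay: "\<And>z. R0 \<le> norm z \<Longrightarrow> norm (f z) \<le> C0 / norm z" and R0: "R0 > 0"
    proof -
      obtain e where e: "e > 0" "?F holomorphic_on ball 0 e"
        using an by (auto simp: analytic_on_def)
      have "?F field_differentiable at 0"
        using e by (intro holomorphic_on_imp_differentiable_at[OF e(2)]) auto
      then obtain D where "(?F has_field_derivative D) (at 0)" by (auto simp: field_differentiable_def)
      then have "((\<lambda>h. (?F (0 + h) - ?F 0) / h) \<longlongrightarrow> D) (at 0)" by (simp add: DERIV_def)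
      then have "eventually (\<lambda>h. dist ((?F (0 + h) - ?F 0) / h) D < 1) (at 0)" by (rule tendstoD) simp
      then obtain d where d: "d > 0" "\<And>h. h \<noteq> 0 \<Longrightarrow> norm h < d \<Longrightarrow> dist ((?F (0 + h) - ?F 0) / h) D < 1"
        unfolding eventually_at by (auto simp: dist_norm)
      have "norm (f z) \<le> (norm D + 1) / norm z" if z: "2 / d \<le> norm z" for z
      proof -
        have z0: "z \<noteq> 0" using z d by auto
        have "1 < d * norm z" using z d by (simp add: field_simps)
        then have "norm (inverse z) < d"
          unfolding norm_inverse using z0 by (simp add: inverse_eq_divide pos_divide_less_eq)
        then have "dist ((?F (0 + inverse z) - ?F 0) / inverse z) D < 1" using d(2)[of "inverse z"] z0 by simp
        then have "norm (f z * z - D) < 1" using z0 by (simp add: dist_norm divide_inverse)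
        then have "norm (f z * z) \<le> norm D + 1" using norm_triangle_ineq2[of "f z * z" D] by linarith
        then show ?thesis using z0 by (simp add: norm_mult field_simps)
      qed
      then show ?thesis using that[of "2/d"] d by auto
    qed
    obtain R2 where R2: "R2 > 0" "(\<Union>j\<in>J. K j) \<subseteq> ball 0 R2"
      using bounded_subset_ballD[OF compact_imp_bounded[OF compact_KK], of 0] by blast
    have "(\<Sum>j\<in>J. contour_integral (Gam j 1) (\<lambda>w. f w * c w)) = 0"
    proof (rule sum_contour_integral_Gam_eq_0)
      show "(\<lambda>w. f w * c w) holomorphic_on Om" using f c by (intro holomorphic_intros)
      show "continuous_on (closure Om) (\<lambda>w. f w * c w)" using f c by (intro continuous_intros)
      fix z :: complex assume z: "max R0 Rc \<le> norm z"
      have "norm (f z * c z) \<le> (C0 / norm z) * (Cc / norm z)"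
        unfolding norm_mult using decay[of z] c_decay[of z] z order_trans[OF norm_ge_zero decay[of z]]
        by (intro mult_mono) auto
      then show "norm (f z * c z) \<le> (C0 * Cc) / (norm z)\<^sup>2" by (simp add: power2_eq_square)
    qed
    moreover have "contour_integral (Gam j 1) (\<lambda>w. f w * cnj w) =
        contour_integral (Gam j 1) (\<lambda>w. f w * r w) + contour_integral (Gam j 1) (\<lambda>w. f w * c w)" if j: "j \<in> J" for j
    proof -
      have sub: "X j ` sphere 0 1 \<subseteq> frontier Om" using j by (auto simp: frontier_Om)
      have sub2: "X j ` sphere 0 1 \<subseteq> closure Om" by (rule sphere_subset_closure[OF j])
      have "contour_integral (Gam j 1) (\<lambda>w. f w * cnj w) = contour_integral (Gam j 1) (\<lambda>w. f w * r w + f w * c w)"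
        using sub by (intro contour_integral_eq) (auto simp: path_image_Gam[OF j] schwarz algebra_simps)
      also have "\<dots> = contour_integral (Gam j 1) (\<lambda>w. f w * r w) + contour_integral (Gam j 1) (\<lambda>w. f w * c w)"
        using sub sub2 by (intro contour_integral_add contour_integrable_Gam[OF j] continuous_intros
          continuous_on_subset[OF r] continuous_on_subset[OF f(2)] continuous_on_subset[OF c(2)])
      finally show ?thesis .
    qed
    ultimately have eq: "(\<Sum>j\<in>J. contour_integral (Gam j 1) (\<lambda>w. f w * cnj w)) = (\<Sum>j\<in>J. contour_integral (Gam j 1) (\<lambda>w. f w * r w))"
      by (simp add: sum.distrib)
    have "boundary_integral \<gamma>s (\<lambda>z. f z * r z) = - (\<Sum>j\<in>J. contour_integral (Gam j 1) (\<lambda>w. f w * r w))"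
      unfolding boundary_integral_def sum_js sum_negf[symmetric]
      using valid_path_Gam[of _ 1] by (intro sum.cong contour_integral_reversepath) auto
    then have val: "boundary_integral \<gamma>s (\<lambda>z. f z * r z) / (2 * \<i>) =
       \<i> / 2 * (\<Sum>j\<in>J. contour_integral (Gam j 1) (\<lambda>w. f w * cnj w))"
      unfolding eq by (simp add: field_simps)
    have "integral (Om \<inter> ball 0 R) f = boundary_integral \<gamma>s (\<lambda>z. f z * r z) / (2 * \<i>)" if "R \<ge> R2" for R
      unfolding val using R2 that
      by (intro integral_unique area_integral_Om[OF f decay ne]) (auto dest!: subsetD)
    then show ?thesis unfolding pv_area_integral_is_def
      by (intro tendsto_eventually) (auto simp: eventually_at_top_linorder intro!: exI[of _ R2])
  qed
  then show ?thesis unfolding unbounded_quadrature_domain_def using ud bc poles by blast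
qed

text \<open>The disjoint balls separate the cells from each other, so the points
  \<open>X j 0\<close> lie in different components of the complement.\<close>

lemma card_le_connectivity: "enat (card J) \<le> connectivity Om"
proof -
  define U where "U = (\<Union>j\<in>J. K j)"
  define comp where "comp j = connected_component_set U (X j 0)" for j
  have in_K: "X j 0 \<in> K j" for j by (simp add: K_def)
  have comp: "comp j \<in> components U" if "j \<in> J" for j
    using that in_K[of j] by (auto simp: comp_def components_def U_def)
  have inj: "inj_on comp J"
  proof (rule inj_onI, rule ccontr)
    fix i j assume ij: "i \<in> J" "j \<in> J" "comp i = comp j" "i \<noteq> j"
    let ?A = "ball (a i) \<delta>" and ?B = "\<Union>l\<in>J - {i}. ball (a l) \<delta>"
    have con: "connected (comp i)" by (simp add: comp_def)
    have sub: "comp i \<subseteq> U" unfolding comp_def by (rule connected_component_subset)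
    have "X l 0 \<in> comp l" if "l \<in> J" for l
      using that in_K[of l] by (auto simp: comp_def U_def)
    then have "X i 0 \<in> comp i" "X j 0 \<in> comp i"
      using ij by metis+
    moreover have "X i 0 \<in> ?A" "X j 0 \<in> ?B"
    proof -
      have "X l 0 \<in> ball (a l) \<delta>" if "l \<in> J" for l using X_in_ball[OF that, of 0] N by simp
      from this[OF ij(1)] this[OF ij(2)] ij(2,4) show "X i 0 \<in> ?A" "X j 0 \<in> ?B" by blast+
    qed
    moreover have "comp i \<subseteq> ?A \<union> ?B"
      using sub K_subset_ball unfolding U_def by fastforce
    moreover have "?A \<inter> ?B \<inter> comp i = {}" using disj[OF ij(1)] by blast
    ultimately show False using connectedD[OF con, of ?A ?B] by blast
  qed
  have "- Om = U" by (simp add: Om_def U_def)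
  then show ?thesis unfolding connectivity_def
    using card_inj_on_le[OF inj, of "components U"] comp by auto
qed

end

section \<open>The fixed point equation\<close>

text \<open>With \<open>\<sigma> = N * unit_exp x\<close> one has
  \<open>d\<sigma> / (2 pi i) = \<sigma> dx\<close>. So this is the Cauchy integral over
  \<open>|\<sigma>| = N\<close> of data \<open>v\<close> given as a function of the angle, and
  \<open>circle_Cauchy'\<close> is its derivative in \<open>z\<close>.\<close>

definition circle_Cauchy :: "real \<Rightarrow> (real \<Rightarrow> complex) \<Rightarrow> complex \<Rightarrow> complex" where
  "circle_Cauchy N v z = integral {0..1} (\<lambda>x. v x * (of_real N * unit_exp x / (of_real N * unit_exp x - z)))"

definition circle_Cauchy' :: "real \<Rightarrow> (real \<Rightarrow> complex) \<Rightarrow> complex \<Rightarrow> complex" where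
  "circle_Cauchy' N v z = integral {0..1} (\<lambda>x. v x * (of_real N * unit_exp x / (of_real N * unit_exp x - z)\<^sup>2))"

lemma circle_kernel_lower:
  assumes "0 < N"
  shows "N - norm z \<le> norm (of_real N * unit_exp x - z)"
  using norm_triangle_ineq2[of "of_real N * unit_exp x" z] assms by (simp add: norm_mult)

lemma circle_kernel_nonzero:
  assumes "norm z < N"
  shows "of_real N * unit_exp x - z \<noteq> 0"
  using circle_kernel_lower[of N z x] assms norm_ge_zero[of z] by auto

lemma norm_integral_unit_interval_le:
  fixes f :: "real \<Rightarrow> complex"
  assumes "continuous_on {0..1} f" "\<And>x. x \<in> {0..1} \<Longrightarrow> norm (f x) \<le> B"
  shows "norm (integral {0..1} f) \<le> B"
proof -
  have "norm (integral {0..1} f) \<le> B * (1 - 0)"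
    using integral_bound[of 0 1 f B] assms by simp
  then show ?thesis by simp
qed

context
  fixes N :: real and v :: "real \<Rightarrow> complex"
  assumes v: "continuous_on {0..1} v"
begin

lemma circle_Cauchy_integrand_continuous:
  assumes "norm z < N"
  shows "continuous_on {0..1} (\<lambda>x. v x * (of_real N * unit_exp x / (of_real N * unit_exp x - z)))"
    "continuous_on {0..1} (\<lambda>x. v x * (of_real N * unit_exp x / (of_real N * unit_exp x - z)\<^sup>2))"
  using circle_kernel_nonzero[OF assms] by (intro continuous_intros v; auto)+

lemma norm_circle_Cauchy_le:
  assumes z: "norm z < N" and B: "\<And>x. x \<in> {0..1} \<Longrightarrow> norm (v x) \<le> B"
  shows "norm (circle_Cauchy N v z) \<le> B * (N / (N - norm z))"
    and "norm (circle_Cauchy' N v z) \<le> B * (N / (N - norm z)\<^sup>2)"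
proof -
  have N: "0 < N" using z norm_ge_zero[of z] by linarith
  have B0: "0 \<le> B" using order_trans[OF norm_ge_zero B[of 0]] by simp
  have k: "N - norm z \<le> norm (of_real N * unit_exp x - z)" for x by (rule circle_kernel_lower[OF N])
  show "norm (circle_Cauchy N v z) \<le> B * (N / (N - norm z))"
    unfolding circle_Cauchy_def
  proof (rule norm_integral_unit_interval_le[OF circle_Cauchy_integrand_continuous(1)[OF z]])
    fix x :: real assume x: "x \<in> {0..1}"
    show "norm (v x * (of_real N * unit_exp x / (of_real N * unit_exp x - z))) \<le> B * (N / (N - norm z))"
      unfolding norm_mult norm_divide using B[OF x] B0 k[of x] N z
      by (intro mult_mono frac_le) auto
  qed
  show "norm (circle_Cauchy' N v z) \<le> B * (N / (N - norm z)\<^sup>2)"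
    unfolding circle_Cauchy'_def
  proof (rule norm_integral_unit_interval_le[OF circle_Cauchy_integrand_continuous(2)[OF z]])
    fix x :: real assume x: "x \<in> {0..1}"
    show "norm (v x * (of_real N * unit_exp x / (of_real N * unit_exp x - z)\<^sup>2)) \<le> B * (N / (N - norm z)\<^sup>2)"
      unfolding norm_mult norm_divide norm_power using B[OF x] B0 k[of x] N z
      by (intro mult_mono frac_le power_mono) auto
  qed
qed

lemma circle_Cauchy_has_derivative:
  assumes z: "norm z < N"
  shows "(circle_Cauchy N v has_field_derivative circle_Cauchy' N v z) (at z)"
proof -
  have "((\<lambda>z. integral (cbox 0 1) (\<lambda>x. v x * (of_real N * unit_exp x / (of_real N * unit_exp x - z)))) has_field_derivative
      integral (cbox 0 1) (\<lambda>x. v x * (of_real N * unit_exp x / (of_real N * unit_exp x - z)\<^sup>2))) (at z within ball 0 N)"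
  proof (rule leibniz_rule_field_derivative)
    fix z :: complex and x :: real assume "z \<in> ball 0 N"
    then have ne: "of_real N * unit_exp x - z \<noteq> 0" by (intro circle_kernel_nonzero) simp
    then show "((\<lambda>z. v x * (of_real N * unit_exp x / (of_real N * unit_exp x - z))) has_field_derivative
        v x * (of_real N * unit_exp x / (of_real N * unit_exp x - z)\<^sup>2)) (at z within ball 0 N)"
      by (auto intro!: derivative_eq_intros simp: power2_eq_square)
  next
    fix z :: complex assume "z \<in> ball 0 N"
    then show "(\<lambda>x. v x * (of_real N * unit_exp x / (of_real N * unit_exp x - z))) integrable_on cbox 0 1"
      using integrable_continuous_real[OF circle_Cauchy_integrand_continuous(1)] by simp
  next
    have "continuous_on (ball 0 N \<times> cbox 0 1) (\<lambda>p. v (snd p))"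
      by (rule continuous_on_compose2[OF v]) (auto intro!: continuous_intros)
    then show "continuous_on (ball 0 N \<times> cbox 0 1) (\<lambda>(z, x). v x * (of_real N * unit_exp x / (of_real N * unit_exp x - z)\<^sup>2))"
      unfolding case_prod_beta using circle_kernel_nonzero
      by (intro continuous_intros) auto
  qed (use z in auto)
  then show ?thesis
    using z at_within_open[of z "ball 0 N"] by (simp add: circle_Cauchy_def[abs_def] circle_Cauchy'_def)
qed

lemma circle_Cauchy_holomorphic: "circle_Cauchy N v holomorphic_on ball 0 N"
  unfolding holomorphic_on_open[OF open_ball] using circle_Cauchy_has_derivative by (metis mem_ball_0)

lemma circle_Cauchy'_continuous: "continuous_on (ball 0 N) (circle_Cauchy' N v)"
proof -
  have "deriv (circle_Cauchy N v) holomorphic_on ball 0 N"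
    by (intro holomorphic_deriv circle_Cauchy_holomorphic) auto
  then have "continuous_on (ball 0 N) (deriv (circle_Cauchy N v))" by (rule holomorphic_on_imp_continuous_on)
  then show ?thesis
    by (rule continuous_on_eq) (auto intro!: DERIV_imp_deriv circle_Cauchy_has_derivative)
qed

end

lemma circle_Cauchy_diff:
  assumes "continuous_on {0..1} v" "continuous_on {0..1} w" "norm z < N"
  shows "circle_Cauchy N (\<lambda>x. v x - w x) z = circle_Cauchy N v z - circle_Cauchy N w z"
    "circle_Cauchy' N (\<lambda>x. v x - w x) z = circle_Cauchy' N v z - circle_Cauchy' N w z"
  using circle_Cauchy_integrand_continuous[OF assms(1,3)] circle_Cauchy_integrand_continuous[OF assms(2,3)]
  unfolding circle_Cauchy_def circle_Cauchy'_def
  by (simp_all add: Henstock_Kurzweil_Integration.integral_diff[symmetric] integrable_continuous_real left_diff_distrib diff_divide_distrib)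

lemma circle_Cauchy_contour:
  assumes "0 < N"
  shows "circle_Cauchy N (\<lambda>x. F (of_real N * unit_exp x)) z
      = contour_integral (circlepath 0 N) (\<lambda>s. F s / (s - z)) / (2 * of_real pi * \<i>)"
    "circle_Cauchy' N (\<lambda>x. F (of_real N * unit_exp x)) z
      = contour_integral (circlepath 0 N) (\<lambda>s. F s / (s - z)\<^sup>2) / (2 * of_real pi * \<i>)"
  unfolding contour_integral_circlepath_unit_exp circle_Cauchy_def circle_Cauchy'_def by simp_all

text \<open>A family of functions becomes a single continuous function on a product with a discrete
  factor, so that the Banach space of bounded continuous functions applies to families.\<close>

lemma continuous_on_discrete_Times:
  fixes f :: "'i \<Rightarrow> 'a::topological_space \<Rightarrow> 'b::topological_space"
  assumes "\<And>j. continuous_on UNIV (f j)"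
  shows "continuous_on UNIV (\<lambda>p. f (of_discrete (fst p)) (snd p))"
proof -
  have "continuous_on (\<Union>j. {j} \<times> UNIV) (\<lambda>p. f (of_discrete (fst p)) (snd p))"
  proof (rule continuous_on_open_UN)
    fix j :: "'i discrete"
    show "open ({j} \<times> (UNIV :: 'a set))" by (intro open_Times open_discrete) simp
    have "continuous_on ({j} \<times> UNIV) (\<lambda>p. f (of_discrete j) (snd p))"
      by (rule continuous_on_compose2[OF assms[of "of_discrete j"]]) (auto intro!: continuous_intros)
    then show "continuous_on ({j} \<times> UNIV) (\<lambda>p. f (of_discrete (fst p)) (snd p))"
      by (rule continuous_on_eq) auto
  qed
  also have "(\<Union>j. {j} \<times> UNIV) = (UNIV :: ('i discrete \<times> 'a) set)" by auto
  finally show ?thesis .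
qed

text \<open>Banach's theorem in the closed ball of radius \<open>M\<close> of the bounded continuous
  functions on \<open>'i discrete \<times> real\<close>.\<close>

lemma family_contraction_fixpoint:
  fixes T :: "('i \<Rightarrow> real \<Rightarrow> complex) \<Rightarrow> 'i \<Rightarrow> real \<Rightarrow> complex"
  assumes M: "0 \<le> M" and q: "0 \<le> q" "q < 1"
    and cont: "\<And>u j. (\<And>j. continuous_on UNIV (u j)) \<Longrightarrow> (\<And>j x. norm (u j x) \<le> M) \<Longrightarrow> continuous_on UNIV (T u j)"
    and bound: "\<And>u j x. (\<And>j. continuous_on UNIV (u j)) \<Longrightarrow> (\<And>j x. norm (u j x) \<le> M) \<Longrightarrow> norm (T u j x) \<le> M"
    and contr: "\<And>u v D j x. (\<And>j. continuous_on UNIV (u j)) \<Longrightarrow> (\<And>j x. norm (u j x) \<le> M) \<Longrightarrow>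
       (\<And>j. continuous_on UNIV (v j)) \<Longrightarrow> (\<And>j x. norm (v j x) \<le> M) \<Longrightarrow>
       (\<And>j x. norm (u j x - v j x) \<le> D) \<Longrightarrow> norm (T u j x - T v j x) \<le> q * D"
  obtains u where "\<And>j. continuous_on UNIV (u j)" "\<And>j x. norm (u j x) \<le> M" "\<And>j x. T u j x = u j x"
proof -
  define F where "F U = (\<lambda>j x. apply_bcontfun U (discrete j, x))" for U :: "('i discrete \<times> real) \<Rightarrow>\<^sub>C complex"
  define S where "S = cball (0 :: ('i discrete \<times> real) \<Rightarrow>\<^sub>C complex) M"
  \<comment> \<open>Outside \<open>S\<close> the argument of \<open>Bcontfun\<close> need not be
    bounded or continuous, and \<open>T' U\<close> is then unspecified. Banach's theorem is applied
    on \<open>S\<close> only.\<close>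
  define T' where "T' U = Bcontfun (\<lambda>p. T (F U) (of_discrete (fst p)) (snd p))" for U
  have Fc: "continuous_on UNIV (F U j)" for U j
    unfolding F_def by (rule continuous_on_compose2[of UNIV "apply_bcontfun U"]) (auto intro!: continuous_intros)
  have Fb: "norm (F U j x) \<le> M" if "U \<in> S" for U j x
    using that norm_bounded[of U "(discrete j, x)"] by (simp add: F_def S_def)
  have Fd: "norm (F U j x - F V j x) \<le> dist U V" for U V j x
    using dist_bounded[of U "(discrete j, x)" V] by (simp add: F_def dist_norm)
  have T'_apply: "apply_bcontfun (T' U) (j, x) = T (F U) (of_discrete j) x" if U: "U \<in> S" for U j x
  proof -
    have "(\<lambda>p. T (F U) (of_discrete (fst p)) (snd p)) \<in> bcontfun"
      using cont[OF Fc Fb[OF U]] bound[OF Fc Fb[OF U]]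
      by (intro bcontfun_normI[of _ M] continuous_on_discrete_Times) auto
    then show ?thesis by (simp add: T'_def Bcontfun_inverse)
  qed
  have "\<exists>!U\<in>S. T' U = U"
  proof (rule Banach_fix[OF _ _ q])
    show "complete S" unfolding S_def by (rule complete_eq_closed[THEN iffD2]) (rule closed_cball)
    show "S \<noteq> {}" using M by (auto simp: S_def)
    show "T' ` S \<subseteq> S"
    proof safe
      fix U assume U: "U \<in> S"
      have "norm (T' U) \<le> M"
        using bound[OF Fc Fb[OF U]] by (intro norm_bound) (auto simp: T'_apply[OF U])
      then show "T' U \<in> S" by (simp add: S_def)
    qed
    fix U V assume U: "U \<in> S" and V: "V \<in> S"
    show "dist (T' U) (T' V) \<le> q * dist U V"
      using contr[OF Fc Fb[OF U] Fc Fb[OF V] Fd]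
      by (intro dist_bound) (auto simp: T'_apply[OF U] T'_apply[OF V] dist_norm)
  qed
  then obtain U where U: "U \<in> S" "T' U = U" by blast
  have "T (F U) j x = F U j x" for j x
  proof -
    have "apply_bcontfun U (discrete j, x) = T (F U) j x"
      using T'_apply[OF U(1), of "discrete j" x] unfolding U(2) discrete_inverse[OF UNIV_I] .
    then show ?thesis by (simp only: F_def)
  qed
  then show ?thesis using that[of "F U"] Fc Fb[OF U(1)] by blast
qed

text \<open>
  \<open>\<alpha> j\<close> is the derivative of \<open>r\<close> at \<open>a j\<close>. The factor \<open>N\<^sup>2 / (N\<^sup>2 - 1)\<close> bounds the Cauchy projection
  from the circle of radius \<open>N\<close> to that of radius \<open>1 / N\<close>; it tends to 1 as \<open>N\<close> grows, so that
  \<open>A < 1\<close> suffices for a contraction.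
\<close>

locale attracting_data =
  fixes n :: nat and a \<alpha> :: "nat \<Rightarrow> complex" and r :: "complex \<Rightarrow> complex" and N M t \<delta> \<eta> A q L :: real
  assumes N: "2 \<le> N" and M: "0 \<le> M" and t: "0 < t" "t \<le> 1" and \<delta>: "0 < \<delta>" and \<eta>: "0 \<le> \<eta>"
    and sep: "\<And>i j. i < n \<Longrightarrow> j < n \<Longrightarrow> i \<noteq> j \<Longrightarrow> 4 * \<delta> \<le> norm (a i - a j)"
    and r_hol: "\<And>j. j < n \<Longrightarrow> r holomorphic_on ball (a j) \<delta>"
    and r_fix: "\<And>j. j < n \<Longrightarrow> r (a j) = cnj (a j)"
    and r_lip: "\<And>j x y. j < n \<Longrightarrow> x \<in> ball (a j) \<delta> \<Longrightarrow> y \<in> ball (a j) \<delta> \<Longrightarrow>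
        norm ((r x - \<alpha> j * x) - (r y - \<alpha> j * y)) \<le> \<eta> * norm (x - y)"
    and \<alpha>: "\<And>j. j < n \<Longrightarrow> norm (\<alpha> j) \<le> A" and A: "0 \<le> A"
    and t_small: "t * (N + 2 * M) < \<delta>"
    and self_map: "(A + \<eta>) * (N + N\<^sup>2 / (N\<^sup>2 - 1) * M) + t * (n * ((1 + 2 * M)\<^sup>2 / (2 * \<delta>))) \<le> M"
    and contraction: "(A + \<eta>) * (N\<^sup>2 / (N\<^sup>2 - 1)) +
         t * (n * (4 * (1 + 2 * M) / (2 * \<delta>) + (1 + 2 * M)\<^sup>2 * 4 / (2 * \<delta>)\<^sup>2)) \<le> q" "q < 1"
    and L: "A + 2 * (\<eta> * (N + 2 * M) + t * (n * ((1 + 2 * M)\<^sup>2 / (2 * \<delta>)))) \<le> L" "L < 1"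
begin

abbreviation "\<kappa> \<equiv> N\<^sup>2 / (N\<^sup>2 - 1)"

definition adm :: "(nat \<Rightarrow> real \<Rightarrow> complex) \<Rightarrow> bool" where
  "adm u \<longleftrightarrow> (\<forall>j. continuous_on UNIV (u j)) \<and> (\<forall>j x. norm (u j x) \<le> M)"

text \<open>
  The unknown \<open>u j x\<close> stands for the value of \<open>(r + \<Sum>\<^sub>l c\<^sub>l - cnj a\<^sub>j) / t\<close> at the point \<open>Y u j x = \<phi>\<^sub>j(N e\<^sup>2\<^sup>\<pi>\<^sup>i\<^sup>x)\<close>;
  \<open>h u j\<close> is its projection to nonnegative powers and \<open>d u j\<close> the derivative of the projection.
  \<open>W u l x = \<phi>\<^sub>l(e\<^sup>2\<^sup>\<pi>\<^sup>i\<^sup>x)\<close> runs through the boundary of the \<open>l\<close>-th cell, and \<open>t\<^sup>2 CC u l z\<close> is its Cauchy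
  transform \<open>(2\<pi>i)\<^sup>-\<^sup>1 \<ointegral> cnj w / (z - w) dw\<close>, where the constant \<open>cnj a\<^sub>l\<close> has been dropped from \<open>cnj w\<close>
  because it contributes nothing for \<open>z\<close> outside the cell.
\<close>

definition "h u j = circle_Cauchy N (u j)"
definition "d u j = circle_Cauchy' N (u j)"
text \<open>At \<open>w = W u l x\<close>, the density of
  \<open>(cnj w - cnj (a l)) dw / (2 pi i)\<close> with respect to \<open>x\<close> is
  \<open>t\<^sup>2 * P u l x\<close>: the first factor is \<open>cnj (w - a l) / t\<close>, the
  other two come from \<open>dw\<close>.\<close>

definition "P u l x = (cnj (unit_exp x) + h u l (unit_exp x)) *
   (1 - cnj (d u l (unit_exp x)) * (cnj (unit_exp x))\<^sup>2) * unit_exp x"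
definition "W u l x = a l + of_real t * (unit_exp x + cnj (h u l (unit_exp x)))"
definition "CC u l z = integral {0..1} (\<lambda>x. P u l x / (z - W u l x))"
definition "Y u j x = a j + of_real t * (of_real N * unit_exp x + cnj (h u j (unit_exp x / of_real N)))"
text \<open>Families are indexed by all natural numbers; the value 0 for \<open>j \<ge> n\<close>
  keeps the bounds valid there.\<close>

definition "T u j x = (if j < n then (r (Y u j x) - cnj (a j)) / of_real t +
    of_real t * (\<Sum>l\<in>{..<n} - {j}. CC u l (Y u j x)) else 0)"

lemma kappa: "0 \<le> \<kappa>" "\<kappa> \<le> 2"
proof -
  have "4 \<le> N\<^sup>2" using power_mono[OF N, of 2] by simp
  then show "0 \<le> \<kappa>" "\<kappa> \<le> 2" by (auto simp: field_simps)
qed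

lemma norm_le_1_less_N: "norm (z::complex) \<le> 1 \<Longrightarrow> norm z < N"
  using N by simp

lemma norm_le_invN_less_N: "norm (z::complex) \<le> 1 / N \<Longrightarrow> norm z < N"
proof -
  assume "norm z \<le> 1 / N"
  moreover have "1 / N \<le> 1" using N by simp
  ultimately show ?thesis using N by linarith
qed

lemma kernel_bounds:
  assumes "norm (z::complex) \<le> 1"
  shows "N / (N - norm z) \<le> 2" "N / (N - norm z)\<^sup>2 \<le> 2"
proof -
  have 1: "1 \<le> N - norm z" "N \<le> 2 * (N - norm z)" using assms N by auto
  then show "N / (N - norm z) \<le> 2" by (simp add: field_simps)
  have "2 * (N - norm z) * 1 \<le> 2 * (N - norm z) * (N - norm z)" using 1 by (intro mult_left_mono) auto
  then have "N \<le> 2 * (N - norm z)\<^sup>2" using 1 unfolding power2_eq_square by linarith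
  then show "N / (N - norm z)\<^sup>2 \<le> 2" using 1 by (simp add: divide_le_eq)
qed

lemma kernel_bound_kappa:
  assumes "norm (z::complex) \<le> 1 / N"
  shows "N / (N - norm z) \<le> \<kappa>"
proof -
  have N1: "1 / N < N" using N by (simp add: field_simps) (smt (verit) mult_le_cancel_left1)
  have "N / (N - norm z) \<le> N / (N - 1 / N)" using assms N1 N by (intro divide_left_mono mult_pos_pos) auto
  also have "\<dots> = \<kappa>" using N by (simp add: field_simps power2_eq_square)
  finally show ?thesis .
qed

lemma continuous_01: "adm u \<Longrightarrow> continuous_on {0..1} (u j)"
  by (auto simp: adm_def intro: continuous_on_subset)

text \<open>The crude factor 2 on the unit disc is enough for whatever is later multiplied by
  \<open>t\<close> or belongs to a small error. The sharper \<open>\<kappa>\<close> on the disc of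
  radius \<open>1 / N\<close> is needed for \<open>Y\<close>, whose displacement is multiplied by
  \<open>A\<close>.\<close>

lemma h_bounds:
  assumes c: "continuous_on {0..1} v" and B: "\<And>x. norm (v x) \<le> B"
  shows "norm z \<le> 1 \<Longrightarrow> norm (circle_Cauchy N v z) \<le> 2 * B"
    "norm z \<le> 1 \<Longrightarrow> norm (circle_Cauchy' N v z) \<le> 2 * B"
    "norm z \<le> 1 / N \<Longrightarrow> norm (circle_Cauchy N v z) \<le> \<kappa> * B"
proof -
  have B0: "0 \<le> B" using order_trans[OF norm_ge_zero B[of 0]] .
  { assume z: "norm z \<le> 1"
    show "norm (circle_Cauchy N v z) \<le> 2 * B"
      using norm_circle_Cauchy_le(1)[OF c norm_le_1_less_N[OF z] B]
        mult_left_mono[OF kernel_bounds(1)[OF z] B0] by linarith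
    show "norm (circle_Cauchy' N v z) \<le> 2 * B"
      using norm_circle_Cauchy_le(2)[OF c norm_le_1_less_N[OF z] B]
        mult_left_mono[OF kernel_bounds(2)[OF z] B0] by linarith }
  assume z: "norm z \<le> 1 / N"
  show "norm (circle_Cauchy N v z) \<le> \<kappa> * B"
    using norm_circle_Cauchy_le(1)[OF c norm_le_invN_less_N[OF z] B]
      mult_left_mono[OF kernel_bound_kappa[OF z] B0] by (simp add: mult.commute)
qed

lemma h_le:
  assumes u: "adm u"
  shows "norm z \<le> 1 \<Longrightarrow> norm (h u j z) \<le> 2 * M"
    "norm z \<le> 1 \<Longrightarrow> norm (d u j z) \<le> 2 * M"
    "norm z \<le> 1 / N \<Longrightarrow> norm (h u j z) \<le> \<kappa> * M"
  using h_bounds[OF continuous_01[OF u], of j M z] u by (auto simp: h_def d_def adm_def)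

lemma h_diff_le:
  assumes u: "adm u" and v: "adm v" and D: "\<And>j x. norm (u j x - v j x) \<le> D"
  shows "norm z \<le> 1 \<Longrightarrow> norm (h u j z - h v j z) \<le> 2 * D"
    "norm z \<le> 1 \<Longrightarrow> norm (d u j z - d v j z) \<le> 2 * D"
    "norm z \<le> 1 / N \<Longrightarrow> norm (h u j z - h v j z) \<le> \<kappa> * D"
  using h_bounds[of "\<lambda>x. u j x - v j x" D z] D continuous_01[OF u, of j] continuous_01[OF v, of j]
    circle_Cauchy_diff[OF continuous_01[OF u, of j] continuous_01[OF v, of j], of z N]
    norm_le_1_less_N[of z] norm_le_invN_less_N[of z]
  by (auto simp: h_def d_def intro!: continuous_intros)

lemma h_holomorphic: "adm u \<Longrightarrow> h u j holomorphic_on ball 0 N"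
  unfolding h_def by (rule circle_Cauchy_holomorphic[OF continuous_01])

lemma h_continuous: "adm u \<Longrightarrow> continuous_on (ball 0 N) (h u j)"
  by (rule holomorphic_on_imp_continuous_on[OF h_holomorphic])

lemma d_continuous: "adm u \<Longrightarrow> continuous_on (ball 0 N) (d u j)"
  unfolding d_def by (rule circle_Cauchy'_continuous[OF continuous_01])

lemma P_continuous: "adm u \<Longrightarrow> continuous_on S (P u l)"
  unfolding P_def using N
  by (intro continuous_intros continuous_on_compose2[OF h_continuous] continuous_on_compose2[OF d_continuous]) auto

lemma W_continuous: "adm u \<Longrightarrow> continuous_on S (W u l)"
  unfolding W_def using N by (intro continuous_intros continuous_on_compose2[OF h_continuous]) auto

lemma norm_unit_exp_div: "norm (unit_exp x / of_real N) = 1 / N"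
  using N by (simp add: norm_divide)

lemma Y_continuous: "adm u \<Longrightarrow> continuous_on S (Y u l)"
  unfolding Y_def using N norm_unit_exp_div norm_le_invN_less_N[of "unit_exp _ / of_real N"]
  by (intro continuous_intros continuous_on_compose2[OF h_continuous]) auto

lemma P_le: "adm u \<Longrightarrow> norm (P u l x) \<le> (1 + 2 * M)\<^sup>2"
proof -
  assume u: "adm u"
  have "norm (cnj (unit_exp x) + h u l (unit_exp x)) \<le> 1 + 2 * M"
    using norm_triangle_ineq[of "cnj (unit_exp x)" "h u l (unit_exp x)"] h_le(1)[OF u, of "unit_exp x" l] by simp
  moreover have "norm (1 - cnj (d u l (unit_exp x)) * (cnj (unit_exp x))\<^sup>2) \<le> 1 + 2 * M"
    using norm_triangle_ineq4[of 1 "cnj (d u l (unit_exp x)) * (cnj (unit_exp x))\<^sup>2"] h_le(2)[OF u, of "unit_exp x" l]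
    by (simp add: norm_mult norm_power)
  ultimately show ?thesis
    unfolding P_def norm_mult power2_eq_square using M by (auto intro!: mult_mono)
qed

lemma P_diff_le:
  assumes u: "adm u" and v: "adm v" and D: "\<And>j x. norm (u j x - v j x) \<le> D"
  shows "norm (P u l x - P v l x) \<le> 4 * (1 + 2 * M) * D"
proof -
  let ?e = "unit_exp x"
  define X1 X2 where "X1 u = cnj ?e + h u l ?e" and "X2 u = 1 - cnj (d u l ?e) * (cnj ?e)\<^sup>2" for u
  have b1: "norm (X1 v) \<le> 1 + 2 * M"
    using norm_triangle_ineq[of "cnj ?e" "h v l ?e"] h_le(1)[OF v, of ?e l] by (simp add: X1_def)
  have b2: "norm (X2 u) \<le> 1 + 2 * M"
    using norm_triangle_ineq4[of 1 "cnj (d u l ?e) * (cnj ?e)\<^sup>2"] h_le(2)[OF u, of ?e l]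
    by (simp add: X2_def norm_mult norm_power)
  have d1: "norm (X1 u - X1 v) \<le> 2 * D"
    using h_diff_le(1)[OF u v D, of ?e l] by (simp add: X1_def)
  have "X2 u - X2 v = - (cnj (d u l ?e - d v l ?e) * (cnj ?e)\<^sup>2)" by (simp add: X2_def algebra_simps)
  then have d2: "norm (X2 u - X2 v) \<le> 2 * D"
    using h_diff_le(2)[OF u v D, of ?e l] by (simp only: norm_minus_cancel norm_mult complex_mod_cnj norm_power) simp
  have "P u l x - P v l x = ((X1 u - X1 v) * X2 u + X1 v * (X2 u - X2 v)) * ?e"
    by (simp add: P_def X1_def X2_def algebra_simps)
  then have "norm (P u l x - P v l x) = norm ((X1 u - X1 v) * X2 u + X1 v * (X2 u - X2 v))"
    by (simp add: norm_mult)
  also have "\<dots> \<le> norm (X1 u - X1 v) * norm (X2 u) + norm (X1 v) * norm (X2 u - X2 v)"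
    by (metis norm_triangle_ineq norm_mult)
  also have "\<dots> \<le> (2 * D) * (1 + 2 * M) + (1 + 2 * M) * (2 * D)"
    using b1 b2 d1 d2 M order_trans[OF norm_ge_zero d1] by (intro add_mono mult_mono) auto
  finally show ?thesis by (simp add: algebra_simps)
qed

lemma W_in: "adm u \<Longrightarrow> norm (W u l x - a l) < \<delta>"
proof -
  assume u: "adm u"
  have "norm (W u l x - a l) = t * norm (unit_exp x + cnj (h u l (unit_exp x)))" using t by (simp add: W_def norm_mult)
  also have "\<dots> \<le> t * (N + 2 * M)"
  proof (rule mult_left_mono)
    show "norm (unit_exp x + cnj (h u l (unit_exp x))) \<le> N + 2 * M"
      using norm_triangle_ineq[of "unit_exp x" "cnj (h u l (unit_exp x))"] h_le(1)[OF u, of "unit_exp x" l] N by simp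
  qed (use t in simp)
  also have "\<dots> < \<delta>" by (rule t_small)
  finally show ?thesis .
qed

lemma Y_le: "adm u \<Longrightarrow> norm (Y u l x - a l) \<le> t * (N + \<kappa> * M)"
proof -
  assume u: "adm u"
  have "norm (Y u l x - a l) = t * norm (of_real N * unit_exp x + cnj (h u l (unit_exp x / of_real N)))" using t by (simp add: Y_def norm_mult)
  also have "\<dots> \<le> t * (N + \<kappa> * M)"
  proof (rule mult_left_mono)
    show "norm (of_real N * unit_exp x + cnj (h u l (unit_exp x / of_real N))) \<le> N + \<kappa> * M"
      using norm_triangle_ineq[of "of_real N * unit_exp x" "cnj (h u l (unit_exp x / of_real N))"]
        h_le(3)[OF u, of "unit_exp x / of_real N" l] N norm_unit_exp_div[of x] by (simp add: norm_mult)
  qed (use t in simp)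
  finally show ?thesis .
qed

lemma Y_in: "adm u \<Longrightarrow> Y u l x \<in> ball (a l) \<delta>"
proof -
  assume u: "adm u"
  have "t * (N + \<kappa> * M) \<le> t * (N + 2 * M)" using kappa M t by (intro mult_left_mono add_left_mono mult_right_mono) auto
  then show ?thesis using Y_le[OF u, of l x] t_small by (simp add: dist_norm norm_minus_commute)
qed

lemma Y_diff_le:
  assumes u: "adm u" and v: "adm v" and D: "\<And>j x. norm (u j x - v j x) \<le> D"
  shows "norm (Y u j x - Y v j x) \<le> t * (\<kappa> * D)"
proof -
  have "Y u j x - Y v j x = of_real t * cnj (h u j (unit_exp x / of_real N) - h v j (unit_exp x / of_real N))"
    by (simp add: Y_def algebra_simps)
  then have "norm (Y u j x - Y v j x) = t * norm (h u j (unit_exp x / of_real N) - h v j (unit_exp x / of_real N))"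
    using t by (simp only: norm_mult complex_mod_cnj norm_of_real abs_of_pos)
  also have "\<dots> \<le> t * (\<kappa> * D)"
    using h_diff_le(3)[OF u v D, of "unit_exp x / of_real N" j] norm_unit_exp_div[of x] t by (intro mult_left_mono) auto
  finally show ?thesis .
qed

lemma W_diff_le:
  assumes u: "adm u" and v: "adm v" and D: "\<And>j x. norm (u j x - v j x) \<le> D"
  shows "norm (W u j x - W v j x) \<le> t * (2 * D)"
proof -
  have "W u j x - W v j x = of_real t * cnj (h u j (unit_exp x) - h v j (unit_exp x))"
    by (simp add: W_def algebra_simps)
  then have "norm (W u j x - W v j x) = t * norm (h u j (unit_exp x) - h v j (unit_exp x))"
    using t by (simp only: norm_mult complex_mod_cnj norm_of_real abs_of_pos)
  also have "\<dots> \<le> t * (2 * D)"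
    using h_diff_le(1)[OF u v D, of "unit_exp x" j] t by (intro mult_left_mono) auto
  finally show ?thesis .
qed

lemma W_far:
  assumes u: "adm u" and jl: "j < n" "l < n" "j \<noteq> l" and z: "z \<in> ball (a j) \<delta>"
  shows "2 * \<delta> \<le> norm (z - W u l x)"
proof -
  have "a j - a l = (z - W u l x) - (z - a j) + (W u l x - a l)" by simp
  then have "norm (a j - a l) \<le> norm (z - W u l x) + norm (z - a j) + norm (W u l x - a l)"
    by (smt (verit) norm_triangle_ineq norm_triangle_ineq4)
  then show ?thesis using sep[OF jl] W_in[OF u, of l x] z by (simp add: dist_norm norm_minus_commute)
qed

lemma CC_integrand_continuous:
  assumes u: "adm u" and jl: "j < n" "l < n" "j \<noteq> l" and z: "z \<in> ball (a j) \<delta>"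
  shows "continuous_on {0..1} (\<lambda>x. P u l x / (z - W u l x))"
proof (intro continuous_intros P_continuous[OF u] W_continuous[OF u] ballI)
  fix x :: real
  show "z - W u l x \<noteq> 0" using W_far[OF assms, of x] \<delta> by auto
qed

lemma CC_le:
  assumes u: "adm u" and jl: "j < n" "l < n" "j \<noteq> l" and z: "z \<in> ball (a j) \<delta>"
  shows "norm (CC u l z) \<le> (1 + 2 * M)\<^sup>2 / (2 * \<delta>)"
  unfolding CC_def
proof (rule norm_integral_unit_interval_le[OF CC_integrand_continuous[OF assms]])
  fix x :: real
  show "norm (P u l x / (z - W u l x)) \<le> (1 + 2 * M)\<^sup>2 / (2 * \<delta>)"
    unfolding norm_divide using P_le[OF u, of l x] W_far[OF assms, of x] \<delta> by (intro frac_le) auto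
qed

lemma CC_diff_le:
  assumes u: "adm u" and v: "adm v" and D: "\<And>j x. norm (u j x - v j x) \<le> D"
    and jl: "j < n" "l < n" "j \<noteq> l" and z: "z \<in> ball (a j) \<delta>" "z' \<in> ball (a j) \<delta>" "norm (z - z') \<le> 2 * D"
  shows "norm (CC u l z - CC v l z') \<le> (4 * (1 + 2 * M) / (2 * \<delta>) + (1 + 2 * M)\<^sup>2 * 4 / (2 * \<delta>)\<^sup>2) * D"
proof -
  note c1 = CC_integrand_continuous[OF u jl z(1)] and c2 = CC_integrand_continuous[OF v jl z(2)]
  have D0: "0 \<le> D" using order_trans[OF norm_ge_zero D] .
  have "CC u l z - CC v l z' = integral {0..1} (\<lambda>x. P u l x / (z - W u l x) - P v l x / (z' - W v l x))"
    unfolding CC_def using c1 c2 by (intro Henstock_Kurzweil_Integration.integral_diff[symmetric] integrable_continuous_real)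
  also have "norm \<dots> \<le> (4 * (1 + 2 * M) / (2 * \<delta>) + (1 + 2 * M)\<^sup>2 * 4 / (2 * \<delta>)\<^sup>2) * D"
  proof (rule norm_integral_unit_interval_le[OF continuous_on_diff[OF c1 c2]])
    fix x :: real
    define p p' s s' where "p = P u l x" "p' = P v l x" "s = z - W u l x" "s' = z' - W v l x"
    have s: "2 * \<delta> \<le> norm s" "2 * \<delta> \<le> norm s'"
      using W_far[OF u jl z(1)] W_far[OF v jl z(2)] by (auto simp: p_p'_s_s'_def)
    then have s0: "s \<noteq> 0" "s' \<noteq> 0" using \<delta> by auto
    \<comment> \<open>One half is the displacement of the boundary point \<open>W\<close>, the other
      that of the evaluation point.\<close>
    have ds: "norm (s' - s) \<le> 4 * D"
    proof -
      have "s' - s = (W u l x - W v l x) - (z - z')" by (simp add: p_p'_s_s'_def)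
      then have "norm (s' - s) \<le> norm (W u l x - W v l x) + norm (z - z')" by (metis norm_triangle_ineq4)
      also have "\<dots> \<le> t * (2 * D) + 2 * D" using W_diff_le[OF u v D] z(3) by (intro add_mono) auto
      also have "\<dots> \<le> 1 * (2 * D) + 2 * D" using t D0 by (intro add_right_mono mult_right_mono) auto
      finally show ?thesis by simp
    qed
    have "p / s - p' / s' = (p - p') / s + p' * (s' - s) / (s * s')"
      using s0 by (simp add: field_simps)
    then have "norm (p / s - p' / s') \<le> norm (p - p') / norm s + norm p' * norm (s' - s) / (norm s * norm s')"
      by (metis norm_triangle_ineq norm_mult norm_divide)
    also have "\<dots> \<le> (4 * (1 + 2 * M) * D) / (2 * \<delta>) + ((1 + 2 * M)\<^sup>2 * (4 * D)) / ((2 * \<delta>) * (2 * \<delta>))"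
      using P_diff_le[OF u v D, of l x] P_le[OF v, of l x] s ds \<delta> D0 M
      by (intro add_mono frac_le mult_mono mult_pos_pos) (auto simp: p_p'_s_s'_def)
    also have "\<dots> = (4 * (1 + 2 * M) / (2 * \<delta>) + (1 + 2 * M)\<^sup>2 * 4 / (2 * \<delta>)\<^sup>2) * D"
      by (simp add: power2_eq_square algebra_simps)
    finally show "norm (P u l x / (z - W u l x) - P v l x / (z' - W v l x)) \<le>
       (4 * (1 + 2 * M) / (2 * \<delta>) + (1 + 2 * M)\<^sup>2 * 4 / (2 * \<delta>)\<^sup>2) * D"
      by (simp add: p_p'_s_s'_def)
  qed
  finally show ?thesis .
qed

lemma sum_others_le:
  fixes B :: real
  assumes "\<And>l. l < n \<Longrightarrow> l \<noteq> j \<Longrightarrow> norm (f l :: complex) \<le> B" "0 \<le> B"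
  shows "norm (\<Sum>l\<in>{..<n} - {j}. f l) \<le> n * B"
proof -
  have "norm (\<Sum>l\<in>{..<n} - {j}. f l) \<le> (\<Sum>l\<in>{..<n} - {j}. B)"
    using assms by (intro sum_norm_le) auto
  also have "\<dots> \<le> (\<Sum>l\<in>{..<n}. B)" using assms by (intro sum_mono2) auto
  finally show ?thesis by simp
qed

lemma CC_sum_le:
  assumes u: "adm u" and j: "j < n" and z: "z \<in> ball (a j) \<delta>"
  shows "norm (of_real t * (\<Sum>l\<in>{..<n} - {j}. CC u l z)) \<le> t * (n * ((1 + 2 * M)\<^sup>2 / (2 * \<delta>)))"
proof -
  have "norm (\<Sum>l\<in>{..<n} - {j}. CC u l z) \<le> n * ((1 + 2 * M)\<^sup>2 / (2 * \<delta>))"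
    using CC_le[OF u j _ _ z] \<delta> by (intro sum_others_le) auto
  then have "t * norm (\<Sum>l\<in>{..<n} - {j}. CC u l z) \<le> t * (n * ((1 + 2 * M)\<^sup>2 / (2 * \<delta>)))"
    using t by (intro mult_left_mono) auto
  then show ?thesis using t by (simp only: norm_mult norm_of_real abs_of_pos)
qed

lemma r_part_le:
  assumes j: "j < n" and z: "x \<in> ball (a j) \<delta>" "y \<in> ball (a j) \<delta>"
  shows "norm (r x - r y) \<le> (A + \<eta>) * norm (x - y)"
proof -
  have "r x - r y = ((r x - \<alpha> j * x) - (r y - \<alpha> j * y)) + \<alpha> j * (x - y)" by (simp add: algebra_simps)
  then have "norm (r x - r y) \<le> norm ((r x - \<alpha> j * x) - (r y - \<alpha> j * y)) + norm (\<alpha> j * (x - y))"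
    by (metis norm_triangle_ineq)
  also have "\<dots> \<le> \<eta> * norm (x - y) + A * norm (x - y)"
    unfolding norm_mult using r_lip[OF j z] \<alpha>[OF j] by (intro add_mono mult_right_mono) auto
  finally show ?thesis by (simp add: algebra_simps)
qed

lemma CC_holomorphic:
  assumes u: "adm u" and jl: "j < n" "l < n" "j \<noteq> l"
  shows "CC u l holomorphic_on ball (a j) \<delta>"
  unfolding holomorphic_on_open[OF open_ball]
proof (intro ballI exI)
  fix z assume z: "z \<in> ball (a j) \<delta>"
  have ne: "z - W u l x \<noteq> 0" if "z \<in> ball (a j) \<delta>" for z x
    using W_far[OF assms that, of x] \<delta> by auto
  have "((\<lambda>z. integral (cbox 0 1) (\<lambda>x. P u l x / (z - W u l x))) has_field_derivative
      integral (cbox 0 1) (\<lambda>x. - P u l x / (z - W u l x)\<^sup>2)) (at z within ball (a j) \<delta>)"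
  proof (rule leibniz_rule_field_derivative)
    fix z x assume "z \<in> ball (a j) \<delta>"
    then show "((\<lambda>z. P u l x / (z - W u l x)) has_field_derivative - P u l x / (z - W u l x)\<^sup>2) (at z within ball (a j) \<delta>)"
      using ne by (auto intro!: derivative_eq_intros simp: power2_eq_square)
  next
    fix z assume "z \<in> ball (a j) \<delta>"
    then show "(\<lambda>x. P u l x / (z - W u l x)) integrable_on cbox 0 1"
      using integrable_continuous_real[OF CC_integrand_continuous[OF assms]] by simp
  next
    have "continuous_on (ball (a j) \<delta> \<times> cbox 0 1) (\<lambda>p. P u l (snd p))" "continuous_on (ball (a j) \<delta> \<times> cbox 0 1) (\<lambda>p. W u l (snd p))"
      by (rule continuous_on_compose2[OF P_continuous[OF u, of UNIV]] continuous_on_compose2[OF W_continuous[OF u, of UNIV]];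
          auto intro!: continuous_intros)+
    then show "continuous_on (ball (a j) \<delta> \<times> cbox 0 1) (\<lambda>(z, x). - P u l x / (z - W u l x)\<^sup>2)"
      unfolding case_prod_beta using ne by (intro continuous_intros) auto
  qed (use z in auto)
  then show "(CC u l has_field_derivative integral (cbox 0 1) (\<lambda>x. - P u l x / (z - W u l x)\<^sup>2)) (at z)"
    using z at_within_open[of z "ball (a j) \<delta>"] by (simp add: CC_def[abs_def])
qed

text \<open>In the summand with \<open>r\<close> the division by \<open>t\<close> cancels the factor
  \<open>t\<close> in \<open>Y\<close>, so its Lipschitz constant is
  \<open>(A + \<eta>) * \<kappa>\<close>. The other cells act with an extra factor \<open>t\<close>.
  The hypotheses \<open>self_map\<close> and \<open>contraction\<close> add up these two
  effects.\<close>

lemma T_fixpoint: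
  obtains u where "adm u" "\<And>j x. T u j x = u j x"
proof -
  have q0: "0 \<le> q"
  proof -
    have "0 \<le> (A + \<eta>) * \<kappa> + t * (n * (4 * (1 + 2 * M) / (2 * \<delta>) + (1 + 2 * M)\<^sup>2 * 4 / (2 * \<delta>)\<^sup>2))"
    proof (rule add_nonneg_nonneg)
      show "0 \<le> (A + \<eta>) * \<kappa>" using A \<eta> by (intro mult_nonneg_nonneg[OF _ kappa(1)]) auto
    qed (use t M \<delta> in auto)
    then show ?thesis using contraction by linarith
  qed
  show ?thesis
  proof (rule family_contraction_fixpoint[OF M q0 contraction(2), of T])
    fix u :: "nat \<Rightarrow> real \<Rightarrow> complex" and j assume "\<And>j. continuous_on UNIV (u j)" "\<And>j x. norm (u j x) \<le> M"
    then have u: "adm u" by (simp add: adm_def)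
    show "continuous_on UNIV (T u j)"
    proof (cases "j < n")
      case True
      have "continuous_on UNIV (\<lambda>x. r (Y u j x))"
        using Y_in[OF u] by (intro continuous_on_compose2[OF holomorphic_on_imp_continuous_on[OF r_hol[OF True]] Y_continuous[OF u]]) auto
      moreover have "continuous_on UNIV (\<lambda>x. CC u l (Y u j x))" if "l \<in> {..<n} - {j}" for l
        using Y_in[OF u] that True
        by (intro continuous_on_compose2[OF holomorphic_on_imp_continuous_on[OF CC_holomorphic[OF u True]] Y_continuous[OF u]]) auto
      ultimately show ?thesis
        unfolding T_def using True t by (simp only: if_True) (intro continuous_intros, auto)
    qed (simp add: T_def)
  next
    fix u :: "nat \<Rightarrow> real \<Rightarrow> complex" and j x assume "\<And>j. continuous_on UNIV (u j)" "\<And>j x. norm (u j x) \<le> M"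
    then have u: "adm u" by (simp add: adm_def)
    show "norm (T u j x) \<le> M"
    proof (cases "j < n")
      case True
      have aj: "a j \<in> ball (a j) \<delta>" using \<delta> by simp
      have "norm (r (Y u j x) - cnj (a j)) \<le> (A + \<eta>) * norm (Y u j x - a j)"
        using r_part_le[OF True Y_in[OF u] aj] r_fix[OF True] by simp
      also have "\<dots> \<le> (A + \<eta>) * (t * (N + \<kappa> * M))"
        using Y_le[OF u] A \<eta> by (intro mult_left_mono) auto
      finally have "norm ((r (Y u j x) - cnj (a j)) / of_real t) \<le> (A + \<eta>) * (N + \<kappa> * M)"
        using t by (simp add: norm_divide divide_le_eq mult_ac)
      then show ?thesis
        using norm_triangle_ineq[of "(r (Y u j x) - cnj (a j)) / of_real t" "of_real t * (\<Sum>l\<in>{..<n} - {j}. CC u l (Y u j x))"]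
          CC_sum_le[OF u True Y_in[OF u], of x] self_map True by (simp add: T_def)
    qed (use M in \<open>simp add: T_def\<close>)
  next
    fix u v :: "nat \<Rightarrow> real \<Rightarrow> complex" and D j x
    assume "\<And>j. continuous_on UNIV (u j)" "\<And>j x. norm (u j x) \<le> M"
      "\<And>j. continuous_on UNIV (v j)" "\<And>j x. norm (v j x) \<le> M"
      and D: "\<And>j x. norm (u j x - v j x) \<le> D"
    then have u: "adm u" and v: "adm v" by (simp_all add: adm_def)
    have D0: "0 \<le> D" using order_trans[OF norm_ge_zero D] .
    show "norm (T u j x - T v j x) \<le> q * D"
    proof (cases "j < n")
      case True
      let ?CL = "4 * (1 + 2 * M) / (2 * \<delta>) + (1 + 2 * M)\<^sup>2 * 4 / (2 * \<delta>)\<^sup>2"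
      have CL0: "0 \<le> ?CL" using M \<delta> by auto
      have dY: "norm (Y u j x - Y v j x) \<le> t * (\<kappa> * D)" by (rule Y_diff_le[OF u v D])
      have "t * (\<kappa> * D) \<le> 1 * (2 * D)"
        by (rule mult_mono[OF t(2) mult_right_mono[OF kappa(2) D0] zero_le_one mult_nonneg_nonneg[OF kappa(1) D0]])
      then have dY2: "norm (Y u j x - Y v j x) \<le> 2 * D" using dY by simp
      have "norm (r (Y u j x) - r (Y v j x)) \<le> (A + \<eta>) * (t * (\<kappa> * D))"
        using r_part_le[OF True Y_in[OF u, of j x] Y_in[OF v, of j x]] mult_left_mono[OF dY, of "A + \<eta>"] A \<eta> by linarith
      then have 1: "norm ((r (Y u j x) - r (Y v j x)) / of_real t) \<le> (A + \<eta>) * (\<kappa> * D)"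
        using t by (simp add: norm_divide divide_le_eq mult_ac)
      have "norm (\<Sum>l\<in>{..<n} - {j}. CC u l (Y u j x) - CC v l (Y v j x)) \<le> n * (?CL * D)"
        using CC_diff_le[OF u v D True _ _ Y_in[OF u] Y_in[OF v] dY2] CL0 D0 by (intro sum_others_le) auto
      then have 2: "norm (of_real t * (\<Sum>l\<in>{..<n} - {j}. CC u l (Y u j x) - CC v l (Y v j x))) \<le> t * (n * (?CL * D))"
        unfolding norm_mult using t by (auto intro!: mult_left_mono)
      have "T u j x - T v j x = (r (Y u j x) - r (Y v j x)) / of_real t +
         of_real t * (\<Sum>l\<in>{..<n} - {j}. CC u l (Y u j x) - CC v l (Y v j x))"
        using True by (simp add: T_def sum_subtractf diff_divide_distrib right_diff_distrib)
      then have "norm (T u j x - T v j x) \<le> (A + \<eta>) * (\<kappa> * D) + t * (n * (?CL * D))"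
        using norm_triangle_ineq[of "(r (Y u j x) - r (Y v j x)) / of_real t"
           "of_real t * (\<Sum>l\<in>{..<n} - {j}. CC u l (Y u j x) - CC v l (Y v j x))"] 1 2 by simp
      also have "\<dots> = ((A + \<eta>) * \<kappa> + t * (n * ?CL)) * D" by (simp only: distrib_right mult.assoc)
      also have "\<dots> \<le> q * D" using contraction(1) D0 by (rule mult_right_mono)
      finally show ?thesis .
    qed (use q0 D0 in \<open>simp add: T_def\<close>)
  next
    fix u :: "nat \<Rightarrow> real \<Rightarrow> complex"
    assume "\<And>j. continuous_on UNIV (u j)" "\<And>j x. norm (u j x) \<le> M" "\<And>j x. T u j x = u j x"
    then show thesis using that[of u] by (simp add: adm_def)
  qed
qed

end

section \<open>Integrals near infinity and reflection in the unit circle\<close>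

lemma contour_integral_circlepath_exterior_eq_0:
  assumes g: "g holomorphic_on {s. \<rho> < norm s}" and \<rho>: "0 \<le> \<rho>" "\<rho> < N"
    and decay: "\<And>s. R0 \<le> norm s \<Longrightarrow> norm (g s) \<le> C / (norm s)\<^sup>2"
  shows "contour_integral (circlepath 0 N) g = 0"
proof -
  have le: "norm (contour_integral (circlepath 0 N) g) \<le> 2 * pi * \<bar>C\<bar> / R" if R: "R \<ge> max R0 N" for R
  proof -
    have Rp: "R > 0" "R \<ge> R0" "R \<ge> N" using R \<rho> by auto
    have eq: "contour_integral (circlepath 0 N) g = contour_integral (circlepath 0 R) g"
      using \<rho> Rp by (intro contour_integral_circlepath_annulus[OF open_norm_gt g]) auto
    have "g contour_integrable_on (circlepath 0 R)"
      using Rp \<rho> by (intro contour_integrable_continuous_circlepath continuous_on_subset[OF holomorphic_on_imp_continuous_on[OF g]]) auto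
    then have "(g has_contour_integral contour_integral (circlepath 0 N) g) (circlepath 0 R)"
      unfolding eq by (rule has_contour_integral_integral)
    then have "norm (contour_integral (circlepath 0 N) g) \<le> (\<bar>C\<bar> / R\<^sup>2) * (2 * pi * R)"
    proof (rule has_contour_integral_bound_circlepath)
      fix z :: complex assume "norm (z - 0) = R"
      then have "norm (g z) \<le> C / R\<^sup>2" using decay[of z] Rp by simp
      also have "\<dots> \<le> \<bar>C\<bar> / R\<^sup>2" by (intro divide_right_mono) auto
      finally show "norm (g z) \<le> \<bar>C\<bar> / R\<^sup>2" .
    qed (use Rp in auto)
    then show ?thesis using Rp by (simp add: power2_eq_square field_simps)
  qed
  have "((\<lambda>R. 2 * pi * \<bar>C\<bar> / R) \<longlongrightarrow> 0) at_top" (is "(?f \<longlongrightarrow> 0) at_top")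
    by (intro tendsto_divide_0[OF tendsto_const] filterlim_at_top_imp_at_infinity filterlim_ident)
  then have "norm (contour_integral (circlepath 0 N) g) \<le> 0"
    using le by (intro tendsto_lowerbound[of ?f 0 at_top]) (auto simp: eventually_at_top_linorder intro!: exI[of _ "max R0 N"])
  then show ?thesis by simp
qed

text \<open>This folds the plane onto the closed unit disc without increasing distances. Composing
  \<open>h\<close> with it therefore extends \<open>s \<mapsto> h (1 / cnj s)\<close> from the
  exterior to the whole plane with the Lipschitz constant that \<open>h\<close> has on the
  disc.\<close>

definition disc_reflect :: "complex \<Rightarrow> complex" where
  "disc_reflect s = (if norm s \<le> 1 then s else 1 / cnj s)"

lemma norm_disc_reflect_le: "norm (disc_reflect s) \<le> 1"
  by (auto simp: disc_reflect_def norm_divide divide_le_eq)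

text \<open>The identity \<open>|x cnj y - 1|\<^sup>2 = |x - y|\<^sup>2 + (1 - |x|\<^sup>2) (1 -
  |y|\<^sup>2)\<close> of hyperbolic geometry; its last term is nonpositive for points on different
  sides of the circle.\<close>

lemma disc_reflect_mixed:
  assumes "norm x \<le> 1" "1 < norm y"
  shows "norm (x - 1 / cnj y) \<le> norm (x - y)"
proof -
  have y0: "y \<noteq> 0" using assms by auto
  have id: "(norm (x * cnj y - 1))\<^sup>2 = (norm (x - y))\<^sup>2 + (1 - (norm x)\<^sup>2) * (1 - (norm y)\<^sup>2)"
    unfolding cmod_power2 by (simp add: algebra_simps power2_eq_square)
  have "(1 - (norm x)\<^sup>2) * (1 - (norm y)\<^sup>2) \<le> 0"
    using assms by (intro mult_nonneg_nonpos) (auto simp: power_le_one one_le_power)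
  then have "(norm (x * cnj y - 1))\<^sup>2 \<le> (norm (x - y))\<^sup>2" using id by simp
  then have le: "norm (x * cnj y - 1) \<le> norm (x - y)" by (simp add: power2_le_iff_abs_le)
  have "x - 1 / cnj y = (x * cnj y - 1) / cnj y" using y0 by (simp add: field_simps)
  then have "norm (x - 1 / cnj y) = norm (x * cnj y - 1) / norm y" by (simp add: norm_divide)
  also have "\<dots> \<le> norm (x - y) / 1" using le assms by (intro frac_le) auto
  finally show ?thesis by simp
qed

lemma disc_reflect_lipschitz: "norm (disc_reflect x - disc_reflect y) \<le> norm (x - y)"
proof -
  consider "norm x \<le> 1" "norm y \<le> 1" | "norm x \<le> 1" "1 < norm y" | "1 < norm x" "norm y \<le> 1" | "1 < norm x" "1 < norm y"
    by linarith
  then show ?thesis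
  proof cases
    case 3
    then show ?thesis using disc_reflect_mixed[of y x] by (simp add: disc_reflect_def norm_minus_commute)
  next
    case 4
    then have ne: "x \<noteq> 0" "y \<noteq> 0" by auto
    have "1 / cnj x - 1 / cnj y = cnj (y - x) / (cnj x * cnj y)" using ne by (simp add: field_simps)
    then have "norm (1 / cnj x - 1 / cnj y) = norm (x - y) / (norm x * norm y)"
      by (simp only: norm_divide norm_mult complex_mod_cnj norm_minus_commute)
    also have "\<dots> \<le> norm (x - y) / 1"
      using 4 mult_mono[of 1 "norm x" 1 "norm y"] by (intro frac_le) auto
    finally show ?thesis using 4 by (simp add: disc_reflect_def)
  qed (use disc_reflect_mixed in \<open>auto simp: disc_reflect_def\<close>)
qed

section \<open>The Schwarz function of the solution\<close>

locale schwarz_solution = attracting_data +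
  fixes u :: "nat \<Rightarrow> real \<Rightarrow> complex"
  assumes adm_u: "adm u" and T_u: "\<And>j x. T u j x = u j x" and n_pos: "0 < n"
begin

text \<open>Conjugated twice, \<open>k j\<close> is holomorphic in \<open>s\<close>, as far as
  \<open>1 / cnj s\<close> stays in the disc of radius \<open>N\<close>.\<close>

definition "k j s = cnj (h u j (1 / cnj s))"
definition "E j s = cnj (h u j (disc_reflect s))"

lemma E_eq_k: "1 \<le> norm s \<Longrightarrow> E j s = k j s"
proof -
  assume s: "1 \<le> norm s"
  show "E j s = k j s"
  proof (cases "norm s = 1")
    case True
    then show ?thesis using inverse_cnj_unit[OF True] by (simp add: E_def k_def disc_reflect_def)
  next
    case False
    then show ?thesis using s by (simp add: E_def k_def disc_reflect_def)
  qed
qed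

lemma norm_inverse_cnj: "1 / N < norm s \<Longrightarrow> norm (1 / cnj s) < N"
proof -
  assume s: "1 / N < norm s"
  then have "0 < norm s" using N by (smt (verit) divide_nonneg_nonneg)
  then show ?thesis using s N by (simp add: norm_divide field_simps)
qed

lemma k_has_derivative:
  assumes "1 / N < norm s"
  shows "(k j has_field_derivative - (cnj (d u j (1 / cnj s)) / s\<^sup>2)) (at s)"
proof -
  have s0: "s \<noteq> 0" using assms N by auto
  have 1: "(h u j has_field_derivative d u j (1 / cnj s)) (at (cnj (1 / s)))"
    using circle_Cauchy_has_derivative[OF continuous_01[OF adm_u] norm_inverse_cnj[OF assms], of j]
    by (simp add: h_def d_def)
  have 2: "((\<lambda>s. 1 / s) has_field_derivative - (1 / s\<^sup>2)) (at s)"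
    using s0 by (auto intro!: derivative_eq_intros simp: power2_eq_square)
  have "(((cnj \<circ> h u j \<circ> cnj) \<circ> (\<lambda>s. 1 / s)) has_field_derivative cnj (d u j (1 / cnj s)) * - (1 / s\<^sup>2)) (at s)"
    by (rule DERIV_chain[OF has_field_derivative_cnj_cnj[OF 1] 2])
  moreover have "(cnj \<circ> h u j \<circ> cnj) \<circ> (\<lambda>s. 1 / s) = k j"
    by (auto simp: k_def fun_eq_iff)
  ultimately show ?thesis by simp
qed

lemma k_holomorphic: "k j holomorphic_on {s. 1 / N < norm s}"
  unfolding holomorphic_on_open[OF open_norm_gt] using k_has_derivative by blast

lemma k_le: "1 \<le> norm s \<Longrightarrow> norm (k j s) \<le> 2 * M"
proof -
  assume "1 \<le> norm s"
  then have "norm (1 / cnj s) \<le> 1" by (simp add: norm_divide divide_le_eq)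
  then show ?thesis using h_le(1)[OF adm_u, of "1 / cnj s" j] by (simp add: k_def)
qed

lemma Y_eq: "Y u j x = cell_map (a j) t (k j) (of_real N * unit_exp x)"
  using N by (simp add: Y_def cell_map_def k_def cnj_unit_exp)

text \<open>The function \<open>k j\<close> is bounded and holomorphic near infinity, so its
  integral against \<open>1 / (s - z)\<^sup>2\<close> vanishes. Only the summand \<open>s\<close> is
  seen, and its derivative is 1.\<close>

lemma circle_Cauchy'_identity:
  assumes z: "norm z \<le> 1"
  shows "circle_Cauchy' N (\<lambda>x. of_real N * unit_exp x + k j (of_real N * unit_exp x)) z = 1"
proof -
  have zN: "z \<in> ball 0 N" using z N by simp
  have 1: "(\<lambda>s. s / (s - z)\<^sup>2) contour_integrable_on circlepath 0 N"
    "((\<lambda>s. s) has_field_derivative (1 / (2 * of_real pi * \<i>) * contour_integral (circlepath 0 N) (\<lambda>s. s / (s - z)\<^sup>2))) (at z)"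
    using Cauchy_derivative_integral_circlepath[of 0 N "\<lambda>s. s" z] zN by auto
  have v1: "1 / (2 * of_real pi * \<i>) * contour_integral (circlepath 0 N) (\<lambda>s. s / (s - z)\<^sup>2) = 1"
    by (rule DERIV_unique[OF 1(2) DERIV_ident])
  have hol: "(\<lambda>s. k j s / (s - z)\<^sup>2) holomorphic_on {s. 1 < norm s}"
  proof -
    have "1 / N \<le> 1" using N by simp
    then show ?thesis using z by (intro holomorphic_intros holomorphic_on_subset[OF k_holomorphic]) auto
  qed
  have v2: "contour_integral (circlepath 0 N) (\<lambda>s. k j s / (s - z)\<^sup>2) = 0"
  proof (rule contour_integral_circlepath_exterior_eq_0[OF hol])
    fix s :: complex assume s: "2 \<le> norm s"
    have "norm s / 2 \<le> norm (s - z)" using norm_triangle_ineq2[of s z] s z by auto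
    then have "(norm s / 2)\<^sup>2 \<le> (norm (s - z))\<^sup>2" by (intro power_mono) auto
    then have "norm (k j s / (s - z)\<^sup>2) \<le> 2 * M / (norm s / 2)\<^sup>2"
      unfolding norm_divide norm_power using k_le[of s j] s M by (intro frac_le) auto
    then show "norm (k j s / (s - z)\<^sup>2) \<le> (8 * M) / (norm s)\<^sup>2" by (simp add: power_divide)
  qed (use N in auto)
  have "(\<lambda>s. k j s / (s - z)\<^sup>2) contour_integrable_on circlepath 0 N"
    using N by (intro contour_integrable_continuous_circlepath continuous_on_subset[OF holomorphic_on_imp_continuous_on[OF hol]]) auto
  from contour_integral_add[OF 1(1) this] v2
  have "contour_integral (circlepath 0 N) (\<lambda>s. (s + k j s) / (s - z)\<^sup>2) = contour_integral (circlepath 0 N) (\<lambda>s. s / (s - z)\<^sup>2)"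
    by (simp add: add_divide_distrib)
  then show ?thesis
    using circle_Cauchy_contour(2)[of N "\<lambda>s. s + k j s" z] v1 N by simp
qed

text \<open>Write \<open>Y u j x = a j + t \<psi>(x)\<close> and split \<open>u j\<close> into
  \<open>\<alpha> j * \<psi>\<close> and an error. By \<open>circle_Cauchy'_identity\<close> the
  first part contributes exactly \<open>\<alpha> j\<close>, with no loss from the projection. The
  error is small with \<open>\<eta>\<close> and \<open>t\<close> and can afford the factor
  2.\<close>

lemma d_le_L:
  assumes j: "j < n" and z: "norm z \<le> 1"
  shows "norm (d u j z) \<le> L"
proof -
  define \<psi> where "\<psi> x = of_real N * unit_exp x + k j (of_real N * unit_exp x)" for x
  have Y\<psi>: "Y u j x = a j + of_real t * \<psi> x" for x by (simp add: Y_eq cell_map_def \<psi>_def)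
  have \<psi>_cont: "continuous_on {0..1} \<psi>"
  proof -
    have "continuous_on {0..1} (\<lambda>x. (Y u j x - a j) / of_real t)"
      using t by (intro continuous_intros Y_continuous[OF adm_u]) auto
    then show ?thesis using t by (simp add: Y\<psi>)
  qed
  have \<psi>_le: "norm (\<psi> x) \<le> N + 2 * M" for x
    using norm_triangle_ineq[of "of_real N * unit_exp x" "k j (of_real N * unit_exp x)"]
      k_le[of "of_real N * unit_exp x" j] N by (simp add: \<psi>_def norm_mult)
  let ?B = "\<eta> * (N + 2 * M) + t * (n * ((1 + 2 * M)\<^sup>2 / (2 * \<delta>)))"
  have err: "norm (u j x - \<alpha> j * \<psi> x) \<le> ?B" for x
  proof -
    have aj: "a j \<in> ball (a j) \<delta>" using \<delta> by simp
    have "u j x - \<alpha> j * \<psi> x = ((r (Y u j x) - \<alpha> j * Y u j x) - (r (a j) - \<alpha> j * a j)) / of_real t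
        + of_real t * (\<Sum>l\<in>{..<n} - {j}. CC u l (Y u j x))"
      using T_u[of j x] j t r_fix[OF j] by (simp add: T_def Y\<psi> field_simps)
    also have "norm \<dots> \<le> norm (((r (Y u j x) - \<alpha> j * Y u j x) - (r (a j) - \<alpha> j * a j)) / of_real t)
        + norm (of_real t * (\<Sum>l\<in>{..<n} - {j}. CC u l (Y u j x)))" by (rule norm_triangle_ineq)
    also have "\<dots> \<le> \<eta> * (N + 2 * M) + t * (n * ((1 + 2 * M)\<^sup>2 / (2 * \<delta>)))"
    proof (rule add_mono)
      have "norm ((r (Y u j x) - \<alpha> j * Y u j x) - (r (a j) - \<alpha> j * a j)) \<le> \<eta> * norm (Y u j x - a j)"
        by (rule r_lip[OF j Y_in[OF adm_u] aj])
      also have "\<dots> = \<eta> * (t * norm (\<psi> x))" using t by (simp add: Y\<psi> norm_mult)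
      also have "\<dots> \<le> \<eta> * (t * (N + 2 * M))" using \<psi>_le[of x] t \<eta> by (intro mult_left_mono) auto
      finally show "norm (((r (Y u j x) - \<alpha> j * Y u j x) - (r (a j) - \<alpha> j * a j)) / of_real t) \<le> \<eta> * (N + 2 * M)"
        using t by (simp add: norm_divide divide_le_eq mult_ac)
    qed (rule CC_sum_le[OF adm_u j Y_in[OF adm_u]])
    finally show ?thesis .
  qed
  have "circle_Cauchy' N (\<lambda>x. \<alpha> j * \<psi> x) z = \<alpha> j * circle_Cauchy' N \<psi> z"
    unfolding circle_Cauchy'_def integral_mult_right[symmetric] by (rule integral_cong) (simp add: mult.assoc)
  also have "circle_Cauchy' N \<psi> z = 1"
    unfolding \<psi>_def by (rule circle_Cauchy'_identity[OF z])
  finally have "d u j z = \<alpha> j + circle_Cauchy' N (\<lambda>x. u j x - \<alpha> j * \<psi> x) z"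
    using circle_Cauchy_diff(2)[OF continuous_01[OF adm_u, of j] continuous_on_mult_left[OF \<psi>_cont, of "\<alpha> j"] norm_le_1_less_N[OF z]]
    by (simp add: d_def)
  also have "norm \<dots> \<le> norm (\<alpha> j) + norm (circle_Cauchy' N (\<lambda>x. u j x - \<alpha> j * \<psi> x) z)" by (rule norm_triangle_ineq)
  also have "\<dots> \<le> A + 2 * ?B"
  proof (rule add_mono[OF \<alpha>[OF j]])
    have "continuous_on {0..1} (\<lambda>x. u j x - \<alpha> j * \<psi> x)"
      by (intro continuous_intros continuous_01[OF adm_u] \<psi>_cont)
    then show "norm (circle_Cauchy' N (\<lambda>x. u j x - \<alpha> j * \<psi> x) z) \<le> 2 * ?B"
      using err z by (rule h_bounds(2))
  qed
  finally show ?thesis using L(1) by linarith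
qed

lemma L_nonneg: "0 \<le> L"
  by (rule order_trans[OF norm_ge_zero d_le_L[OF n_pos, of 0]]) simp

lemma E_lipschitz:
  assumes j: "j < n"
  shows "norm (E j x - E j y) \<le> L * norm (x - y)"
proof -
  have "norm (E j x - E j y) = norm (h u j (disc_reflect x) - h u j (disc_reflect y))"
    by (metis E_def complex_cnj_diff complex_mod_cnj)
  also have "\<dots> \<le> L * norm (disc_reflect x - disc_reflect y)"
  proof (rule field_differentiable_bound[of "cball 0 1"])
    fix z :: complex assume "z \<in> cball 0 1"
    then have z: "norm z \<le> 1" by simp
    show "(h u j has_field_derivative d u j z) (at z within cball 0 1)"
      unfolding h_def d_def
      by (rule has_field_derivative_at_within[OF circle_Cauchy_has_derivative[OF continuous_01[OF adm_u] norm_le_1_less_N[OF z]]])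
    show "norm (d u j z) \<le> L" by (rule d_le_L[OF j z])
  qed (use norm_disc_reflect_le in auto)
  also have "\<dots> \<le> L * norm (x - y)"
    using L_nonneg disc_reflect_lipschitz by (rule mult_left_mono[rotated])
  finally show ?thesis .
qed

text \<open>Besides the full index set, the singletons \<open>{l}\<close> are needed:
  \<open>chat_eq_c\<close> applies Cauchy's formula in the exterior of a single cell.\<close>

lemma cells_subset:
  assumes J: "J \<subseteq> {..<n}"
  shows "cells J a t E k L (1 / N) N \<delta>"
proof (rule cells.intro)
  show "finite J" using J finite_subset by blast
  fix j assume "j \<in> J"
  then have j: "j < n" using J by auto
  show "near_identity t (E j) L"
    using t L(2) L_nonneg E_lipschitz[OF j] by unfold_locales auto
  show "k j holomorphic_on {s. 1 / N < norm s}" by (rule k_holomorphic)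
  show "E j s = k j s" if "1 \<le> norm s" for s by (rule E_eq_k[OF that])
  show "cell_map (a j) t (E j) s \<in> ball (a j) \<delta>" if "norm s \<le> N" for s
  proof -
    have "norm (s + E j s) \<le> N + 2 * M"
      using norm_triangle_ineq[of s "E j s"] h_le(1)[OF adm_u norm_disc_reflect_le, of j s] that by (simp add: E_def)
    then have "t * norm (s + E j s) < \<delta>" by (rule le_less_trans[OF mult_left_mono t_small]) (use t in auto)
    then show ?thesis using t by (simp add: cell_map_def dist_norm norm_mult)
  qed
next
  fix i j assume ij: "i \<in> J" "j \<in> J" "i \<noteq> j"
  then have s: "4 * \<delta> \<le> norm (a i - a j)" using J by (intro sep) auto
  show "ball (a i) \<delta> \<inter> ball (a j) \<delta> = {}"
  proof (rule ccontr)
    assume "ball (a i) \<delta> \<inter> ball (a j) \<delta> \<noteq> {}"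
    then obtain x where "dist (a i) x < \<delta>" "dist (a j) x < \<delta>" by auto
    then have "dist (a i) (a j) < 2 * \<delta>" using dist_triangle2[of "a i" "a j" x] by simp
    then show False using s \<delta> by (simp add: dist_norm)
  qed
qed (use N in auto)

sublocale all: cells "{..<n}" a t E k L "1 / N" N \<delta>
  by (rule cells_subset) simp

text \<open>
  \<open>e l\<close> is the part of \<open>cnj (\<phi>\<^sub>l s) - F l s\<close> with negative powers of \<open>s\<close>, given by two formulas that
  agree for \<open>1 < |s| < N\<close>; \<open>chat l\<close> transplants it to the exterior of the cell. It coincides with the Cauchy
  transform \<open>c l\<close> there, but is also continuous up to the boundary.
\<close>

definition "c m z = of_real (t\<^sup>2) * CC u m z"
definition "R l w = r w + (\<Sum>m\<in>{..<n} - {l}. c m w)"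
definition "F l s = R l (all.ph l s)"
definition "J1 l s = contour_integral (circlepath 0 1) (\<lambda>\<sigma>. F l \<sigma> / (\<sigma> - s)) / (2 * of_real pi * \<i>)"
definition "e l s = (if norm s < N then cnj (a l) + of_real t / s + of_real t * h u l s - F l s
   else of_real t / s + J1 l s)"
definition "chat l z = e l (inv (all.X l) z)"

lemma X_unit: "l < n \<Longrightarrow> all.X l (unit_exp x) = W u l x"
  by (simp add: all.X_def cell_map_def W_def E_def disc_reflect_def)

lemma inverse_N_less_1: "1 / N < 1" using N by simp

lemma deriv_ph_unit:
  assumes "l < n"
  shows "deriv (all.ph l) (unit_exp x) = of_real t * (1 - cnj (d u l (unit_exp x)) * (cnj (unit_exp x))\<^sup>2)"
proof -
  have "(k l has_field_derivative - (cnj (d u l (1 / cnj (unit_exp x))) / (unit_exp x)\<^sup>2)) (at (unit_exp x))"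
    using inverse_N_less_1 by (intro k_has_derivative) simp
  then have "(k l has_field_derivative - (cnj (d u l (unit_exp x)) * (cnj (unit_exp x))\<^sup>2)) (at (unit_exp x))"
    by (simp only: inverse_cnj_unit[OF norm_unit_exp] cnj_unit_exp) (simp add: power_divide)
  then have "(all.ph l has_field_derivative of_real t * (1 + - (cnj (d u l (unit_exp x)) * (cnj (unit_exp x))\<^sup>2))) (at (unit_exp x))"
    unfolding all.ph_def cell_map_def by (auto intro!: derivative_eq_intros)
  then show ?thesis by (simp add: DERIV_imp_deriv)
qed

text \<open>The constant \<open>cnj (a m)\<close> in \<open>cnj w\<close> drops out because the loop
  does not wind about \<open>z\<close>. What remains is the integrand of \<open>CC\<close>; the sign
  comes from its kernel \<open>1 / (z - w)\<close>.\<close>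

lemma contour_integral_cnj_Gam:
  assumes m: "m < n" and z: "z \<notin> all.K m"
  shows "contour_integral (all.Gam m 1) (\<lambda>w. cnj w / (w - z)) = - 2 * of_real pi * \<i> * c m z"
proof -
  have m': "m \<in> {..<n}" using m by simp
  have zn: "z \<notin> all.X m ` sphere 0 1" "z \<notin> all.X m ` ball 0 1" using z by (auto simp: all.K_def)
  have Wne: "W u m x - z \<noteq> 0" for x
  proof -
    have "all.X m (unit_exp x) \<in> all.K m" by (simp add: all.K_def)
    then show ?thesis using z X_unit[OF m] by auto
  qed
  have 0: "contour_integral (all.Gam m 1) (\<lambda>w. 1 / (w - z)) = 0"
    using all.contour_integral_Gam_Cauchy[OF m' zn(1)] zn(2) by (simp add: contour_integral_unique)
  let ?D = "\<lambda>x. of_real t * (1 - cnj (d u m (unit_exp x)) * (cnj (unit_exp x))\<^sup>2) * unit_exp x"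
  have Dc: "continuous_on {0..1} ?D"
    using N by (intro continuous_intros continuous_on_compose2[OF d_continuous[OF adm_u]]) auto
  have 1: "contour_integral (all.Gam m 1) g = 2 * of_real pi * \<i> * integral {0..1} (\<lambda>x. g (W u m x) * ?D x)" for g
    unfolding all.contour_integral_Gam[OF m' order_refl] by (simp add: X_unit[OF m] deriv_ph_unit[OF m])
  have i0: "integral {0..1} (\<lambda>x. 1 / (W u m x - z) * ?D x) = 0" using 0 unfolding 1 by simp
  have c1: "continuous_on {0..1} (\<lambda>x. 1 / (W u m x - z) * ?D x)"
  proof (rule continuous_on_mult[OF _ Dc])
    show "continuous_on {0..1} (\<lambda>x. 1 / (W u m x - z))"
      using Wne by (intro continuous_on_divide continuous_on_const continuous_on_diff W_continuous[OF adm_u]) auto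
  qed
  have c2: "continuous_on {0..1} (\<lambda>x. P u m x / (z - W u m x))"
    using Wne by (intro continuous_on_divide continuous_on_const continuous_on_diff P_continuous[OF adm_u] W_continuous[OF adm_u]) auto
  have eq: "cnj (W u m x) / (W u m x - z) * ?D x =
     cnj (a m) * (1 / (W u m x - z) * ?D x) + - of_real (t\<^sup>2) * (P u m x / (z - W u m x))" for x
  proof -
    define w where "w = W u m x - z"
    define dd where "dd = (1 - cnj (d u m (unit_exp x)) * (cnj (unit_exp x))\<^sup>2)"
    have w0: "w \<noteq> 0" using Wne by (simp add: w_def)
    have z: "z - W u m x = - w" by (simp add: w_def)
    have P: "P u m x = (cnj (unit_exp x) + h u m (unit_exp x)) * dd * unit_exp x" by (simp add: P_def dd_def)
    have W: "cnj (W u m x) = cnj (a m) + of_real t * (cnj (unit_exp x) + h u m (unit_exp x))" by (simp add: W_def)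
    show ?thesis unfolding W P z w_def[symmetric] dd_def[symmetric] using w0
      by (simp add: field_simps power2_eq_square)
  qed
  have "integral {0..1} (\<lambda>x. cnj (W u m x) / (W u m x - z) * ?D x) =
     cnj (a m) * integral {0..1} (\<lambda>x. 1 / (W u m x - z) * ?D x) + - of_real (t\<^sup>2) * integral {0..1} (\<lambda>x. P u m x / (z - W u m x))"
    unfolding eq
    by (intro integral_unique has_integral_add has_integral_mult_right integrable_integral
        integrable_continuous_real c1 c2)
  then show ?thesis unfolding 1 i0 by (simp add: c_def CC_def)
qed

lemma R_holomorphic: "l < n \<Longrightarrow> R l holomorphic_on ball (a l) \<delta>"
  unfolding R_def c_def by (intro holomorphic_intros r_hol CC_holomorphic[OF adm_u]) auto

lemma ph_in_ball: "l < n \<Longrightarrow> 1 \<le> norm s \<Longrightarrow> norm s \<le> N \<Longrightarrow> all.ph l s \<in> ball (a l) \<delta>"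
  using all.X_in_ball[of l s] all.ph_eq_X[of l s] by simp

text \<open>An open neighbourhood of the closed annulus \<open>1 \<le> |s| \<le> N\<close>. The
  preimage is taken because \<open>R l\<close> is known to be holomorphic on that ball only.\<close>

definition "S l = {s. 1 / N < norm s} \<inter> all.ph l -` ball (a l) \<delta>"

lemma S_annulus: assumes l: "l < n"
  shows "open (S l)" "F l holomorphic_on S l" "\<And>s. 1 \<le> norm s \<Longrightarrow> norm s \<le> N \<Longrightarrow> s \<in> S l"
proof -
  have l': "l \<in> {..<n}" using l by simp
  show "open (S l)"
    unfolding S_def
    by (rule continuous_open_preimage[OF holomorphic_on_imp_continuous_on[OF all.holomorphic_ph[OF l']] open_norm_gt open_ball])
  have "all.ph l holomorphic_on S l"
    by (rule holomorphic_on_subset[OF all.holomorphic_ph[OF l']]) (auto simp: S_def)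
  then have "(R l \<circ> all.ph l) holomorphic_on S l"
    by (rule holomorphic_on_compose_gen[OF _ R_holomorphic[OF l]]) (auto simp: S_def)
  then show "F l holomorphic_on S l" by (simp add: F_def[abs_def] comp_def)
  show "s \<in> S l" if "1 \<le> norm s" "norm s \<le> N" for s
  proof -
    have "1 / N < norm s" using inverse_N_less_1 that by linarith
    then show ?thesis using ph_in_ball[OF l that] by (simp add: S_def)
  qed
qed

text \<open>The fixed point equation \<open>T u = u\<close>, read on the circle
  \<open>|s| = N\<close>. It makes \<open>cnj (a l) + t h\<close> the Cauchy projection of
  \<open>F l\<close> from that circle.\<close>

lemma fixpoint_F:
  assumes l: "l < n"
  shows "F l (of_real N * unit_exp x) = cnj (a l) + of_real t * u l x"
proof -
  have "F l (of_real N * unit_exp x) = R l (Y u l x)" by (simp add: F_def all.ph_def Y_eq)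
  also have "\<dots> = cnj (a l) + of_real t * T u l x"
    using t l by (simp add: R_def c_def T_def sum_distrib_left[symmetric] power2_eq_square distrib_left mult.assoc)
  finally show ?thesis by (simp add: T_u)
qed

lemma h_contour:
  assumes l: "l < n" and z: "norm z < N"
  shows "contour_integral (circlepath 0 N) (\<lambda>\<sigma>. F l \<sigma> / (\<sigma> - z)) / (2 * of_real pi * \<i>) = cnj (a l) + of_real t * h u l z"
proof -
  have N0: "0 < N" using N by simp
  have const: "circle_Cauchy N (\<lambda>x. C) z = C" for C
  proof -
    have "((\<lambda>\<sigma>. C / (\<sigma> - z)) has_contour_integral (2 * of_real pi * \<i> * C)) (circlepath 0 N)"
      using z by (intro Cauchy_integral_circlepath_simple) auto
    then show ?thesis using circle_Cauchy_contour(1)[OF N0, of "\<lambda>_. C" z] by (simp add: contour_integral_unique)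
  qed
  have "circle_Cauchy N (\<lambda>x. F l (of_real N * unit_exp x)) z =
     circle_Cauchy N (\<lambda>x. (cnj (a l) + of_real t * u l x)) z" by (simp add: fixpoint_F[OF l])
  also have "\<dots> - circle_Cauchy N (\<lambda>x. of_real t * u l x) z = circle_Cauchy N (\<lambda>x. cnj (a l)) z"
    using circle_Cauchy_diff(1)[of "\<lambda>x. cnj (a l) + of_real t * u l x" "\<lambda>x. of_real t * u l x" z N] z continuous_01[OF adm_u, of l]
    by (simp add: continuous_intros)
  finally have "circle_Cauchy N (\<lambda>x. F l (of_real N * unit_exp x)) z = cnj (a l) + circle_Cauchy N (\<lambda>x. of_real t * u l x) z"
    unfolding const by (simp add: algebra_simps)
  also have "circle_Cauchy N (\<lambda>x. of_real t * u l x) z = of_real t * h u l z"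
    unfolding circle_Cauchy_def h_def integral_mult_right[symmetric] by (rule integral_cong) (simp add: mult.assoc)
  finally show ?thesis using circle_Cauchy_contour(1)[OF N0, of "F l" z] by simp
qed

text \<open>Cauchy's formula in the annulus: the outer circle supplies the nonnegative powers, known
  by \<open>h_contour\<close>, and the unit circle the negative ones.\<close>

lemma F_Laurent:
  assumes l: "l < n" and s: "1 < norm s" "norm s < N"
  shows "F l s = cnj (a l) + of_real t * h u l s - J1 l s"
proof -
  note [simp] = S_annulus[OF l]
  \<comment> \<open>The difference quotient has no singularity at \<open>s\<close>, so its integrals
    over both circles agree. Only the outer circle winds about \<open>s\<close>, which isolates
    \<open>F l s\<close>.\<close>
  define g where "g \<sigma> = (if \<sigma> = s then deriv (F l) s else (F l \<sigma> - F l s) / (\<sigma> - s))" for \<sigma>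
  have g: "g holomorphic_on S l" unfolding g_def by (rule pole_lemma_open) auto
  have eq: "contour_integral (circlepath 0 1) g = contour_integral (circlepath 0 N) g"
    using N by (intro contour_integral_circlepath_annulus[OF _ g]) auto
  have val: "contour_integral (circlepath 0 \<rho>) g = contour_integral (circlepath 0 \<rho>) (\<lambda>\<sigma>. F l \<sigma> / (\<sigma> - s)) - F l s * i"
    if \<rho>: "\<rho> = 1 \<or> \<rho> = N" and i: "((\<lambda>\<sigma>. 1 / (\<sigma> - s)) has_contour_integral i) (circlepath 0 \<rho>)" for \<rho> i
  proof -
    have ne: "\<sigma> \<noteq> s" if "norm \<sigma> = \<rho>" for \<sigma> using that \<rho> s by auto
    have \<rho>0: "\<rho> > 0" using \<rho> N by auto
    have "sphere 0 \<rho> \<subseteq> S l" using \<rho> N by auto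
    then have "(\<lambda>\<sigma>. F l \<sigma> / (\<sigma> - s)) contour_integrable_on circlepath 0 \<rho>"
      using \<rho>0 ne by (intro contour_integrable_continuous_circlepath continuous_intros
        continuous_on_subset[OF holomorphic_on_imp_continuous_on[OF S_annulus(2)[OF l]]]) auto
    then have "((\<lambda>\<sigma>. F l \<sigma> / (\<sigma> - s) - F l s * (1 / (\<sigma> - s))) has_contour_integral
       contour_integral (circlepath 0 \<rho>) (\<lambda>\<sigma>. F l \<sigma> / (\<sigma> - s)) - F l s * i) (circlepath 0 \<rho>)"
      by (intro has_contour_integral_diff has_contour_integral_lmul i has_contour_integral_integral)
    then have "(g has_contour_integral contour_integral (circlepath 0 \<rho>) (\<lambda>\<sigma>. F l \<sigma> / (\<sigma> - s)) - F l s * i) (circlepath 0 \<rho>)"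
      by (rule has_contour_integral_eq) (use ne \<rho>0 in \<open>auto simp: g_def diff_divide_distrib\<close>)
    then show ?thesis by (rule contour_integral_unique)
  qed
  have i1: "((\<lambda>\<sigma>. 1 / (\<sigma> - s)) has_contour_integral 0) (circlepath 0 1)"
    using s by (intro Cauchy_theorem_convex_simple[of _ "cball 0 1"] holomorphic_intros) auto
  have iN: "((\<lambda>\<sigma>. 1 / (\<sigma> - s)) has_contour_integral (2 * of_real pi * \<i> * 1)) (circlepath 0 N)"
    using s by (intro Cauchy_integral_circlepath_simple) auto
  have "contour_integral (circlepath 0 1) (\<lambda>\<sigma>. F l \<sigma> / (\<sigma> - s)) =
     contour_integral (circlepath 0 N) (\<lambda>\<sigma>. F l \<sigma> / (\<sigma> - s)) - F l s * (2 * of_real pi * \<i>)"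
    using eq val[OF _ i1] val[OF _ iN] by simp
  then have "F l s = contour_integral (circlepath 0 N) (\<lambda>\<sigma>. F l \<sigma> / (\<sigma> - s)) / (2 * of_real pi * \<i>) - J1 l s"
    by (simp add: J1_def field_simps)
  then show ?thesis using h_contour[OF l s(2)] by simp
qed

lemma e_eq: "l < n \<Longrightarrow> 1 < norm s \<Longrightarrow> e l s = of_real t / s + J1 l s"
  using F_Laurent[of l s] by (simp add: e_def)

lemma F_continuous_circle: "l < n \<Longrightarrow> continuous_on (path_image (circlepath 0 1)) (F l)"
  using S_annulus[of l] N by (intro continuous_on_subset[OF holomorphic_on_imp_continuous_on[OF S_annulus(2)]]) auto

lemma J1_holomorphic:
  assumes l: "l < n"
  shows "J1 l holomorphic_on {s. 1 < norm s}"
proof -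
  let ?G = "\<lambda>s. contour_integral (circlepath 0 1) (\<lambda>\<sigma>. F l \<sigma> / (\<sigma> - s) ^ 1)"
  have "\<exists>f'. (?G has_field_derivative f') (at s)" if s: "1 < norm s" for s
  proof -
    have "(?G has_field_derivative (of_nat 1 * contour_integral (circlepath 0 1) (\<lambda>\<sigma>. F l \<sigma> / (\<sigma> - s) ^ Suc 1))) (at s)"
    proof (rule Cauchy_next_derivative(2)[where S = UNIV and B = "2 * pi"])
      show "continuous_on (path_image (circlepath 0 1)) (F l)" by (rule F_continuous_circle[OF l])
      show "norm (vector_derivative (circlepath 0 1) (at x)) \<le> 2 * pi" for x
        by (simp add: vector_derivative_circlepath norm_mult)
      show "((\<lambda>\<sigma>. F l \<sigma> / (\<sigma> - w) ^ 1) has_contour_integral ?G w) (circlepath 0 1)"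
        if "w \<in> UNIV - path_image (circlepath 0 1)" for w
        using that by (intro has_contour_integral_integral contour_integrable_continuous_circlepath
          continuous_intros F_continuous_circle[OF l]) auto
    qed (use s in auto)
    then show ?thesis by blast
  qed
  then have "?G holomorphic_on {s. 1 < norm s}" by (auto simp: holomorphic_on_open[OF open_norm_gt])
  then show ?thesis unfolding J1_def[abs_def] by (auto intro!: holomorphic_intros)
qed

lemma e_holomorphic:
  assumes l: "l < n"
  shows "e l holomorphic_on {s. 1 < norm s}"
proof -
  have "(\<lambda>s. of_real t / s + J1 l s) holomorphic_on {s. 1 < norm s}"
    by (intro holomorphic_intros J1_holomorphic[OF l]) auto
  then show ?thesis by (rule holomorphic_transform) (auto simp: e_eq[OF l])
qed

lemma e_continuous:
  assumes l: "l < n"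
  shows "continuous_on {s. 1 \<le> norm s} (e l)"
  unfolding continuous_on_eq_continuous_within
proof
  fix s :: complex assume "s \<in> {s. 1 \<le> norm s}"
  then have s: "1 \<le> norm s" by simp
  show "continuous (at s within {s. 1 \<le> norm s}) (e l)"
  proof (cases "norm s = 1")
    case False
    then have "isCont (e l) s"
      using s holomorphic_on_imp_continuous_on[OF e_holomorphic[OF l]] open_norm_gt[of 1]
      by (auto simp: continuous_on_eq_continuous_at)
    then show ?thesis by (rule continuous_at_imp_continuous_within)
  next
    case True
    let ?g = "\<lambda>s. cnj (a l) + of_real t / s + of_real t * h u l s - F l s"
    have s0: "s \<noteq> 0" using True by auto
    have "s \<in> S l" using S_annulus(3)[OF l, of s] True N by simp
    then have "isCont (F l) s"
      using holomorphic_on_imp_continuous_on[OF S_annulus(2)[OF l]] S_annulus(1)[OF l] by (auto simp: continuous_on_eq_continuous_at)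
    moreover have "isCont (h u l) s"
      using h_continuous[OF adm_u, of l] True N by (auto simp: continuous_on_eq_continuous_at)
    ultimately have "isCont ?g s" using s0 by (intro continuous_intros) auto
    then have "continuous (at s within {s. 1 \<le> norm s}) ?g" by (rule continuous_at_imp_continuous_within)
    then show ?thesis
    \<comment> \<open>Within this distance of the unit circle \<open>|x| < N\<close> holds, so that
      the first formula for \<open>e\<close> is in force.\<close>
    proof (rule continuous_transform_within[where \<delta> = "N - 1"])
      fix x :: complex assume "x \<in> {s. 1 \<le> norm s}" "dist x s < N - 1"
      then have "norm x < N" using norm_triangle_ineq2[of x s] True by (simp add: dist_norm)
      then show "?g x = e l x" by (simp add: e_def)
    qed (use s N in auto)
  qed
qed

lemma e_decay:
  assumes l: "l < n"
  obtains C where "\<And>s. 2 \<le> norm s \<Longrightarrow> norm (e l s) \<le> C / norm s"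
proof -
  obtain B where B: "\<And>\<sigma>. \<sigma> \<in> path_image (circlepath 0 1) \<Longrightarrow> norm (F l \<sigma>) \<le> B"
    using compact_imp_bounded[OF compact_continuous_image[OF F_continuous_circle[OF l] compact_path_image]]
    unfolding bounded_iff by (metis imageI path_circlepath)
  have B0: "0 \<le> B" using order_trans[OF norm_ge_zero B[of 1]] by simp
  have "norm (e l s) \<le> (t + 2 * B) / norm s" if s: "2 \<le> norm s" for s
  proof -
    have "((\<lambda>\<sigma>. F l \<sigma> / (\<sigma> - s)) has_contour_integral contour_integral (circlepath 0 1) (\<lambda>\<sigma>. F l \<sigma> / (\<sigma> - s))) (circlepath 0 1)"
      using s by (intro has_contour_integral_integral contour_integrable_continuous_circlepath
          continuous_intros F_continuous_circle[OF l]) auto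
    then have "norm (contour_integral (circlepath 0 1) (\<lambda>\<sigma>. F l \<sigma> / (\<sigma> - s))) \<le> (B / (norm s / 2)) * (2 * pi * 1)"
    proof (rule has_contour_integral_bound_circlepath)
      fix \<sigma> :: complex assume "norm (\<sigma> - 0) = 1"
      then have \<sigma>: "norm \<sigma> = 1" by simp
      have "norm s / 2 \<le> norm (\<sigma> - s)" using norm_triangle_ineq2[of s \<sigma>] \<sigma> s by (simp add: norm_minus_commute)
      then show "norm (F l \<sigma> / (\<sigma> - s)) \<le> B / (norm s / 2)"
        unfolding norm_divide using B[of \<sigma>] \<sigma> s B0 by (intro frac_le) auto
    qed (use B0 s in auto)
    then have "norm (J1 l s) \<le> 2 * B / norm s"
      using s by (simp add: J1_def norm_divide norm_mult field_simps)
    moreover have "norm (of_real t / s) = t / norm s" using t by (simp add: norm_divide)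
    ultimately have "norm (of_real t / s + J1 l s) \<le> t / norm s + 2 * B / norm s"
      using norm_triangle_ineq[of "of_real t / s" "J1 l s"] by linarith
    then show ?thesis using e_eq[OF l, of s] s by (simp add: add_divide_distrib)
  qed
  then show ?thesis using that by blast
qed

lemma X_outside: "l < n \<Longrightarrow> all.X l ` {s. 1 < norm s} = - all.K l"
proof -
  assume l: "l < n"
  have "{s::complex. 1 < norm s} = - cball 0 1" by auto
  then show ?thesis using all.X_homeo(6)[of l "cball 0 1"] l by (simp add: all.K_def)
qed

text \<open>\<open>X l\<close> is only Lipschitz inside the disc, but outside it is the injective
  holomorphic map \<open>ph l\<close>. The inverse of that map is holomorphic and coincides with
  \<open>inv (X l)\<close> off the cell.\<close>

lemma chat_holomorphic:
  assumes l: "l < n"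
  shows "chat l holomorphic_on - all.K l"
proof -
  have l': "l \<in> {..<n}" using l by simp
  let ?V = "{s::complex. 1 < norm s}"
  have V: "all.ph l s = all.X l s" if "s \<in> ?V" for s using that all.ph_eq_X[OF l', of s] by simp
  have hol: "all.ph l holomorphic_on ?V"
    using inverse_N_less_1 by (intro holomorphic_on_subset[OF all.holomorphic_ph[OF l']]) auto
  have inj: "inj_on (all.ph l) ?V"
    using V all.X_homeo(11)[OF l'] by (auto intro!: inj_onI)
  have im: "all.ph l ` ?V = - all.K l"
    using V by (simp add: X_outside[OF l, symmetric] image_def)
  obtain g where g: "g holomorphic_on (all.ph l ` ?V)" "\<And>z. z \<in> ?V \<Longrightarrow> g (all.ph l z) = z"
    using holomorphic_has_inverse[OF hol open_norm_gt inj] by metis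
  have ginv: "g z = inv (all.X l) z \<and> g z \<in> ?V" if "z \<in> - all.K l" for z
  proof -
    have "z \<in> all.ph l ` ?V" using that im by simp
    then obtain s where s: "s \<in> ?V" "z = all.ph l s" by (rule imageE)
    then show ?thesis using g(2)[OF s(1)] V[OF s(1)] all.X_homeo(10)[OF l', of s] by simp
  qed
  have "g ` (- all.K l) \<subseteq> ?V" using ginv by blast
  then have "(e l \<circ> g) holomorphic_on - all.K l"
    using g(1) unfolding im by (intro holomorphic_on_compose_gen[OF _ e_holomorphic[OF l]])
  then show ?thesis by (rule holomorphic_transform) (use ginv in \<open>auto simp: chat_def\<close>)
qed

lemma inv_X_ge_1:
  assumes l: "l < n" and z: "z \<notin> all.X l ` ball 0 1"
  shows "1 \<le> norm (inv (all.X l) z)"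
proof (rule ccontr)
  assume "\<not> 1 \<le> norm (inv (all.X l) z)"
  then have "all.X l (inv (all.X l) z) \<in> all.X l ` ball 0 1" by simp
  then show False using z all.X_homeo(9)[of l z] l by simp
qed

lemma chat_continuous:
  assumes l: "l < n"
  shows "continuous_on (- all.X l ` ball 0 1) (chat l)"
  unfolding chat_def using inv_X_ge_1[OF l] l
  by (intro continuous_on_compose2[OF e_continuous[OF l] all.X_homeo(8)]) auto

lemma chat_decay:
  assumes l: "l < n"
  obtains C R0 where "\<And>z. R0 \<le> norm z \<Longrightarrow> norm (chat l z) \<le> C / norm z" "0 \<le> C" "0 \<le> R0"
proof -
  obtain C where C: "\<And>s. 2 \<le> norm s \<Longrightarrow> norm (e l s) \<le> C / norm s" using e_decay[OF l] by blast
  have C0: "0 \<le> C" using order_trans[OF norm_ge_zero C[of 2]] by simp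
  \<comment> \<open>Large enough that \<open>z = X l s\<close> implies
    \<open>|z| / 2 \<le> t |s|\<close> and \<open>2 \<le> |s|\<close>.\<close>
  let ?R0 = "2 * norm (a l) + 4 * M * t + 4 * t + 1"
  have "norm (chat l z) \<le> (2 * t * C) / norm z" if z: "?R0 \<le> norm z" for z
  proof -
    define s where "s = inv (all.X l) z"
    have "z = all.X l s" using all.X_homeo(9)[of l z] l by (simp add: s_def)
    then have zs: "z = a l + of_real t * (s + E l s)" by (simp add: all.X_def cell_map_def)
    have "norm z \<le> norm (a l) + t * norm (s + E l s)"
      unfolding zs using norm_triangle_ineq[of "a l" "of_real t * (s + E l s)"] t by (simp add: norm_mult)
    also have "t * norm (s + E l s) \<le> t * (norm s + 2 * M)"
      using norm_triangle_ineq[of s "E l s"] h_le(1)[OF adm_u norm_disc_reflect_le, of l s] t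
      by (intro mult_left_mono) (auto simp: E_def)
    finally have "norm z \<le> norm (a l) + t * norm s + 2 * M * t" by (simp add: algebra_simps)
    then have half: "norm z / 2 \<le> t * norm s" using z t by linarith
    have zp: "0 < norm z" using z t M norm_ge_zero[of "a l"] mult_nonneg_nonneg[of M t] by linarith
    have "4 * t \<le> norm z" using z M t norm_ge_zero[of "a l"] mult_nonneg_nonneg[of M t] by linarith
    then have "t * 2 \<le> t * norm s" using half by simp
    then have s2: "2 \<le> norm s" using t by simp
    have "norm (chat l z) \<le> C / norm s" using C[OF s2] by (simp add: chat_def s_def)
    also have "\<dots> \<le> C / (norm z / (2 * t))"
    proof (rule divide_left_mono)
      show "norm z / (2 * t) \<le> norm s" using half t by (simp add: field_simps)
      have "0 < norm s" using s2 by linarith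
      then show "0 < norm s * (norm z / (2 * t))" using zp t by simp
    qed (rule C0)
    finally show ?thesis using t by (simp add: mult_ac)
  qed
  moreover have "0 \<le> ?R0" using t M norm_ge_zero[of "a l"] mult_nonneg_nonneg[of M t] by linarith
  ultimately show ?thesis using that[of ?R0 "2 * t * C"] C0 t by simp
qed

text \<open>On the unit circle \<open>cnj s = 1 / s\<close>, which turns \<open>cnj (X l s)\<close>
  into the terms of the first formula for \<open>e\<close> other than \<open>F l s\<close>.\<close>

lemma chat_boundary:
  assumes l: "l < n" and s: "norm s = 1"
  shows "chat l (all.X l s) = cnj (all.X l s) - R l (all.X l s)"
proof -
  have l': "l \<in> {..<n}" using l by simp
  have "cnj s = 1 / s" using inverse_cnj_unit[OF s] s by (metis complex_cnj_cnj complex_cnj_divide complex_cnj_one)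
  then have "cnj (all.X l s) = cnj (a l) + of_real t / s + of_real t * h u l s"
    using s by (simp add: all.X_def cell_map_def E_def disc_reflect_def algebra_simps)
  moreover have "chat l (all.X l s) = e l s" by (simp add: chat_def all.X_homeo(10)[OF l'])
  moreover have "F l s = R l (all.X l s)" using all.ph_eq_X[OF l', of s] s by (simp add: F_def)
  ultimately show ?thesis using s N by (simp add: e_def)
qed

text \<open>Outside the cell, \<open>chat l\<close> is the Cauchy integral of its boundary values
  \<open>cnj w - R l w\<close>. The part with \<open>R l\<close> vanishes, since \<open>R l\<close>
  is holomorphic in a ball containing the cell and \<open>z\<close> is outside the cell. The part
  with \<open>cnj w\<close> gives \<open>c l\<close>.\<close>

lemma chat_eq_c:
  assumes l: "l < n" and z: "z \<notin> all.K l"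
  shows "chat l z = c l z"
proof -
  interpret one: cells "{l}" a t E k L "1 / N" N \<delta> by (rule cells_subset) (use l in simp)
  have l': "l \<in> {..<n}" using l by simp
  have Om: "one.Om = - all.K l" by (simp add: one.Om_def)
  have cl: "closure one.Om = - all.X l ` ball 0 1" by (simp add: one.closure_Om)
  obtain C R0 where decay: "\<And>z. R0 \<le> norm z \<Longrightarrow> norm (chat l z) \<le> C / norm z" using chat_decay[OF l] by blast
  have "(\<Sum>j\<in>{l}. contour_integral (one.Gam j 1) (\<lambda>w. chat l w / (w - z))) = - 2 * of_real pi * \<i> * chat l z"
  proof (rule one.exterior_Cauchy_outside[OF _ _ decay])
    show "chat l holomorphic_on one.Om" using chat_holomorphic[OF l] by (simp add: Om)
    show "continuous_on (closure one.Om) (chat l)" using chat_continuous[OF l] by (simp add: cl)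
    show "z \<in> one.Om" using z by (simp add: Om)
  qed auto
  then have 1: "contour_integral (all.Gam l 1) (\<lambda>w. chat l w / (w - z)) = - 2 * of_real pi * \<i> * chat l z" by simp
  have zn: "z \<notin> all.X l ` sphere 0 1" "z \<notin> all.X l ` ball 0 1" using z by (auto simp: all.K_def)
  have pim: "path_image (all.Gam l 1) = all.X l ` sphere 0 1" by (rule all.path_image_Gam[OF l' order_refl])
  have Kb: "all.X l ` sphere 0 1 \<subseteq> ball (a l) \<delta>" "all.X l ` ball 0 1 \<subseteq> ball (a l) \<delta>"
    using all.K_subset_ball[OF l'] by (auto simp: all.K_def)
  have R0: "((\<lambda>w. R l w / (w - z)) has_contour_integral 0) (all.Gam l 1)"
  proof (rule Cauchy_theorem_global[of "ball (a l) \<delta> - {z}"])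
    show "(\<lambda>w. R l w / (w - z)) holomorphic_on ball (a l) \<delta> - {z}"
      by (intro holomorphic_intros holomorphic_on_subset[OF R_holomorphic[OF l]]) auto
    show "path_image (all.Gam l 1) \<subseteq> ball (a l) \<delta> - {z}" using Kb zn by (auto simp: pim)
    fix w assume "w \<notin> ball (a l) \<delta> - {z}"
    then have "w \<notin> all.X l ` sphere 0 1" "w \<notin> all.X l ` ball 0 1" using Kb zn by blast+
    then show "winding_number (all.Gam l 1) w = 0" using all.winding_number_Gam[OF l' order_refl] by simp
  qed (use all.valid_path_Gam[OF l' order_refl] all.loop_Gam in auto)
  have ci: "(\<lambda>w. cnj w / (w - z)) contour_integrable_on all.Gam l 1"
    using zn by (intro all.contour_integrable_Gam[OF l'] continuous_intros) auto
  have "((\<lambda>w. cnj w / (w - z) - R l w / (w - z)) has_contour_integral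
     contour_integral (all.Gam l 1) (\<lambda>w. cnj w / (w - z)) - 0) (all.Gam l 1)"
    by (intro has_contour_integral_diff has_contour_integral_integral ci R0)
  then have "((\<lambda>w. chat l w / (w - z)) has_contour_integral
     contour_integral (all.Gam l 1) (\<lambda>w. cnj w / (w - z)) - 0) (all.Gam l 1)"
    by (rule has_contour_integral_eq) (auto simp: pim chat_boundary[OF l] diff_divide_distrib)
  then have "contour_integral (all.Gam l 1) (\<lambda>w. chat l w / (w - z)) = - 2 * of_real pi * \<i> * c l z"
    using contour_integral_cnj_Gam[OF l z] by (simp add: contour_integral_unique)
  then show ?thesis using 1 by simp
qed

text \<open>On the boundary of cell \<open>j\<close>, \<open>chat_boundary\<close> expresses
  \<open>cnj w\<close> by \<open>r\<close>, \<open>chat j\<close> and the \<open>c l\<close> of the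
  other cells. There \<open>w\<close> is outside those cells, so \<open>chat_eq_c\<close> replaces
  each \<open>c l\<close> by \<open>chat l\<close>, and the formula becomes the same for all
  \<open>j\<close>.\<close>

theorem quadrature_domain:
  assumes poles: "\<And>z j. pole z \<Longrightarrow> j < n \<Longrightarrow> z \<notin> ball (a j) \<delta>"
  shows "unbounded_quadrature_domain all.Om r pole" "enat n \<le> connectivity all.Om"
proof -
  show "enat n \<le> connectivity all.Om" using all.card_le_connectivity by simp
  have K_ball: "all.K j \<subseteq> ball (a j) \<delta>" if "j < n" for j using all.K_subset_ball[of j] that by simp
  have Om_sub: "all.Om \<subseteq> - all.K l" if "l < n" for l using that by (auto simp: all.Om_def)
  have cl_sub: "closure all.Om \<subseteq> - all.X l ` ball 0 1" if "l < n" for l using that by (auto simp: all.closure_Om)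
  have "\<forall>l\<in>{..<n}. \<exists>C R0. (\<forall>z. R0 \<le> norm z \<longrightarrow> norm (chat l z) \<le> C / norm z) \<and> 0 \<le> C \<and> 0 \<le> R0"
    using chat_decay by (metis lessThan_iff)
  then obtain C R0 where CR: "\<And>l z. l < n \<Longrightarrow> R0 l \<le> norm z \<Longrightarrow> norm (chat l z) \<le> C l / norm z"
     "\<And>l. l < n \<Longrightarrow> 0 \<le> C l" "\<And>l. l < n \<Longrightarrow> 0 \<le> R0 l"
    by (metis lessThan_iff)
  show "unbounded_quadrature_domain all.Om r pole"
  proof (rule all.unbounded_quadrature_domain_Om[where c = "\<lambda>z. \<Sum>l<n. chat l z" and Cc = "sum C {..<n}" and Rc = "sum R0 {..<n}"])
    show "{..<n} \<noteq> {}" using n_pos by auto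
    show "continuous_on (frontier all.Om) r"
    proof -
      have "continuous_on (\<Union>j\<in>{..<n}. ball (a j) \<delta>) r"
        by (rule continuous_on_open_UN) (auto intro!: holomorphic_on_imp_continuous_on r_hol)
      moreover have "frontier all.Om \<subseteq> (\<Union>j\<in>{..<n}. ball (a j) \<delta>)"
      proof
        fix w assume "w \<in> frontier all.Om"
        then obtain j s where "j < n" "w = all.X j s" "norm s = 1" by (auto simp: all.frontier_Om)
        then show "w \<in> (\<Union>j\<in>{..<n}. ball (a j) \<delta>)" using all.X_in_ball[of j s] N by auto
      qed
      ultimately show ?thesis by (rule continuous_on_subset)
    qed
    show "z \<in> all.Om" if "pole z" for z
      using poles[OF that] K_ball unfolding all.Om_def by blast
    show "(\<lambda>z. \<Sum>l<n. chat l z) holomorphic_on all.Om"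
      by (intro holomorphic_on_sum holomorphic_on_subset[OF chat_holomorphic] Om_sub) auto
    show "continuous_on (closure all.Om) (\<lambda>z. \<Sum>l<n. chat l z)"
      by (intro continuous_on_sum continuous_on_subset[OF chat_continuous] cl_sub) auto
    show "norm (\<Sum>l<n. chat l z) \<le> sum C {..<n} / norm z" if z: "sum R0 {..<n} \<le> norm z" for z
    proof -
      have "norm (\<Sum>l<n. chat l z) \<le> (\<Sum>l<n. C l / norm z)"
      proof (rule sum_norm_le)
        fix l assume "l \<in> {..<n}"
        then have l: "l < n" by simp
        have "R0 l \<le> sum R0 {..<n}" using l CR(3) by (intro member_le_sum) auto
        then show "norm (chat l z) \<le> C l / norm z" using CR(1)[OF l, of z] z by simp
      qed
      then show ?thesis by (simp add: sum_divide_distrib)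
    qed
    fix w assume "w \<in> frontier all.Om"
    then obtain j s where j: "j < n" and w: "w = all.X j s" and s: "norm s = 1" by (auto simp: all.frontier_Om)
    have wK: "w \<in> all.K j" using s by (simp add: w all.K_def)
    have "w \<notin> all.K l" if "l < n" "l \<noteq> j" for l
      using wK K_ball[OF j] K_ball[OF that(1)] all.disj[of l j] that j by blast
    then have "(\<Sum>l\<in>{..<n} - {j}. chat l w) = (\<Sum>l\<in>{..<n} - {j}. c l w)"
      by (intro sum.cong) (auto intro!: chat_eq_c)
    moreover have "(\<Sum>l<n. chat l w) = chat j w + (\<Sum>l\<in>{..<n} - {j}. chat l w)"
      using j by (intro sum.remove) auto
    ultimately show "cnj w = r w + (\<Sum>l<n. chat l w)"
      using chat_boundary[OF j s] by (simp add: w R_def)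
  qed
qed

end

section \<open>Existence of the domain and choice of the constants\<close>

theorem (in attracting_data) ex_quadrature_domain:
  assumes "0 < n" and "\<And>z j. pole z \<Longrightarrow> j < n \<Longrightarrow> z \<notin> ball (a j) \<delta>"
  shows "\<exists>\<Omega>. unbounded_quadrature_domain \<Omega> r pole \<and> enat n \<le> connectivity \<Omega>"
proof -
  obtain u where "adm u" "\<And>j x. T u j x = u j x" using T_fixpoint by blast
  then interpret schwarz_solution n a \<alpha> r N M t \<delta> \<eta> A q L u
    using assms(1) by unfold_locales auto
  show ?thesis using quadrature_domain assms(2) by blast
qed

text \<open>The degenerate domain with empty boundary: by Liouville's theorem the only test function
  on the whole sphere is 0.\<close>

lemma unbounded_quadrature_domain_UNIV: "unbounded_quadrature_domain UNIV r pole"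
proof -
  have "boundary_cycle UNIV []" by (simp add: boundary_cycle_def)
  moreover have "pv_area_integral_is UNIV f (boundary_integral [] (\<lambda>z. f z * r z) / (2 * \<i>))"
    if f: "test_function UNIV f" for f
  proof -
    have hol: "f holomorphic_on UNIV"
      and an: "(\<lambda>w. if w = 0 then 0 else f (inverse w)) analytic_on {0}" (is "?F analytic_on {0}")
      using f by (auto simp: test_function_def)
    have "isCont ?F 0" using an by (simp add: analytic_at_imp_isCont)
    then have "(?F \<longlongrightarrow> 0) (at 0)" by (simp add: isCont_def)
    then have "((\<lambda>w. f (inverse w)) \<longlongrightarrow> 0) (at 0)"
      by (rule Lim_transform_eventually) (auto simp: eventually_at_filter)
    then have "(f \<longlongrightarrow> 0) at_infinity"
      by (simp add: lim_at_infinity_0 comp_def)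
    then have "f z = 0" for z using Liouville_weak_0[OF hol] by blast
    then have "f = (\<lambda>_. 0)" by auto
    then show ?thesis by (simp add: pv_area_integral_is_def boundary_integral_def)
  qed
  ultimately show ?thesis
    by (auto simp: unbounded_quadrature_domain_def unbounded_domain_def intro!: exI[of _ "[]"])
qed

lemma ex_small_scale:
  fixes x y z d d' d'' :: real
  assumes "0 < d" "0 < d'" "0 < d''"
  shows "\<exists>t>0. t \<le> 1 \<and> t * x < d \<and> t * y < d' \<and> t * z < d''"
proof -
  have ev: "eventually (\<lambda>t. t * c < d) (at_right 0)" if "0 < d" for c d :: real
  proof -
    have "((\<lambda>t. t * c) \<longlongrightarrow> 0 * c) (at_right 0)" by (intro tendsto_intros)
    then show ?thesis using that by (intro order_tendstoD(2)) auto
  qed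
  have "eventually (\<lambda>t::real. 0 < t \<and> t \<le> 1) (at_right 0)"
    unfolding eventually_at_right_field by (intro exI[of _ 1]) auto
  then have "eventually (\<lambda>t. (0 < t \<and> t \<le> 1) \<and> t * x < d \<and> t * y < d' \<and> t * z < d'') (at_right 0)"
    by (intro eventually_conj[OF _ eventually_conj[OF ev[OF assms(1)] eventually_conj[OF ev[OF assms(2)] ev[OF assms(3)]]]])
  then show ?thesis using eventually_happens trivial_limit_at_right_real by blast
qed

lemma derivative_near_Lipschitz:
  fixes r :: "complex \<Rightarrow> complex"
  assumes hol: "r holomorphic_on U" and U: "open U" "z \<in> U" and \<eta>: "0 < \<eta>"
  obtains d where "0 < d" "ball z d \<subseteq> U"
    "\<And>x y. x \<in> ball z d \<Longrightarrow> y \<in> ball z d \<Longrightarrow>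
       norm ((r x - deriv r z * x) - (r y - deriv r z * y)) \<le> \<eta> * norm (x - y)"
proof -
  have "deriv r holomorphic_on U" by (intro holomorphic_deriv hol U)
  then have "isCont (deriv r) z"
    using U by (simp add: holomorphic_on_imp_continuous_on continuous_on_eq_continuous_at[symmetric] holomorphic_on_imp_differentiable_at field_differentiable_imp_continuous_at)
  then obtain d1 where d1: "0 < d1" "\<And>x. dist x z < d1 \<Longrightarrow> dist (deriv r x) (deriv r z) < \<eta>"
    using \<eta> by (auto simp: continuous_at_eps_delta)
  obtain d2 where d2: "0 < d2" "ball z d2 \<subseteq> U" using U open_contains_ball by blast
  let ?d = "min d1 d2"
  have "norm ((r x - deriv r z * x) - (r y - deriv r z * y)) \<le> \<eta> * norm (x - y)"
    if xy: "x \<in> ball z ?d" "y \<in> ball z ?d" for x y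
  proof (rule field_differentiable_bound[of "ball z ?d" "\<lambda>x. r x - deriv r z * x" "\<lambda>x. deriv r x - deriv r z"])
    fix w assume w: "w \<in> ball z ?d"
    then have "(r has_field_derivative deriv r w) (at w)"
      using d2 by (intro holomorphic_derivI[OF hol U(1)]) auto
    then show "((\<lambda>x. r x - deriv r z * x) has_field_derivative deriv r w - deriv r z) (at w within ball z ?d)"
      by (intro has_field_derivative_at_within[OF DERIV_diff[OF _ DERIV_cmult_Id]])
    show "norm (deriv r w - deriv r z) \<le> \<eta>"
      using d1(2)[of w] w by (auto simp: dist_norm norm_minus_commute)
  qed (use xy in auto)
  moreover have "ball z ?d \<subseteq> U" using d2 by auto
  ultimately show ?thesis using that[of ?d] d1 d2 by auto
qed

theorem theorem6p2:
  fixes p q :: "complex poly"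
  assumes "q \<noteq> 0" and "coprime p q"
  shows "\<exists>\<Omega>0. unbounded_quadrature_domain \<Omega>0 (rat_fun p q) (\<lambda>z. poly q z = 0)
              \<and> enat (card (attracting_fixed_points p q)) \<le> connectivity \<Omega>0"
proof (cases "card (attracting_fixed_points p q) = 0")
  \<comment> \<open>\<open>card\<close> is 0 for an infinite set as well, so finiteness is at hand
    in the other case.\<close>
  case True
  then show ?thesis using unbounded_quadrature_domain_UNIV by (auto simp: zero_enat_def[symmetric])
next
  case False
  define Att where "Att = attracting_fixed_points p q"
  define n where "n = card Att"
  define r where "r = rat_fun p q"
  have n0: "0 < n" using False by (simp add: n_def Att_def)
  then have fin: "finite Att" unfolding n_def using card_gt_0_iff by blast
  obtain a where a: "bij_betw a {..<n} Att"
    using ex_bij_betw_nat_finite[OF fin] by (auto simp: n_def atLeast0LessThan)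
  have aP: "a j \<in> Att" if "j < n" for j using a that by (auto simp: bij_betw_def)
  define U where "U = {z. poly q z \<noteq> 0}"
  have U: "open U" unfolding U_def by (intro open_Collect_neq continuous_intros)
  have hol: "r holomorphic_on U" unfolding r_def rat_fun_def U_def by (intro holomorphic_intros) auto
  define \<alpha> where "\<alpha> j = deriv r (a j)" for j
  have aj: "a j \<in> U" "r (a j) = cnj (a j)" "norm (\<alpha> j) < 1" if "j < n" for j
    using aP[OF that] by (auto simp: Att_def attracting_fixed_points_def U_def r_def \<alpha>_def)
  define A where "A = Max ((\<lambda>j. norm (\<alpha> j)) ` {..<n})"
  have A1: "A < 1" unfolding A_def using n0 aj(3) by (subst Max_less_iff) auto
  have A: "norm (\<alpha> j) \<le> A" if "j < n" for j unfolding A_def using that by (intro Max_ge) auto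
  have A0: "0 \<le> A" using order_trans[OF norm_ge_zero A[OF n0]] .
  \<comment> \<open>The inequality \<open>A * \<kappa> < 1\<close> amounts to
    \<open>1 < N\<^sup>2 (1 - A)\<close>, and here \<open>N\<^sup>2 (1 - A) = 2 N\<close>. The
    remaining constants are chosen in the order \<open>M\<close>, \<open>\<eta>\<close>,
    \<open>\<delta>\<close>, \<open>t\<close>, each in terms of the earlier ones.\<close>
  define N where "N = 2 / (1 - A)"
  have N: "2 \<le> N" using A0 A1 by (simp add: N_def field_simps)
  define \<kappa> where "\<kappa> = N\<^sup>2 / (N\<^sup>2 - 1)"
  have N4: "4 \<le> N\<^sup>2" using power_mono[OF N, of 2] by simp
  have \<kappa>: "0 < \<kappa>" "\<kappa> \<le> 2" using N4 by (auto simp: \<kappa>_def field_simps)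
  have A\<kappa>: "A * \<kappa> < 1"
  proof -
    have "N * (1 - A) = 2" using A1 unfolding N_def by (intro nonzero_eq_divide_eq[THEN iffD1, OF _ refl]) auto
    then have "1 < N * (N * (1 - A))" using N by simp
    then have "A * N\<^sup>2 < N\<^sup>2 - 1" by (simp add: power2_eq_square algebra_simps)
    then show ?thesis using N4 by (simp add: \<kappa>_def)
  qed
  define q1 where "q1 = (1 + A * \<kappa>) / 2"
  have q1: "q1 < 1" "0 \<le> q1" using A\<kappa> A0 \<kappa> by (auto simp: q1_def)
  \<comment> \<open>The solution of \<open>2 * N + q1 * M + 1 = M\<close>: in
    \<open>self_map\<close>, \<open>(A + \<eta>) * N \<le> 2 * N\<close>, and the influence of the
    other cells is at most 1.\<close>
  define M where "M = (2 * N + 1) / (1 - q1)"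
  have M: "0 < M" using N q1 by (simp add: M_def)
  \<comment> \<open>The three entries give \<open>A + \<eta> \<le> 2\<close>,
    \<open>(A + \<eta>) * \<kappa> \<le> q1\<close> (because \<open>\<kappa> \<le> 2\<close>), and
    an error of at most \<open>(1 - A) / 8\<close> in the derivative bound.\<close>
  define \<eta> where "\<eta> = min 1 (min ((1 - A * \<kappa>) / 4) ((1 - A) / (8 * (N + 2 * M))))"
  have \<eta>: "0 < \<eta>" "\<eta> \<le> 1" "\<eta> \<le> (1 - A * \<kappa>) / 4" "\<eta> \<le> (1 - A) / (8 * (N + 2 * M))"
  proof -
    show "0 < \<eta>" unfolding \<eta>_def using A\<kappa> A1 N M by simp
  qed (unfold \<eta>_def, rule min.cobounded1, rule order_trans[OF min.cobounded2 min.cobounded1],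
      rule order_trans[OF min.cobounded2 min.cobounded2])
  have \<eta>3: "\<eta> * (N + 2 * M) \<le> (1 - A) / 8"
  proof -
    have "0 < 8 * (N + 2 * M)" using N M by (intro mult_pos_pos add_pos_pos) auto
    then have "\<eta> * (8 * (N + 2 * M)) \<le> 1 - A" using \<eta>(4) by (simp only: pos_le_divide_eq)
    then show ?thesis by (simp only: mult.left_commute[of \<eta>]) simp
  qed
  have \<eta>2: "(A + \<eta>) * \<kappa> \<le> q1"
  proof -
    have "\<eta> * \<kappa> \<le> (1 - A * \<kappa>) / 4 * 2" using \<eta> \<kappa> A\<kappa> by (intro mult_mono) auto
    then show ?thesis by (simp add: q1_def algebra_simps)
  qed
  have "\<forall>j\<in>{..<n}. \<exists>d>0. ball (a j) d \<subseteq> U \<and>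
      (\<forall>x\<in>ball (a j) d. \<forall>y\<in>ball (a j) d. norm ((r x - \<alpha> j * x) - (r y - \<alpha> j * y)) \<le> \<eta> * norm (x - y)) \<and>
      (\<forall>x\<in>Att. x \<noteq> a j \<longrightarrow> d \<le> dist (a j) x)"
  proof
    fix j assume "j \<in> {..<n}"
    then have j: "j < n" by simp
    obtain d1 where d1: "0 < d1" "ball (a j) d1 \<subseteq> U"
      "\<And>x y. x \<in> ball (a j) d1 \<Longrightarrow> y \<in> ball (a j) d1 \<Longrightarrow>
       norm ((r x - \<alpha> j * x) - (r y - \<alpha> j * y)) \<le> \<eta> * norm (x - y)"
      using derivative_near_Lipschitz[OF hol U aj(1)[OF j] \<eta>(1)] unfolding \<alpha>_def by blast
    obtain d2 where d2: "0 < d2" "\<forall>x\<in>Att. x \<noteq> a j \<longrightarrow> d2 \<le> dist (a j) x"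
      using finite_set_avoid[OF fin, of "a j"] by blast
    show "\<exists>d>0. ball (a j) d \<subseteq> U \<and>
      (\<forall>x\<in>ball (a j) d. \<forall>y\<in>ball (a j) d. norm ((r x - \<alpha> j * x) - (r y - \<alpha> j * y)) \<le> \<eta> * norm (x - y)) \<and>
      (\<forall>x\<in>Att. x \<noteq> a j \<longrightarrow> d \<le> dist (a j) x)"
      using d1 d2 by (intro exI[of _ "min d1 d2"]) (auto intro: min.coboundedI2)
  qed
  then obtain D where D': "\<forall>j\<in>{..<n}. 0 < D j \<and> ball (a j) (D j) \<subseteq> U \<and>
      (\<forall>x\<in>ball (a j) (D j). \<forall>y\<in>ball (a j) (D j). norm ((r x - \<alpha> j * x) - (r y - \<alpha> j * y)) \<le> \<eta> * norm (x - y)) \<and>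
      (\<forall>x\<in>Att. x \<noteq> a j \<longrightarrow> D j \<le> dist (a j) x)"
    by (rule bchoice[THEN exE])
  have D: "\<And>j. j < n \<Longrightarrow> 0 < D j" "\<And>j. j < n \<Longrightarrow> ball (a j) (D j) \<subseteq> U"
    "\<And>j x y. j < n \<Longrightarrow> x \<in> ball (a j) (D j) \<Longrightarrow> y \<in> ball (a j) (D j) \<Longrightarrow>
       norm ((r x - \<alpha> j * x) - (r y - \<alpha> j * y)) \<le> \<eta> * norm (x - y)"
    "\<And>j x. j < n \<Longrightarrow> x \<in> Att \<Longrightarrow> x \<noteq> a j \<Longrightarrow> D j \<le> dist (a j) x"
    using D' by blast+
  \<comment> \<open>Distinct fixed points are at least \<open>D j\<close> apart; the quarter
    produces the separation \<open>4 * \<delta>\<close>.\<close>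
  define \<delta> where "\<delta> = Min (D ` {..<n}) / 4"
  have Min_pos: "0 < Min (D ` {..<n})" using n0 D(1) by (subst Min_gr_iff) auto
  have \<delta>: "0 < \<delta>" using Min_pos by (simp add: \<delta>_def)
  have \<delta>D: "4 * \<delta> \<le> D j" if "j < n" for j unfolding \<delta>_def using that by simp
  have ball_sub: "ball (a j) \<delta> \<subseteq> ball (a j) (D j)" if "j < n" for j
    using \<delta>D[OF that] \<delta> by (intro subset_ball) auto
  \<comment> \<open>\<open>CB\<close> and \<open>CL\<close> are the coefficients of \<open>t\<close>
    in the bound for the influence of the other cells and in its Lipschitz constant.\<close>
  define CB where "CB = real n * ((1 + 2 * M)\<^sup>2 / (2 * \<delta>))"
  define CL where "CL = real n * (4 * (1 + 2 * M) / (2 * \<delta>) + (1 + 2 * M)\<^sup>2 * 4 / (2 * \<delta>)\<^sup>2)"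
  obtain t where t: "0 < t" "t \<le> 1" "t * (N + 2 * M) < \<delta>" "t * CB < (1 - A) / 8" "t * CL < (1 - q1) / 2"
  proof -
    have "0 < (1 - A) / 8" "0 < (1 - q1) / 2" using A1 q1 by auto
    from ex_small_scale[OF \<delta> this, where x = "N + 2 * M" and y = CB and z = CL]
    show ?thesis using that by blast
  qed
  have tCB1: "t * CB \<le> 1" using t(4) A0 by simp
  \<comment> \<open>Both constants are midpoints: \<open>q1 + (1 - q1) / 2\<close> for the
    contraction, and \<open>A + 2 * ((1 - A) / 8 + (1 - A) / 8)\<close> for the Lipschitz
    bound.\<close>
  interpret attracting_data n a \<alpha> r N M t \<delta> \<eta> A "(1 + q1) / 2" "(1 + A) / 2"
  proof (unfold_locales)
    fix i j assume "i < n" "j < n" "i \<noteq> j"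
    then have "a j \<noteq> a i" using a by (auto simp: bij_betw_def inj_on_def)
    then show "4 * \<delta> \<le> norm (a i - a j)"
      using D(4)[of i "a j"] \<delta>D[of i] aP[of j] \<open>i < n\<close> \<open>j < n\<close> by (simp add: dist_norm)
  next
    fix j assume j: "j < n"
    show "r holomorphic_on ball (a j) \<delta>"
      using D(2)[OF j] ball_sub[OF j] by (intro holomorphic_on_subset[OF hol]) blast
    show "r (a j) = cnj (a j)" by (rule aj(2)[OF j])
    show "norm (\<alpha> j) \<le> A" by (rule A[OF j])
    show "norm ((r x - \<alpha> j * x) - (r y - \<alpha> j * y)) \<le> \<eta> * norm (x - y)"
      if "x \<in> ball (a j) \<delta>" "y \<in> ball (a j) \<delta>" for x y
      using that ball_sub[OF j] by (intro D(3)[OF j]) auto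
  next
    have "(A + \<eta>) * (N + \<kappa> * M) + t * CB = (A + \<eta>) * N + ((A + \<eta>) * \<kappa>) * M + t * CB"
      by (simp add: algebra_simps)
    also have "\<dots> \<le> 2 * N + q1 * M + 1"
      using \<eta>2 tCB1 A1 \<eta>(2) N M by (intro add_mono mult_right_mono) auto
    also have "\<dots> = M" using q1 by (simp add: M_def field_simps)
    finally show "(A + \<eta>) * (N + N\<^sup>2 / (N\<^sup>2 - 1) * M) + t * (real n * ((1 + 2 * M)\<^sup>2 / (2 * \<delta>))) \<le> M"
      by (simp add: CB_def \<kappa>_def)
  next
    have "(A + \<eta>) * \<kappa> + t * CL \<le> (1 + q1) / 2" using \<eta>2 t(5) by (simp add: field_simps)
    then show "(A + \<eta>) * (N\<^sup>2 / (N\<^sup>2 - 1)) +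
         t * (real n * (4 * (1 + 2 * M) / (2 * \<delta>) + (1 + 2 * M)\<^sup>2 * 4 / (2 * \<delta>)\<^sup>2)) \<le> (1 + q1) / 2"
      by (simp add: CL_def \<kappa>_def)
  next
    have "A + 2 * (\<eta> * (N + 2 * M) + t * CB) \<le> (1 + A) / 2" using \<eta>3 t(4) by (simp add: field_simps)
    then show "A + 2 * (\<eta> * (N + 2 * M) + t * (real n * ((1 + 2 * M)\<^sup>2 / (2 * \<delta>)))) \<le> (1 + A) / 2"
      by (simp add: CB_def)
  qed (use N M t \<delta> \<eta> A0 A1 q1 in auto)
  have "z \<notin> ball (a j) \<delta>" if "poly q z = 0" "j < n" for z j
    using D(2)[OF that(2)] ball_sub[OF that(2)] that(1) by (auto simp: U_def)
  then show ?thesis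
    using ex_quadrature_domain[of "\<lambda>z. poly q z = 0"] n0
    unfolding Att_def[symmetric] n_def[symmetric] r_def[symmetric] by blast
qed

end
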